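(* Let $p_1,\dots,p_\ell$ be distinct odd primes, let $h=p_1p_2\cdots p_\ell$, and let $1\le m\le \ell$. Let $p$ be a prime with $p\nmid h$ and $\gcd(h,p-1)=1$, such that for every divisor $d=p_{i_1}\cdots p_{i_r}$ of $h$, if $\langle p\rangle$ has index $u$ in $(\mathbb{Z}/d\mathbb{Z})^\ast$ then $\langle p\rangle$ also has index $u$ in $(\mathbb{Z}/d'\mathbb{Z})^\ast$ for every $d'=p_{i_1}^{x_1}\cdots p_{i_r}^{x_r}$ with all $x_i\ge 1$. Let $e=[(\mathbb{Z}/h\mathbb{Z})^\ast:\langle p\rangle]$. Let $k=p_1^{e_1}\cdots p_m^{e_m}p_{m+1}p_{m+2}\cdots p_\ell$ with $e_i\ge 1$ for $1\le i\le m$, and assume $\langle p\rangle$ has index $e$ in $(\mathbb{Z}/k\mathbb{Z})^\ast$. Put $q_1=p^{d}$ and $q=p^{f}$ with $d=\phi(h)/e$ and $f=\phi(k)/e$. For $1\le j\le m$ put $h_j=\prod_{1\le i\le \ell,\, i\ne j}p_i$ and assume there is an integer $s_j$ with $p^{s_j}\equiv -1 \pmod{h_j}$. For $1\le j\le m$ put $n_j=\prod_{1\le i\le \ell,\, i\ne j}p_i^{e_i}$ (with $e_i=1$ for $i>m$), and let \[ D=\bigcup_{i_1=0}^{p_1^{e_1-1}-1}\cdots\bigcup_{i_m=0}^{p_m^{e_m-1}-1}C^{(k,q)}_{i_1n_1+\cdots+i_mn_m}. \] If the Cayley graph $\mathrm{Cay}(\mathbb{F}_{q_1},C_0^{(h,q_1)})$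 is strongly regular, then $\mathrm{Cay}(\mathbb{F}_q,D)$ is strongly regular.
   Context: $\phi$ is Euler's totient function. For a prime power $Q$, an integer $N>1$ with $N\mid Q-1$, and a fixed primitive element $\gamma$ of $\mathbb{F}_Q$, the cyclotomic classes of order $N$ are $C_i^{(N,Q)}=\gamma^i\langle\gamma^N\rangle$, $0\le i\le N-1$ (indices read modulo $N$). For an additive group $G$ and $S\subseteq G$ with $0\notin S$, $-S=S$, the Cayley graph $\mathrm{Cay}(G,S)$ has vertex set $G$, with $x,y$ adjacent iff $x-y\in S$. A graph is strongly regular with parameters $(v,k,\lambda,\mu)$ if it is $k$-regular on $v$ vertices, any two adjacent vertices have $\lambda$ common neighbours and any two distinct non-adjacent vertices have $\mu$ common neighbours. *)

theory Defs
  imports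
    "HOL-Algebra.Generated_Groups"
    "HOL-Library.FuncSet"
    "HOL-Library.Cardinality"
    "Graph_Theory.Pair_Digraph"
    "HOL-Number_Theory.Number_Theory"
begin

text \<open>
  The index of \<open>\<langle>a\<rangle>\<close> in \<open>(\<int>/n\<int>)\<^sup>*\<close>, counted as the number of cosets. Meaningful for
  \<open>n > 1\<close> and \<open>a\<close> coprime to \<open>n\<close>: \<^const>\<open>residue_ring\<close> is not a ring for \<open>n = 1\<close>.
\<close>

definition unit_index :: "nat \<Rightarrow> nat \<Rightarrow> nat" where
  "unit_index n a =
    (let U = units_of (residue_ring (int n))
     in card (rcosets\<^bsub>U\<^esub> (generate U {int a mod int n})))"

text \<open>
  A nonzero element generating the multiplicative group; \<open>0\<close> is excluded because
  \<open>range ((powi) 0) = {0, 1}\<close>.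
\<close>

definition primitive_element :: "'a::finite_field \<Rightarrow> bool" where
  "primitive_element \<gamma> \<longleftrightarrow> range (\<lambda>j::int. \<gamma> powi j) = UNIV - {0}"

text \<open>
  The cyclotomic class \<open>C\<^sub>i\<close> of order \<open>N\<close> with respect to \<open>\<gamma>\<close>, i.e. \<open>\<gamma>\<^sup>i\<langle>\<gamma>\<^sup>N\<rangle>\<close>. When \<open>N\<close>
  divides the order of \<open>\<gamma>\<close>, it depends on \<open>i\<close> only modulo \<open>N\<close>, so \<open>i\<close> need not be reduced.
\<close>

definition cyclotomic_class :: "'a::finite_field \<Rightarrow> nat \<Rightarrow> nat \<Rightarrow> 'a set" where
  "cyclotomic_class \<gamma> N i = (\<lambda>y. \<gamma> ^ i * y) ` range (\<lambda>j::int. (\<gamma> ^ N) powi j)"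

definition cayley_graph :: "'a::group_add set \<Rightarrow> 'a pair_pre_digraph" where
  "cayley_graph S = \<lparr>pverts = UNIV, parcs = {(x, y). x - y \<in> S}\<rparr>"

text \<open>
  A simple graph is a \<^locale>\<open>pair_graph\<close>: finite, loopless, with a symmetric arc relation.
  For a Cayley graph, this amounts to \<open>0 \<notin> S\<close> and \<open>-S = S\<close>.
\<close>

definition common_neighbours :: "'a pair_pre_digraph \<Rightarrow> 'a \<Rightarrow> 'a \<Rightarrow> 'a set" where
  "common_neighbours G x y = {z \<in> pverts G. (x, z) \<in> parcs G \<and> (y, z) \<in> parcs G}"

definition strongly_regular_with ::
    "'a pair_pre_digraph \<Rightarrow> nat \<Rightarrow> nat \<Rightarrow> nat \<Rightarrow> nat \<Rightarrow> bool" where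
  "strongly_regular_with G v k l \<mu> \<longleftrightarrow>
     pair_graph G \<and>
     card (pverts G) = v \<and>
     (\<forall>x\<in>pverts G. card {y \<in> pverts G. (x, y) \<in> parcs G} = k) \<and>
     (\<forall>x\<in>pverts G. \<forall>y\<in>pverts G. (x, y) \<in> parcs G \<longrightarrow>
        card (common_neighbours G x y) = l) \<and>
     (\<forall>x\<in>pverts G. \<forall>y\<in>pverts G. x \<noteq> y \<and> (x, y) \<notin> parcs G \<longrightarrow>
        card (common_neighbours G x y) = \<mu>)"

definition strongly_regular :: "'a pair_pre_digraph \<Rightarrow> bool" where
  "strongly_regular G \<longleftrightarrow> (\<exists>v k l \<mu>. strongly_regular_with G v k l \<mu>)"

end

theory Submission
  imports Defs
    "HOL-Computational_Algebra.Polynomial_FPS"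
    "Jordan_Normal_Form.Char_Poly"
begin

text \<open>
  A Cayley graph on a finite field is strongly regular iff the nontrivial character sums over its
  connection set take at most two values. Every translate \<open>uD\<close> meets the subfield of order \<open>q\<^sub>1\<close> in a
  coset of the \<open>h\<close>-th powers, and the character sum over \<open>uD\<close> turns out to be \<open>C a + (C - 1) / h\<close>, where
  \<open>a\<close> is the character sum over that coset and \<open>C = q\<^sub>1\<^bsup>(M - 1) / 2\<^esup>\<close>, \<open>M = k / h\<close>; so two values over the
  subfield give two values over the large field.

  Expanding the indicator of \<open>D\<close> in the characters of order dividing \<open>k\<close>, the union over the shifts kills
  every character whose order contains some \<open>P\<^sub>i\<close> to a power strictly between \<open>0\<close> and \<open>e\<^sub>i\<close>. For the
  others the Gauss sum over the large field is \<open>C\<close> times the one over the subfield. This is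
  shown by climbing through extensions of prime degree \<open>P\<close> over fields of order \<open>Q\<close>, each contributing a
  factor \<open>Q\<^bsup>(P - 1) / 2\<^esup>\<close>.
  If \<open>P\<close> divides the order of \<open>\<chi>\<close>, this is a product formula of Hasse--Davenport type, proved by
  Newton's identity for an L-function of polynomials over the small field. If it does not, some
  power of \<open>p\<close> is \<open>-1\<close> modulo the order, so both Gauss sums are real and equal up to sign to a power of
  \<open>\<surd>Q\<close>; the sign is found from a congruence modulo \<open>P\<close>.
\<close>

section \<open>Polynomials over a subfield\<close>

text \<open>All intermediate fields sit inside one fixed finite field as solution sets of
  \<open>x ^ Q = x\<close>, because a type cannot depend on the degree reached in the climb. The
  given field of order \<open>q1\<close> is identified with such a set only at the end. The obstacle
  is that the characters of order dividing \<open>k\<close> are in general not lifts by the norm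
  from the small field, so the usual Hasse--Davenport lifting does not apply to them. The hypotheses
  enter in three ways. Stability of the index prevents \<open>P i ^ Suc (ex i)\<close> from dividing
  \<open>q - 1\<close>, so the exact power of \<open>P i\<close> at the top is known.
  \<open>gcd h (p - 1) = 1\<close> makes the characters trivial on the prime field, so their values
  at -1 and at \<open>P\<close>, which turn up in each step, are 1. Only the \<open>P j\<close> with
  \<open>j \<le> m\<close> divide \<open>M\<close>, and these are the degrees of the steps; so -1
  must be a power of \<open>p\<close> modulo exactly the corresponding \<open>h_j\<close>. The
  constant \<open>(C - 1) / h\<close> stems from the trivial character, whose Gauss sum is -1 in
  both fields instead of being multiplied by \<open>C\<close>.\<close>

locale subfield_set =
  fixes K :: "'b::finite_field set"
  assumes zero_K [simp]: "0 \<in> K" and one_K [simp]: "1 \<in> K"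
    and add_K: "x \<in> K \<Longrightarrow> y \<in> K \<Longrightarrow> x + y \<in> K"
    and uminus_K: "x \<in> K \<Longrightarrow> - x \<in> K"
    and mult_K: "x \<in> K \<Longrightarrow> y \<in> K \<Longrightarrow> x * y \<in> K"
    and inverse_K: "x \<in> K \<Longrightarrow> inverse x \<in> K"
begin

lemma diff_K: "x \<in> K \<Longrightarrow> y \<in> K \<Longrightarrow> x - y \<in> K"
  using add_K uminus_K by (metis diff_conv_add_uminus)

lemma divide_K: "x \<in> K \<Longrightarrow> y \<in> K \<Longrightarrow> x / y \<in> K"
  using mult_K inverse_K by (simp add: divide_inverse)

lemma sum_K: "(\<And>i. i \<in> A \<Longrightarrow> f i \<in> K) \<Longrightarrow> sum f A \<in> K"
  by (induction A rule: infinite_finite_induct) (auto intro: add_K)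

lemma power_K: "x \<in> K \<Longrightarrow> x ^ n \<in> K"
  by (induction n) (auto intro: mult_K)

definition Kpoly :: "'b poly set" where
  "Kpoly = {F. \<forall>i. coeff F i \<in> K}"

lemma Kpoly_0 [simp]: "0 \<in> Kpoly" and Kpoly_1 [simp]: "1 \<in> Kpoly"
  by (auto simp: Kpoly_def coeff_1)

lemma Kpoly_add: "F \<in> Kpoly \<Longrightarrow> G \<in> Kpoly \<Longrightarrow> F + G \<in> Kpoly"
  by (auto simp: Kpoly_def intro: add_K)

lemma Kpoly_diff: "F \<in> Kpoly \<Longrightarrow> G \<in> Kpoly \<Longrightarrow> F - G \<in> Kpoly"
  by (auto simp: Kpoly_def intro: diff_K)

lemma Kpoly_mult: "F \<in> Kpoly \<Longrightarrow> G \<in> Kpoly \<Longrightarrow> F * G \<in> Kpoly"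
  by (auto simp: Kpoly_def coeff_mult intro!: sum_K mult_K)

lemma Kpoly_monom: "c \<in> K \<Longrightarrow> monom c n \<in> Kpoly"
  by (auto simp: Kpoly_def)

text \<open>Long division never leaves \<open>K\<close>, since each step only divides one leading
  coefficient by another. It supplies the Euclidean argument in \<open>uirr_bezout\<close>.\<close>

lemma Kpoly_division:
  assumes "F \<in> Kpoly" "D \<in> Kpoly" "D \<noteq> 0"
  shows "\<exists>u\<in>Kpoly. \<exists>r\<in>Kpoly. F = u * D + r \<and> (r = 0 \<or> degree r < degree D)"
  using assms(1)
proof (induction "degree F" arbitrary: F rule: less_induct)
  case less
  show ?case
  proof (cases "F = 0 \<or> degree F < degree D")
    case True
    then show ?thesis using less.prems by (intro bexI[of _ 0] bexI[of _ F]) auto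
  next
    case False
    define c where "c = lead_coeff F / lead_coeff D"
    define T where "T = monom c (degree F - degree D)"
    have c: "c \<in> K" using less.prems assms by (auto simp: c_def Kpoly_def intro: divide_K)
    have T: "T \<in> Kpoly" using c by (auto simp: T_def intro: Kpoly_monom)
    define F' where "F' = F - T * D"
    have F': "F' \<in> Kpoly" unfolding F'_def using less.prems assms T by (intro Kpoly_diff Kpoly_mult)
    have c0: "c \<noteq> 0" using False assms by (auto simp: c_def)
    have dT: "degree (T * D) = degree F"
      using False c0 assms by (subst degree_mult_eq) (auto simp: T_def degree_monom_eq monom_eq_0_iff)
    have "lead_coeff (T * D) = lead_coeff F"
      unfolding lead_coeff_mult using c0 assms by (simp add: T_def degree_monom_eq c_def)
    then have lc: "coeff F' (degree F) = 0" by (simp add: F'_def dT)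
    have le: "degree F' \<le> degree F" unfolding F'_def using dT by (simp add: degree_diff_le)
    show ?thesis
    proof (cases "F' = 0")
      case True
      then have "F = T * D + 0" by (simp add: F'_def)
      then show ?thesis using T by (intro bexI[of _ T] bexI[of _ 0]) auto
    next
      case F'0: False
      have "degree F' < degree F"
        using le lc F'0 by (metis le_neq_implies_less leading_coeff_0_iff)
      from less.hyps[OF this F'] obtain u r where ur: "u \<in> Kpoly" "r \<in> Kpoly" "F' = u * D + r"
        "r = 0 \<or> degree r < degree D" by auto
      have "F = (u + T) * D + r" using ur(3) by (simp add: F'_def algebra_simps)
      then show ?thesis using ur T Kpoly_add by blast
    qed
  qed
qed

text \<open>
  The reciprocals of the roots play the role of the roots, so the constant coefficient is
  normalised instead of the leading one.
\<close>

definition upoly :: "'b poly set" where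
  "upoly = {F \<in> Kpoly. coeff F 0 = 1}"

lemma upoly_nz: "F \<in> upoly \<Longrightarrow> F \<noteq> 0"
  by (auto simp: upoly_def)

lemma upoly_1 [simp]: "1 \<in> upoly"
  by (auto simp: upoly_def)

lemma upoly_mult: "F \<in> upoly \<Longrightarrow> G \<in> upoly \<Longrightarrow> F * G \<in> upoly"
  by (auto simp: upoly_def coeff_mult intro!: Kpoly_mult)

lemma upoly_power: "F \<in> upoly \<Longrightarrow> F ^ n \<in> upoly"
  by (induction n) (auto intro: upoly_mult)

lemma upoly_degree_0: "F \<in> upoly \<Longrightarrow> degree F = 0 \<Longrightarrow> F = 1"
  by (auto simp: upoly_def elim!: degree_eq_zeroE)

lemma upoly_degree_mult: "F \<in> upoly \<Longrightarrow> G \<in> upoly \<Longrightarrow> degree (F * G) = degree F + degree G"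
  using upoly_nz degree_mult_eq by blast

text \<open>Constant term 1 makes division a recursion without denominators: each coefficient of
  \<open>h\<close> is one of \<open>g * h\<close> minus products with earlier coefficients of
  \<open>h\<close>. Divisibility in the ambient ring therefore descends to \<open>K\<close>.\<close>

lemma upoly_cancel:
  assumes g: "g \<in> upoly" and gh: "g * h \<in> upoly"
  shows "h \<in> upoly"
proof -
  have 0: "coeff h 0 = 1" using g gh by (auto simp: upoly_def coeff_mult)
  have "coeff h n \<in> K" for n
  proof (induction n rule: less_induct)
    case (less n)
    have "coeff (g * h) n = (\<Sum>i\<le>n. coeff g i * coeff h (n - i))" by (simp add: coeff_mult)
    also have "\<dots> = coeff h n + (\<Sum>i\<in>{1..n}. coeff g i * coeff h (n - i))"
    proof -
      have "{..n} = insert 0 {1..n}" by auto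
      then show ?thesis using g by (simp add: upoly_def)
    qed
    finally have "coeff h n = coeff (g * h) n - (\<Sum>i\<in>{1..n}. coeff g i * coeff h (n - i))" by simp
    moreover have "(\<Sum>i\<in>{1..n}. coeff g i * coeff h (n - i)) \<in> K"
      using g less by (intro sum_K mult_K) (auto simp: upoly_def Kpoly_def)
    ultimately show ?case using gh by (auto simp: upoly_def Kpoly_def intro: diff_K)
  qed
  then show ?thesis using 0 by (auto simp: upoly_def Kpoly_def)
qed

text \<open>Irreducibility over \<open>K\<close> only; over the ambient field such a polynomial may
  factor. The variable itself is absent, having constant term 0.\<close>

definition uirr :: "'b poly \<Rightarrow> bool" where
  "uirr g \<longleftrightarrow> g \<in> upoly \<and> degree g > 0 \<and>
     (\<forall>a\<in>upoly. \<forall>b\<in>upoly. g = a * b \<longrightarrow> degree a = 0 \<or> degree b = 0)"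

lemma uirr_dvd:
  assumes "uirr g" "d \<in> upoly" "d dvd g"
  shows "d = 1 \<or> d = g"
proof -
  from assms(3) obtain b where b: "g = d * b" by (rule dvdE)
  have "b \<in> upoly" using upoly_cancel[of d b] assms b by (auto simp: uirr_def)
  then have "degree d = 0 \<or> degree b = 0" using assms b by (auto simp: uirr_def)
  then show ?thesis using upoly_degree_0 \<open>b \<in> upoly\<close> assms(2) b by auto
qed

text \<open>A nonzero element of least degree in the ideal of \<open>g\<close> and \<open>g'\<close>
  over \<open>K\<close> divides both. Its constant term is nonzero because it divides
  \<open>g\<close>, so it can be normalised, and irreducibility leaves only 1.\<close>

lemma uirr_bezout:
  assumes g: "uirr g" and g': "uirr g'" and ne: "g \<noteq> g'"
  shows "\<exists>u v. u * g + v * g' = 1"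
proof -
  define I where "I = {u * g + v * g' |u v. u \<in> Kpoly \<and> v \<in> Kpoly}"
  have gK: "g \<in> Kpoly" "g' \<in> Kpoly" using g g' by (auto simp: uirr_def upoly_def)
  have "1 * g + 0 * g' \<in> I" unfolding I_def using Kpoly_0 Kpoly_1 by blast
  then have gI: "g \<in> I" by simp
  have "0 * g + 1 * g' \<in> I" unfolding I_def using Kpoly_0 Kpoly_1 by blast
  then have g'I: "g' \<in> I" by simp
  have "\<exists>D. D \<in> I \<and> D \<noteq> 0" using gI upoly_nz g by (auto simp: uirr_def)
  then obtain D where D: "D \<in> I" "D \<noteq> 0" "\<And>E. E \<in> I \<Longrightarrow> E \<noteq> 0 \<Longrightarrow> degree D \<le> degree E"
    using ex_has_least_nat[of "\<lambda>D. D \<in> I \<and> D \<noteq> 0" _ degree] by metis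
  from D(1) obtain u0 v0 where D0: "D = u0 * g + v0 * g'" "u0 \<in> Kpoly" "v0 \<in> Kpoly"
    by (auto simp: I_def)
  have DK: "D \<in> Kpoly" using D0 gK by (auto intro: Kpoly_add Kpoly_mult)
  have dvd: "D dvd F" if "F \<in> I" "F \<in> Kpoly" for F
  proof -
    from that(1) obtain u1 v1 where F: "F = u1 * g + v1 * g'" "u1 \<in> Kpoly" "v1 \<in> Kpoly"
      by (auto simp: I_def)
    from Kpoly_division[OF that(2) DK D(2)] obtain w r where
      w: "w \<in> Kpoly" "r \<in> Kpoly" "F = w * D + r" "r = 0 \<or> degree r < degree D" by auto
    have "r = (u1 - w * u0) * g + (v1 - w * v0) * g'"
      using w(3) F(1) D0(1) by (simp add: algebra_simps)
    then have "r \<in> I" unfolding I_def using w F D0 by (blast intro: Kpoly_diff Kpoly_mult)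
    then have "r = 0" using D(3) w(4) by force
    then show ?thesis using w(3) by simp
  qed
  have Dg: "D dvd g" "D dvd g'" using dvd gI g'I gK by auto
  have nz0: "coeff D 0 \<noteq> 0"
  proof
    assume "coeff D 0 = 0"
    moreover obtain b where "g = D * b" using Dg(1) by (rule dvdE)
    ultimately have "coeff g 0 = 0" by (simp add: coeff_mult)
    then show False using g by (simp add: uirr_def upoly_def)
  qed
  define E where "E = smult (inverse (coeff D 0)) D"
  have E: "E \<in> upoly" unfolding upoly_def
    using nz0 DK by (auto simp: E_def Kpoly_def intro!: mult_K inverse_K)
  have "E dvd g" "E dvd g'" using Dg nz0 by (auto simp: E_def smult_dvd)
  then have E1: "E = 1" using uirr_dvd[OF g E] uirr_dvd[OF g' E] ne by auto
  have "smult (inverse (coeff D 0)) u0 * g + smult (inverse (coeff D 0)) v0 * g' = E"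
    using D0(1) by (simp add: E_def smult_add_right)
  then show ?thesis using E1 by blast
qed

text \<open>Write \<open>X = u * g * X + v * g' * X\<close>: by induction on the exponent the first
  term gains one more factor \<open>g\<close>, and the second has it by assumption.\<close>

lemma uirr_power_dvd_cancel:
  assumes g: "uirr g" and g': "uirr g'" and ne: "g \<noteq> g'" and d: "g ^ j dvd g' * F"
  shows "g ^ j dvd F"
proof -
  from uirr_bezout[OF g g' ne] obtain u v where uv: "u * g + v * g' = 1" by auto
  have *: "g ^ j dvd g' * X \<Longrightarrow> g ^ j dvd X" for X
  proof (induction j arbitrary: X)
    case (Suc j)
    from Suc.prems have "g ^ j dvd g' * X" by (metis dvd_trans dvd_triv_right power_Suc)
    then have "g ^ j dvd X" by (rule Suc.IH)
    then have "g ^ Suc j dvd u * g * X" by (metis mult.assoc mult_dvd_mono dvd_refl power_Suc dvd_mult)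
    moreover have "g ^ Suc j dvd v * g' * X" using Suc.prems by (metis dvd_mult mult.assoc)
    ultimately have "g ^ Suc j dvd (u * g + v * g') * X" by (simp add: distrib_right)
    then show ?case using uv by simp
  qed auto
  from *[OF d] show ?thesis .
qed

lemma uirr_divisor_exists:
  assumes "F \<in> upoly" "degree F > 0"
  shows "\<exists>g. uirr g \<and> g dvd F"
proof -
  obtain g where g: "g \<in> upoly" "degree g > 0" "g dvd F"
    and min: "\<And>h. h \<in> upoly \<Longrightarrow> degree h > 0 \<Longrightarrow> h dvd F \<Longrightarrow> degree g \<le> degree h"
    using ex_has_least_nat[of "\<lambda>g. g \<in> upoly \<and> degree g > 0 \<and> g dvd F" F degree] assms by auto
  have "uirr g" unfolding uirr_def
  proof (intro conjI ballI impI g(1,2))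
    fix a b assume ab: "a \<in> upoly" "b \<in> upoly" "g = a * b"
    show "degree a = 0 \<or> degree b = 0"
    proof (rule ccontr)
      assume "\<not> ?thesis"
      moreover have "degree g = degree a + degree b" using ab upoly_degree_mult by auto
      ultimately have "0 < degree a" "degree a < degree g" by auto
      moreover have "a dvd F" using ab g(3) by (metis dvd_mult_left)
      ultimately show False using min ab(1) by fastforce
    qed
  qed
  then show ?thesis using g by auto
qed

text \<open>
  The sum of \<open>degree g\<close> over these pairs is the degree of \<open>F\<close>; this replaces unique factorisation in
  the proof of Newton's identity below.
\<close>

definition fpairs :: "'b poly \<Rightarrow> ('b poly \<times> nat) set" where
  "fpairs F = {(g, j). uirr g \<and> j \<ge> 1 \<and> g ^ j dvd F}"

lemma uirr_degree_power: "uirr g \<Longrightarrow> degree (g ^ j) = j * degree g"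
  by (simp add: degree_power_eq uirr_def upoly_nz)

lemma uirrD: "uirr g \<Longrightarrow> g \<in> upoly" "uirr g \<Longrightarrow> degree g > 0"
  by (auto simp: uirr_def)

text \<open>An irreducible \<open>g\<close> occurs with every exponent from 1 up to its
  multiplicity. One more factor \<open>g0\<close> shifts the exponents of \<open>g0\<close> upwards
  and so frees the exponent 1.\<close>

lemma fpairs_mult:
  assumes g0: "uirr g0" and F: "F \<in> upoly"
  shows "fpairs (g0 * F) = insert (g0, 1) ((\<lambda>(g, j). if g = g0 then (g, Suc j) else (g, j)) ` fpairs F)"
    (is "?L = ?R")
proof (intro equalityI subsetI)
  fix x assume "x \<in> ?L"
  then obtain g j where x: "x = (g, j)" "uirr g" "j \<ge> 1" "g ^ j dvd g0 * F"
    by (auto simp: fpairs_def)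
  show "x \<in> ?R"
  proof (cases "g = g0")
    case True
    show ?thesis
    proof (cases "j = 1")
      case False
      then obtain i where i: "j = Suc i" "i \<ge> 1" using x(3) by (cases j) auto
      have "g0 ^ i dvd F" using x(4) True i g0 upoly_nz uirrD(1) by auto
      then have "(g0, i) \<in> fpairs F" using i g0 by (auto simp: fpairs_def)
      then show ?thesis using x True i by force
    qed (use x True in auto)
  next
    case False
    then have "(g, j) \<in> fpairs F" using uirr_power_dvd_cancel[OF x(2) g0 False x(4)] x by (auto simp: fpairs_def)
    then show ?thesis using x False by force
  qed
next
  fix x assume "x \<in> ?R"
  then show "x \<in> ?L"
    using g0 by (auto simp: fpairs_def split: if_splits)
qed

lemma fpairs_1: "fpairs 1 = {}"
proof -
  have False if "uirr g" "j \<ge> 1" "g ^ j dvd 1" for g j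
  proof -
    have "degree (g ^ j) = 0" using that(3) by (metis is_unit_iff_degree upoly_nz uirrD(1) that(1) power_not_zero)
    then show False using that uirrD(2)[OF that(1)] by (simp add: uirr_degree_power)
  qed
  then show ?thesis by (auto simp: fpairs_def)
qed

lemma fpairs_degree:
  assumes "F \<in> upoly"
  shows "finite (fpairs F) \<and> (\<Sum>(g, j)\<in>fpairs F. degree g) = degree F"
  using assms
proof (induction "degree F" arbitrary: F rule: less_induct)
  case less
  show ?case
  proof (cases "degree F = 0")
    case True
    then show ?thesis using upoly_degree_0[OF less.prems] by (simp add: fpairs_1)
  next
    case False
    then obtain g0 H where g0: "uirr g0" "F = g0 * H"
      using uirr_divisor_exists[OF less.prems] by (auto elim!: dvdE)
    have H: "H \<in> upoly" using upoly_cancel[of g0 H] g0 less.prems uirrD by auto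
    have dF: "degree F = degree g0 + degree H" using g0 H upoly_degree_mult uirrD by auto
    then have "degree H < degree F" using uirrD(2)[OF g0(1)] by auto
    note IH = less.hyps[OF this H]
    let ?f = "\<lambda>(g, j). if g = g0 then (g, Suc j) else (g, j)"
    have eq: "fpairs F = insert (g0, 1) (?f ` fpairs H)" using fpairs_mult[OF g0(1) H] g0(2) by simp
    have inj: "inj_on ?f (fpairs H)" by (auto simp: inj_on_def split: if_splits)
    have notin: "(g0, 1) \<notin> ?f ` fpairs H" by (auto simp: fpairs_def split: if_splits)
    have "(\<Sum>(g, j)\<in>fpairs F. degree g) = degree g0 + (\<Sum>x\<in>fpairs H. case ?f x of (g, j) \<Rightarrow> degree g)"
      unfolding eq using IH notin inj by (simp add: sum.reindex)
    also have "(\<Sum>x\<in>fpairs H. case ?f x of (g, j) \<Rightarrow> degree g) = (\<Sum>(g, j)\<in>fpairs H. degree g)"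
      by (intro sum.cong) (auto split: if_splits)
    finally show ?thesis using IH dF eq by simp
  qed
qed

section \<open>Newton's identity for multiplicative sums over polynomials of given degree\<close>

definition upoly_deg :: "nat \<Rightarrow> 'b poly set" where
  "upoly_deg n = {F \<in> upoly. degree F = n}"

lemma finite_coeff_polys:
  "finite {F :: 'b poly. degree F \<le> n}"
proof (rule finite_surj)
  show "finite {xs :: 'b list. set xs \<subseteq> UNIV \<and> length xs \<le> Suc n}"
    by (rule finite_lists_length_le) simp
  show "{F :: 'b poly. degree F \<le> n} \<subseteq> Poly ` {xs. set xs \<subseteq> UNIV \<and> length xs \<le> Suc n}"
  proof
    fix F :: "'b poly" assume "F \<in> {F. degree F \<le> n}"
    then have "length (coeffs F) \<le> Suc n" by (cases "F = 0") (auto simp: length_coeffs_degree)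
    then show "F \<in> Poly ` {xs. set xs \<subseteq> UNIV \<and> length xs \<le> Suc n}"
      by (intro image_eqI[of _ _ "coeffs F"]) auto
  qed
qed

lemma finite_upoly_deg [simp]: "finite (upoly_deg n)"
  by (rule finite_subset[OF _ finite_coeff_polys[of n]]) (auto simp: upoly_deg_def)

lemma upoly_deg_0: "upoly_deg 0 = {1}"
  using upoly_degree_0 by (auto simp: upoly_deg_def)

definition upairs :: "nat \<Rightarrow> ('b poly \<times> nat) set" where
  "upairs s = {(g, j). uirr g \<and> j \<ge> 1 \<and> j * degree g = s}"

lemma finite_upairs [simp]: "finite (upairs s)"
proof (rule finite_subset)
  show "upairs s \<subseteq> {F. degree F \<le> s} \<times> {..s}"
    using uirrD(2) by (fastforce simp: upairs_def)
  show "finite ({F::'b poly. degree F \<le> s} \<times> {..s})" using finite_coeff_polys by auto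
qed

text \<open>For completely multiplicative \<open>lam\<close> and the L-function
  \<open>L = (\<Sum>F. lam F * t ^ degree F)\<close>, this is the coefficient of
  \<open>t ^ s\<close> in \<open>t * L' / L\<close>, read off the Euler product over irreducible
  \<open>g\<close>.\<close>

definition psum :: "('b poly \<Rightarrow> complex) \<Rightarrow> nat \<Rightarrow> complex" where
  "psum lam s = (\<Sum>(g, j)\<in>upairs s. of_nat (degree g) * lam g ^ j)"

text \<open>Coefficient comparison in \<open>t * L' = (t * L' / L) * L\<close>, carried out by
  counting: \<open>degree F\<close> is spread over \<open>fpairs F\<close>, and each pair splits
  \<open>F\<close> as \<open>g ^ j * H\<close>.\<close>

lemma newton_upoly:
  fixes lam :: "'b poly \<Rightarrow> complex"
  assumes lam1: "lam 1 = 1"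
    and lam_mult: "\<And>F G. F \<in> upoly \<Longrightarrow> G \<in> upoly \<Longrightarrow> lam (F * G) = lam F * lam G"
  shows "of_nat n * (\<Sum>F\<in>upoly_deg n. lam F) =
    (\<Sum>s\<in>{1..n}. psum lam s * (\<Sum>F\<in>upoly_deg (n - s). lam F))"
proof -
  have lam_pow: "lam (g ^ j) = lam g ^ j" if "g \<in> upoly" for g j
    using that by (induction j) (auto simp: lam1 lam_mult upoly_power)
  have fin: "finite (fpairs F)" if "F \<in> upoly_deg n" for F
    using fpairs_degree that by (auto simp: upoly_deg_def)
  define T where "T = (SIGMA s:{1..n}. upairs s \<times> upoly_deg (n - s))"
  define to where "to = (\<lambda>(F, g, j). (j * degree g, (g :: 'b poly, j :: nat), F div g ^ j))"
  define fro where "fro = (\<lambda>(s :: nat, (g, j), H). (g ^ j * H, g :: 'b poly, j :: nat))"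
  define w1 where "w1 = (\<lambda>(F, g :: 'b poly, j :: nat). of_nat (degree g) * lam F)"
  define w2 where "w2 = (\<lambda>(s :: nat, (g :: 'b poly, j :: nat), H). of_nat (degree g) * (lam g ^ j * lam H))"
  have "of_nat n * (\<Sum>F\<in>upoly_deg n. lam F) = (\<Sum>F\<in>upoly_deg n. of_nat (degree F) * lam F)"
    unfolding sum_distrib_left by (intro sum.cong) (auto simp: upoly_deg_def)
  also have "\<dots> = (\<Sum>F\<in>upoly_deg n. \<Sum>gj\<in>fpairs F. w1 (F, gj))"
  proof (intro sum.cong refl)
    fix F assume "F \<in> upoly_deg n"
    then have "(of_nat (degree F) :: complex) = of_nat (\<Sum>(g, j)\<in>fpairs F. degree g)"
      using fpairs_degree by (auto simp: upoly_deg_def)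
    then show "of_nat (degree F) * lam F = (\<Sum>gj\<in>fpairs F. w1 (F, gj))"
      by (simp add: of_nat_sum case_prod_beta sum_distrib_right w1_def)
  qed
  also have "\<dots> = sum w1 (Sigma (upoly_deg n) fpairs)"
    by (subst sum.Sigma) (use fin in \<open>auto intro: sum.cong\<close>)
  also have "\<dots> = sum w2 T"
  proof (rule sum.reindex_bij_witness[of _ fro to])
    fix x assume "x \<in> Sigma (upoly_deg n) fpairs"
    then obtain F g j where x: "x = (F, g, j)" "F \<in> upoly" "degree F = n" "uirr g" "j \<ge> 1" "g ^ j dvd F"
      by (auto simp: upoly_deg_def fpairs_def)
    have FE: "F = g ^ j * (F div g ^ j)" using x(6) by simp
    have gj: "g ^ j \<in> upoly" using x(4) uirrD(1) upoly_power by auto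
    have H: "F div g ^ j \<in> upoly" using upoly_cancel[OF gj] FE x(2) by metis
    have dF: "n = j * degree g + degree (F div g ^ j)"
      using FE upoly_degree_mult[OF gj H] x(3,4) uirr_degree_power by metis
    show "fro (to x) = x" using x FE by (simp add: fro_def to_def)
    show "to x \<in> T"
      using x dF H uirrD(2)[OF x(4)] by (auto simp: T_def upairs_def upoly_deg_def Suc_le_eq to_def)
    have "lam F = lam g ^ j * lam (F div g ^ j)"
      using FE lam_mult[OF gj H] lam_pow[OF uirrD(1)[OF x(4)]] by metis
    then show "w2 (to x) = w1 x" using x by (simp add: w1_def w2_def to_def)
  next
    fix x assume "x \<in> T"
    moreover obtain s g j H where x: "x = (s, (g, j), H)" by (metis prod.exhaust)
    ultimately have x: "x = (s, (g, j), H)" "s \<in> {1..n}" "uirr g" "j \<ge> 1" "j * degree g = s"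
      "H \<in> upoly" "degree H = n - s"
      by (auto simp: T_def upairs_def upoly_deg_def)
    have nz: "g ^ j \<noteq> 0" using x(3) uirrD(1) upoly_nz by auto
    have gj: "g ^ j \<in> upoly" using x(3) uirrD(1) upoly_power by auto
    show "to (fro x) = x" using x nz by (simp add: to_def fro_def)
    show "fro x \<in> Sigma (upoly_deg n) fpairs"
      using x upoly_mult[OF gj] upoly_degree_mult[OF gj] uirr_degree_power[OF x(3)]
      by (auto simp: upoly_deg_def fpairs_def fro_def)
  qed
  also have "\<dots> = (\<Sum>s\<in>{1..n}. \<Sum>x\<in>upairs s \<times> upoly_deg (n - s). w2 (s, x))"
    unfolding T_def by (subst sum.Sigma) (auto intro: sum.cong)
  also have "\<dots> = (\<Sum>s\<in>{1..n}. psum lam s * (\<Sum>F\<in>upoly_deg (n - s). lam F))"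
    unfolding psum_def
    by (intro sum.cong refl) (simp add: sum_product sum.cartesian_product case_prod_beta mult.assoc w2_def)
  finally show ?thesis .
qed

lemma card_polys_coeffs:
  fixes X :: "nat \<Rightarrow> 'b set"
  shows "card {F :: 'b poly. (\<forall>i\<le>n. coeff F i \<in> X i) \<and> (\<forall>i>n. coeff F i = 0)} = (\<Prod>i\<le>n. card (X i))"
proof -
  have "bij_betw (\<lambda>F. restrict (coeff F) {..n})
     {F :: 'b poly. (\<forall>i\<le>n. coeff F i \<in> X i) \<and> (\<forall>i>n. coeff F i = 0)} (PiE {..n} X)"
  proof (rule bij_betwI')
    fix F G assume "F \<in> {F :: 'b poly. (\<forall>i\<le>n. coeff F i \<in> X i) \<and> (\<forall>i>n. coeff F i = 0)}"
      "G \<in> {F :: 'b poly. (\<forall>i\<le>n. coeff F i \<in> X i) \<and> (\<forall>i>n. coeff F i = 0)}"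
    then show "(restrict (coeff F) {..n} = restrict (coeff G) {..n}) = (F = G)"
      by (auto simp: poly_eq_iff restrict_def fun_eq_iff) (metis linorder_not_le)
  next
    fix F assume "F \<in> {F :: 'b poly. (\<forall>i\<le>n. coeff F i \<in> X i) \<and> (\<forall>i>n. coeff F i = 0)}"
    then show "restrict (coeff F) {..n} \<in> PiE {..n} X" by auto
  next
    fix c assume c: "c \<in> PiE {..n} X"
    define F where "F = (\<Sum>i\<le>n. monom (c i) i)"
    have co: "coeff F i = (if i \<le> n then c i else 0)" for i
      by (simp add: F_def coeff_sum)
    show "\<exists>F\<in>{F :: 'b poly. (\<forall>i\<le>n. coeff F i \<in> X i) \<and> (\<forall>i>n. coeff F i = 0)}. c = restrict (coeff F) {..n}"
      using c by (intro bexI[of _ F]) (auto simp: co PiE_def extensional_def restrict_def fun_eq_iff)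
  qed
  then show ?thesis by (simp add: bij_betw_same_card card_PiE)
qed

lemma card_upoly_deg:
  assumes "n > 0"
  shows "card (upoly_deg n) = (card K - 1) * card K ^ (n - 1)"
proof -
  define X where "X = (\<lambda>i. if i = 0 then {1} else if i = n then K - {0} else K)"
  have "upoly_deg n = {F :: 'b poly. (\<forall>i\<le>n. coeff F i \<in> X i) \<and> (\<forall>i>n. coeff F i = 0)}"
  proof (intro equalityI subsetI)
    fix F assume "F \<in> upoly_deg n"
    then show "F \<in> {F :: 'b poly. (\<forall>i\<le>n. coeff F i \<in> X i) \<and> (\<forall>i>n. coeff F i = 0)}"
      using assms by (auto simp: upoly_deg_def upoly_def Kpoly_def X_def coeff_eq_0)
  next
    fix F assume F: "F \<in> {F :: 'b poly. (\<forall>i\<le>n. coeff F i \<in> X i) \<and> (\<forall>i>n. coeff F i = 0)}"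
    then have "coeff F n \<in> X n" "coeff F 0 \<in> X 0" by auto
    then have n: "coeff F n \<noteq> 0" "coeff F 0 = 1" using assms by (auto simp: X_def)
    have "coeff F i \<in> K" for i
      using F by (cases "i \<le> n") (auto simp: X_def split: if_splits)
    moreover have "degree F = n" using F n(1)
      by (intro antisym degree_le le_degree) auto
    ultimately show "F \<in> upoly_deg n" using n by (auto simp: upoly_deg_def upoly_def Kpoly_def)
  qed
  then have "card (upoly_deg n) = (\<Prod>i\<le>n. card (X i))" by (simp add: card_polys_coeffs)
  also have "{..n} = insert 0 (insert n {1..n-1})" using assms by auto
  also have "(\<Prod>i\<in>\<dots>. card (X i)) = card (X 0) * (card (X n) * (\<Prod>i\<in>{1..n-1}. card (X i)))"
    using assms by (subst prod.insert; simp)+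
  also have "(\<Prod>i\<in>{1..n-1}. card (X i)) = (\<Prod>i\<in>{1..n-1}. card K)"
    by (intro prod.cong) (auto simp: X_def)
  finally show ?thesis using assms by (simp add: X_def card_Diff_singleton)
qed

lemma card_K_gt_1: "card K > 1"
proof -
  have "card {0, 1 :: 'b} \<le> card K" by (intro card_mono) auto
  then show ?thesis by simp
qed

text \<open>With \<open>c = card K\<close>, the L-function of the constant 1 is
  \<open>(1 - t) / (1 - c * t)\<close>. The value serves to count irreducible polynomials of prime
  degree.\<close>

lemma psum_1:
  assumes "n > 0"
  shows "psum (\<lambda>_. 1) n = of_nat (card K ^ n - 1)"
  using assms
proof (induction n rule: less_induct)
  case (less n)
  define c where "c = (of_nat (card K) :: complex)"
  have c1: "c \<noteq> 1" using card_K_gt_1 by (simp add: c_def)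
  have u: "(of_nat (card (upoly_deg s)) :: complex) = (if s = 0 then 1 else (c - 1) * c ^ (s - 1))" for s
    using card_K_gt_1 card_upoly_deg[of s] by (auto simp: c_def upoly_deg_0 of_nat_diff)
  have "of_nat n * (\<Sum>F\<in>upoly_deg n. 1) =
    (\<Sum>s\<in>{1..n}. psum (\<lambda>_. 1) s * (\<Sum>F\<in>upoly_deg (n - s). 1) :: complex)"
    by (rule newton_upoly) auto
  also have "{1..n} = insert n {1..<n}" using less.prems by auto
  also have "(\<Sum>s\<in>insert n {1..<n}. psum (\<lambda>_. 1) s * (\<Sum>F\<in>upoly_deg (n - s). 1)) =
     psum (\<lambda>_. 1) n + (\<Sum>s\<in>{1..<n}. (c ^ s - 1) * ((c - 1) * c ^ (n - s - 1)))"
  proof (subst sum.insert)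
    have "psum (\<lambda>_. 1) s * (\<Sum>F\<in>upoly_deg (n - s). 1) = (c ^ s - 1) * ((c - 1) * c ^ (n - s - 1))"
      if "s \<in> {1..<n}" for s
      using less.IH[of s] that u[of "n - s"] card_K_gt_1 by (simp add: c_def of_nat_diff)
    then show "psum (\<lambda>_. 1) n * (\<Sum>F\<in>upoly_deg (n - n). 1) +
        (\<Sum>s\<in>{1..<n}. psum (\<lambda>_. 1) s * (\<Sum>F\<in>upoly_deg (n - s). 1)) =
        psum (\<lambda>_. 1) n + (\<Sum>s\<in>{1..<n}. (c ^ s - 1) * ((c - 1) * c ^ (n - s - 1)))"
      by (simp add: upoly_deg_0)
  qed auto
  also have "(\<Sum>s\<in>{1..<n}. (c ^ s - 1) * ((c - 1) * c ^ (n - s - 1))) =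
      of_nat (n - 1) * ((c - 1) * c ^ (n - 1)) - (\<Sum>s\<in>{1..<n}. (c - 1) * c ^ (n - s - 1))"
  proof -
    have "(\<Sum>s\<in>{1..<n}. (c ^ s - 1) * ((c - 1) * c ^ (n - s - 1))) =
       (\<Sum>s\<in>{1..<n}. (c - 1) * c ^ (n - 1) - (c - 1) * c ^ (n - s - 1))"
    proof (intro sum.cong refl)
      fix s assume "s \<in> {1..<n}"
      then have "c ^ s * c ^ (n - s - 1) = c ^ (n - 1)" by (simp flip: power_add)
      then show "(c ^ s - 1) * ((c - 1) * c ^ (n - s - 1)) = (c - 1) * c ^ (n - 1) - (c - 1) * c ^ (n - s - 1)"
        by (simp add: algebra_simps)
    qed
    then show ?thesis by (simp add: sum_subtractf)
  qed
  also have "(\<Sum>s\<in>{1..<n}. (c - 1) * c ^ (n - s - 1)) = (\<Sum>i<n-1. (c - 1) * c ^ i)"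
    by (rule sum.reindex_bij_witness[of _ "\<lambda>i. n - i - 1" "\<lambda>s. n - s - 1"]) auto
  also have "\<dots> = c ^ (n - 1) - 1"
    using c1 by (simp add: geometric_sum flip: sum_distrib_left)
  finally have "of_nat n * ((c - 1) * c ^ (n - 1)) = psum (\<lambda>_. 1) n +
      (of_nat (n - 1) * ((c - 1) * c ^ (n - 1)) - (c ^ (n - 1) - 1))"
    using u[of n] less.prems by simp
  then have "psum (\<lambda>_. 1) n = (of_nat n - of_nat (n - 1)) * ((c - 1) * c ^ (n - 1)) + c ^ (n - 1) - 1"
    by (simp add: algebra_simps)
  also have "of_nat n - of_nat (n - 1) = (1::complex)" using less.prems by (simp add: of_nat_diff)
  also have "1 * ((c - 1) * c ^ (n - 1)) + c ^ (n - 1) - 1 = c ^ n - 1"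
    using less.prems by (cases n) (auto simp: algebra_simps)
  also have "\<dots> = of_nat (card K ^ n - 1)" using card_K_gt_1 by (simp add: c_def of_nat_diff)
  finally show ?case .
qed

end

section \<open>Additive characters of subfields\<close>

text \<open>For \<open>Q = p ^ r\<close> with \<open>r\<close> dividing \<open>f\<close> this is the
  subfield of order \<open>Q\<close>.\<close>

definition Fix :: "nat \<Rightarrow> 'b::finite_field set" where
  "Fix Q = {x. x ^ Q = x}"

locale prim_field =
  fixes \<gamma> :: "'b::finite_field" and p f :: nat
  assumes prim: "primitive_element \<gamma>" and p_prime: "prime p" and card_b: "CARD('b) = p ^ f"
begin

lemma char_p: "CHAR('b) = p"
proof -
  have "CHAR('b) dvd p ^ f" using CHAR_dvd_CARD[where ?'a = 'b] card_b by simp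
  moreover have "prime CHAR('b)" by (rule prime_CHAR_semidom) (simp add: finite_imp_CHAR_pos)
  ultimately show ?thesis using p_prime prime_dvd_power primes_dvd_imp_eq by metis
qed

lemma card_gt_1: "CARD('b) > 1"
proof -
  have "card {0, 1 :: 'b} \<le> CARD('b)" by (intro card_mono) auto
  then show ?thesis by simp
qed

lemma f_pos: "f > 0"
  using card_gt_1 card_b by (cases f) auto

lemma q_gt_1: "p ^ f > 1"
  using card_gt_1 card_b by simp

lemma gamma_nz: "\<gamma> \<noteq> 0"
proof
  assume "\<gamma> = 0"
  then have "0 \<in> range (\<lambda>j::int. \<gamma> powi j)" by (intro range_eqI[of _ _ 1]) auto
  then show False using prim by (auto simp: primitive_element_def)
qed

definition qm where "qm = p ^ f - 1"

lemma qm_pos: "qm > 0" and Suc_qm: "Suc qm = p ^ f"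
  using q_gt_1 by (auto simp: qm_def)

lemma gamma_pow_card: "\<gamma> ^ qm = 1"
proof -
  have "\<gamma> * \<gamma> ^ qm = \<gamma> ^ (p ^ f)" by (simp flip: power_Suc Suc_qm)
  also have "\<dots> = \<gamma> * 1" using finite_field_power_card_eq_same[of \<gamma>] card_b by simp
  finally show ?thesis using gamma_nz by simp
qed

lemma gamma_powi_mod: "\<gamma> powi j = \<gamma> ^ nat (j mod int qm)"
proof -
  define N where "N = int qm"
  have N: "N > 0" using qm_pos by (simp add: N_def)
  have "\<gamma> powi (N * (j div N) + j mod N) = (\<gamma> powi N) powi (j div N) * \<gamma> powi (j mod N)"
    by (subst power_int_add) (use gamma_nz in \<open>auto simp only: power_int_mult\<close>)
  then have "\<gamma> powi j = (\<gamma> powi N) powi (j div N) * \<gamma> powi (j mod N)" by simp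
  also have "\<gamma> powi N = 1" using gamma_pow_card by (simp add: N_def power_int_of_nat)
  also have "\<gamma> powi (j mod N) = \<gamma> ^ nat (j mod N)" using N by (simp add: power_int_def)
  finally show ?thesis by (simp add: N_def)
qed

lemma gamma_image: "(\<lambda>i. \<gamma> ^ i) ` {..<qm} = UNIV - {0}"
proof (intro equalityI subsetI)
  fix x assume "x \<in> UNIV - {0 :: 'b}"
  then obtain j :: int where "x = \<gamma> powi j" using prim by (auto simp: primitive_element_def)
  then have x: "x = \<gamma> ^ nat (j mod int qm)" using gamma_powi_mod by simp
  moreover have "nat (j mod int qm) < qm" using qm_pos by (simp add: nat_less_iff)
  ultimately show "x \<in> (\<lambda>i. \<gamma> ^ i) ` {..<qm}" by blast
qed (use gamma_nz in auto)

lemma gamma_inj: "inj_on (\<lambda>i. \<gamma> ^ i) {..<qm}"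
proof (rule eq_card_imp_inj_on)
  have "card (UNIV - {0 :: 'b}) = qm" using card_b by (simp add: card_Diff_singleton qm_def)
  then show "card ((\<lambda>i. \<gamma> ^ i) ` {..<qm}) = card {..<qm}" unfolding gamma_image by simp
qed simp

lemma gamma_exists: "x \<noteq> 0 \<Longrightarrow> \<exists>i. x = \<gamma> ^ i"
  using gamma_image by blast

lemma gamma_mod: "\<gamma> ^ i = \<gamma> ^ (i mod qm)"
proof -
  have "\<gamma> ^ (qm * (i div qm) + i mod qm) = (\<gamma> ^ qm) ^ (i div qm) * \<gamma> ^ (i mod qm)"
    by (simp only: power_add power_mult)
  then show ?thesis by (simp add: gamma_pow_card)
qed

lemma gamma_eq_iff: "\<gamma> ^ i = \<gamma> ^ j \<longleftrightarrow> [i = j] (mod qm)"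
proof
  assume "\<gamma> ^ i = \<gamma> ^ j"
  then have "\<gamma> ^ (i mod qm) = \<gamma> ^ (j mod qm)" using gamma_mod by metis
  then have "i mod qm = j mod qm"
    using inj_onD[OF gamma_inj, of "i mod qm" "j mod qm"] qm_pos by auto
  then show "[i = j] (mod qm)" by (simp add: cong_def)
next
  assume "[i = j] (mod qm)"
  then show "\<gamma> ^ i = \<gamma> ^ j" using gamma_mod by (metis cong_def)
qed

lemma gamma_eq_1_iff: "\<gamma> ^ i = 1 \<longleftrightarrow> qm dvd i"
  using gamma_eq_iff[of i 0] by (simp add: cong_0_iff)

lemma frob_add: "(x + y :: 'b) ^ (p ^ n) = x ^ (p ^ n) + y ^ (p ^ n)"
  by (rule freshmans_dream') (use p_prime char_p in auto)

lemma frob_sum: "(sum g A :: 'b) ^ (p ^ n) = (\<Sum>x\<in>A. g x ^ (p ^ n))"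
  by (rule freshmans_dream_sum') (use p_prime char_p in auto)

lemma p_gt_1: "p > 1" using p_prime prime_gt_1_nat by blast

lemma frob_minus: "(- x :: 'b) ^ (p ^ n) = - (x ^ (p ^ n))"
proof -
  have "(- x + x) ^ (p ^ n) = (- x) ^ (p ^ n) + x ^ (p ^ n)" by (rule frob_add)
  then show ?thesis using p_gt_1 by (simp add: power_0_left eq_neg_iff_add_eq_0)
qed

lemma subfield_Fix: "subfield_set (Fix (p ^ r) :: 'b set)"
  by standard
    (use p_gt_1 in \<open>auto simp: Fix_def frob_add frob_minus power_mult_distrib power_inverse\<close>)

lemma Fix_pow: "x \<in> Fix Q \<Longrightarrow> x ^ (Q ^ i) = x"
  by (induction i) (auto simp: Fix_def power_mult)

lemma Fix_mono: "r dvd s \<Longrightarrow> Fix (p ^ r) \<subseteq> (Fix (p ^ s) :: 'b set)"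
  using Fix_pow by (auto simp: Fix_def power_mult elim!: dvdE)

lemma Fix_f: "Fix (p ^ f) = (UNIV :: 'b set)"
  using finite_field_power_card_eq_same card_b by (metis (mono_tags) Fix_def UNIV_eq_I mem_Collect_eq)

lemma power_minus_1_dvd: "r dvd s \<Longrightarrow> (p ^ r - 1) dvd (p ^ s - 1 :: nat)"
proof (elim dvdE)
  fix j assume "s = r * j"
  moreover have "(int (p ^ r) - 1) dvd (int (p ^ r) ^ j - 1)"
    by (metis power_diff_1_eq dvd_triv_left)
  moreover have "p ^ r \<ge> 1" "p ^ (r * j) \<ge> 1" using p_gt_1 by auto
  ultimately have "int (p ^ r - 1) dvd int (p ^ s - 1)"
    by (simp add: of_nat_diff power_mult)
  then show ?thesis by (simp only: int_dvd_int_iff)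
qed

text \<open>For \<open>r\<close> dividing \<open>f\<close>, the power
  \<open>\<gamma> ^ stride r\<close> generates the multiplicative group of the subfield of order
  \<open>p ^ r\<close>.\<close>

definition stride :: "nat \<Rightarrow> nat" where
  "stride r = qm div (p ^ r - 1)"

lemma stride_mult: "r dvd f \<Longrightarrow> stride r * (p ^ r - 1) = qm"
  unfolding stride_def qm_def by (rule dvd_div_mult_self) (rule power_minus_1_dvd)

lemma pr_gt_1: "r dvd f \<Longrightarrow> p ^ r > 1"
  using p_gt_1 f_pos by (metis dvd_pos_nat one_less_power)

lemma stride_pos: "r dvd f \<Longrightarrow> stride r > 0"
  using stride_mult[of r] qm_pos by (cases "stride r = 0") auto

lemma gamma_in_Fix_iff:
  assumes "r dvd f"
  shows "\<gamma> ^ i \<in> Fix (p ^ r) \<longleftrightarrow> stride r dvd i"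
proof -
  have P: "p ^ r \<ge> 1" using p_gt_1 by simp
  have "\<gamma> ^ i \<in> Fix (p ^ r) \<longleftrightarrow> \<gamma> ^ i * \<gamma> ^ (i * (p ^ r - 1)) = \<gamma> ^ i * 1"
  proof -
    have "i * p ^ r = i + i * (p ^ r - 1)" using P by (simp add: algebra_simps)
    then show ?thesis by (simp add: Fix_def flip: power_add power_mult)
  qed
  also have "\<dots> \<longleftrightarrow> \<gamma> ^ (i * (p ^ r - 1)) = 1" using gamma_nz by simp
  also have "\<dots> \<longleftrightarrow> stride r * (p ^ r - 1) dvd i * (p ^ r - 1)"
    unfolding gamma_eq_1_iff stride_mult[OF assms] by simp
  also have "\<dots> \<longleftrightarrow> stride r dvd i" using pr_gt_1[OF assms] by simp
  finally show ?thesis .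
qed

lemma Fix_nz_iff:
  assumes "r dvd f"
  shows "x \<in> Fix (p ^ r) - {0} \<longleftrightarrow> (\<exists>i. x = \<gamma> ^ (stride r * i))"
proof
  assume x: "x \<in> Fix (p ^ r) - {0}"
  then obtain i where i: "x = \<gamma> ^ i" using gamma_exists by blast
  then have "stride r dvd i" using x gamma_in_Fix_iff[OF assms] by blast
  then show "\<exists>i. x = \<gamma> ^ (stride r * i)" using i by (auto elim!: dvdE)
next
  assume "\<exists>i. x = \<gamma> ^ (stride r * i)"
  then obtain i where i: "x = \<gamma> ^ (stride r * i)" by blast
  have "\<gamma> ^ (stride r * i) \<in> Fix (p ^ r)" unfolding gamma_in_Fix_iff[OF assms] by simp
  then show "x \<in> Fix (p ^ r) - {0}" using i gamma_nz by simp
qed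

lemma card_Fix:
  assumes "r dvd f"
  shows "card (Fix (p ^ r) :: 'b set) = p ^ r"
proof -
  have "bij_betw (\<lambda>i. \<gamma> ^ (stride r * i)) {..<p ^ r - 1} (Fix (p ^ r) - {0})"
    unfolding bij_betw_def
  proof
    show "inj_on (\<lambda>i. \<gamma> ^ (stride r * i)) {..<p ^ r - 1}"
    proof
      fix i j assume ij: "i \<in> {..<p ^ r - 1}" "j \<in> {..<p ^ r - 1}" "\<gamma> ^ (stride r * i) = \<gamma> ^ (stride r * j)"
      have "stride r * i < qm" "stride r * j < qm"
        using ij stride_mult[OF assms] stride_pos[OF assms] by (metis lessThan_iff mult_less_mono2)+
      then have "stride r * i = stride r * j" using ij(3) inj_onD[OF gamma_inj, of "stride r * i" "stride r * j"] by blast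
      then show "i = j" using stride_pos[OF assms] by (metis mult_cancel1 less_numeral_extra(3))
    qed
    show "(\<lambda>i. \<gamma> ^ (stride r * i)) ` {..<p ^ r - 1} = Fix (p ^ r) - {0}"
    proof (intro equalityI subsetI)
      fix x :: 'b assume "x \<in> Fix (p ^ r) - {0}"
      then obtain i where i: "x = \<gamma> ^ (stride r * i)" using Fix_nz_iff[OF assms] by auto
      have "stride r * (i mod (p ^ r - 1)) = (stride r * i) mod qm"
        by (metis mult_mod_right stride_mult[OF assms])
      then have "x = \<gamma> ^ (stride r * (i mod (p ^ r - 1)))" using i gamma_mod[of "stride r * i"] by simp
      moreover have "i mod (p ^ r - 1) < p ^ r - 1" using pr_gt_1[OF assms] by simp
      ultimately show "x \<in> (\<lambda>i. \<gamma> ^ (stride r * i)) ` {..<p ^ r - 1}" by blast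
    next
      fix x assume "x \<in> (\<lambda>i. \<gamma> ^ (stride r * i)) ` {..<p ^ r - 1}"
      then show "x \<in> Fix (p ^ r) - {0}" using Fix_nz_iff[OF assms] by blast
    qed
  qed
  then have "card (Fix (p ^ r) - {0 :: 'b}) = p ^ r - 1" using bij_betw_same_card by fastforce
  moreover have "(0 :: 'b) \<in> Fix (p ^ r)" using p_gt_1 by (simp add: Fix_def)
  ultimately show ?thesis using pr_gt_1[OF assms]
    by (simp add: card_Diff_singleton card_gt_0_iff)
qed

text \<open>On \<open>Fix (p ^ r)\<close> this is the absolute trace to the prime field.\<close>

definition tr :: "nat \<Rightarrow> 'b \<Rightarrow> 'b" where
  "tr r x = (\<Sum>i<r. x ^ (p ^ i))"

lemma tr_add: "tr r (x + y) = tr r x + tr r y"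
  by (simp add: tr_def frob_add sum.distrib)

lemma tr_frob: "x \<in> Fix (p ^ r) \<Longrightarrow> tr r (x ^ p) = tr r x"
proof -
  assume x: "x \<in> Fix (p ^ r)"
  have "tr r (x ^ p) + x = (\<Sum>i<r. x ^ (p ^ Suc i)) + x ^ (p ^ 0)" by (simp add: tr_def power_mult)
  also have "\<dots> = (\<Sum>i<Suc r. x ^ (p ^ i))" by (simp only: sum.lessThan_Suc_shift add.commute)
  also have "\<dots> = tr r x + x ^ (p ^ r)" by (simp add: tr_def)
  finally show ?thesis using x by (simp add: Fix_def)
qed

lemma tr_in_prime: "x \<in> Fix (p ^ r) \<Longrightarrow> tr r x \<in> Fix p"
proof -
  assume x: "x \<in> Fix (p ^ r)"
  have "tr r x ^ p = tr r (x ^ p)" using frob_sum[of "\<lambda>i. x ^ (p ^ i)" "{..<r}" 1]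
    by (simp add: tr_def mult.commute flip: power_mult)
  then show ?thesis using tr_frob[OF x] by (simp add: Fix_def)
qed

lemma prime_field: "Fix p = (of_nat ` {..<p} :: 'b set)"
proof (rule sym, rule card_subset_eq)
  show sub: "of_nat ` {..<p} \<subseteq> (Fix p :: 'b set)"
  proof
    fix x assume "x \<in> (of_nat ` {..<p} :: 'b set)"
    then obtain n where x: "x = of_nat n" by auto
    have "(of_nat n :: 'b) ^ p = of_nat n"
      by (induction n) (use frob_add[of 1 _ 1] p_gt_1 in \<open>auto simp: power_0_left\<close>)
    then show "x \<in> Fix p" by (simp add: x Fix_def)
  qed
  have inj: "inj_on (of_nat :: nat \<Rightarrow> 'b) {..<p}"
  proof
    fix i j assume "i \<in> {..<p}" "j \<in> {..<p}" "of_nat i = (of_nat j :: 'b)"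
    then have "[i = j] (mod p)"
      using of_nat_eq_iff_cong_CHAR[of i j, where ?'a = 'b] unfolding char_p by blast
    then show "i = j" using \<open>i \<in> {..<p}\<close> \<open>j \<in> {..<p}\<close> cong_less_modulus_unique_nat by auto
  qed
  have "card (Fix p :: 'b set) = p" using card_Fix[of 1] by simp
  then show "card (of_nat ` {..<p} :: 'b set) = card (Fix p :: 'b set)"
    using inj by (simp add: card_image)
qed simp

text \<open>\<open>LEAST\<close> picks a natural number representing \<open>x\<close> in the prime
  field; by \<open>prime_addchar_of_nat\<close> any representative gives the same value. Outside the
  prime field the value is arbitrary.\<close>

definition prime_addchar :: "'b \<Rightarrow> complex" where
  "prime_addchar x = cis (2 * pi * real (LEAST n. of_nat n = x) / real p)"

lemma cis_cong:
  assumes "[i = j] (mod N)" "N > 0"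
  shows "cis (2 * pi * real i / real N) = cis (2 * pi * real j / real N)"
proof -
  have *: "cis (2 * pi * real i / real N) = cis (2 * pi * real (i mod N) / real N)" for i
  proof -
    have "real i = real N * real (i div N) + real (i mod N)"
      by (metis mult_div_mod_eq of_nat_add of_nat_mult)
    then have "2 * pi * real i / real N = 2 * pi * real (i div N) + 2 * pi * real (i mod N) / real N"
      using assms(2) by (simp add: field_simps)
    then have "cis (2 * pi * real i / real N) =
        cis (2 * pi * real (i div N)) * cis (2 * pi * real (i mod N) / real N)"
      by (simp only: cis_mult)
    then show ?thesis by (simp add: cis_multiple_2pi)
  qed
  show ?thesis using assms * by (metis cong_def)
qed

lemma cis_eq_1_iff_dvd:
  assumes "N > 0"
  shows "cis (2 * pi * real i / real N) = 1 \<longleftrightarrow> N dvd i"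
proof
  assume "cis (2 * pi * real i / real N) = 1"
  then obtain n :: int where "2 * pi * real i / real N = of_int n * (2 * pi)"
    by (auto simp: complex_eq_iff cos_one_2pi_int mult_ac)
  then have "real i = of_int n * real N" using assms by (simp add: field_simps)
  then have "int i = n * int N" by (metis of_int_eq_iff of_int_mult of_int_of_nat_eq)
  then show "N dvd i" by (metis dvd_triv_right int_dvd_int_iff)
next
  assume "N dvd i"
  then have "cis (2 * pi * real i / real N) = cis (2 * pi * real 0 / real N)"
    using assms by (intro cis_cong) (simp_all add: cong_0_iff)
  then show "cis (2 * pi * real i / real N) = 1" by simp
qed

lemma prime_addchar_of_nat: "prime_addchar (of_nat n) = cis (2 * pi * real n / real p)"
proof -
  have "of_nat (LEAST m. of_nat m = (of_nat n :: 'b)) = (of_nat n :: 'b)" by (rule LeastI) simp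
  then have "[(LEAST m. of_nat m = (of_nat n :: 'b)) = n] (mod p)"
    using of_nat_eq_iff_cong_CHAR char_p by metis
  then show ?thesis unfolding prime_addchar_def using p_gt_1 by (intro cis_cong) simp_all
qed

lemma prime_addchar_add: "x \<in> Fix p \<Longrightarrow> y \<in> Fix p \<Longrightarrow> prime_addchar (x + y) = prime_addchar x * prime_addchar y"
proof -
  assume "x \<in> Fix p" "y \<in> Fix p"
  then obtain i j where "x = of_nat i" "y = of_nat j" unfolding prime_field by auto
  then have "prime_addchar (x + y) = prime_addchar (of_nat (i + j))" "prime_addchar x = prime_addchar (of_nat i)" "prime_addchar y = prime_addchar (of_nat j)" by auto
  then show ?thesis by (simp only: prime_addchar_of_nat) (simp add: cis_mult add_divide_distrib distrib_left)
qed

lemma prime_addchar_eq_1_iff: "x \<in> Fix p \<Longrightarrow> prime_addchar x = 1 \<longleftrightarrow> x = 0"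
proof -
  assume "x \<in> Fix p"
  then obtain i where i: "x = of_nat i" unfolding prime_field by auto
  have "prime_addchar x = 1 \<longleftrightarrow> p dvd i" unfolding i prime_addchar_of_nat using p_gt_1 by (intro cis_eq_1_iff_dvd) simp
  also have "\<dots> \<longleftrightarrow> x = 0" unfolding i of_nat_eq_0_iff_char_dvd char_p ..
  finally show ?thesis .
qed

text \<open>The canonical additive character of the subfield of order \<open>p ^ r\<close>. It is
  not obtained by restricting the character of a larger field: the two differ by the factor which
  the relative trace introduces.\<close>

definition psi :: "nat \<Rightarrow> 'b \<Rightarrow> complex" where
  "psi r x = prime_addchar (tr r x)"

lemma psi_add: "x \<in> Fix (p ^ r) \<Longrightarrow> y \<in> Fix (p ^ r) \<Longrightarrow> psi r (x + y) = psi r x * psi r y"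
  by (simp add: psi_def tr_add prime_addchar_add tr_in_prime)

lemma psi_0 [simp]: "psi r 0 = 1"
  using p_gt_1 prime_addchar_of_nat[of 0] by (simp add: psi_def tr_def power_0_left)

lemma psi_frob: "x \<in> Fix (p ^ r) \<Longrightarrow> psi r (x ^ p) = psi r x"
  by (simp add: psi_def tr_frob)

lemma psi_frob_pow: "x \<in> Fix (p ^ r) \<Longrightarrow> psi r (x ^ (p ^ n)) = psi r x"
proof (induction n)
  case (Suc n)
  have "x ^ (p ^ n) \<in> Fix (p ^ r)" using Suc.prems by (rule subfield_set.power_K[OF subfield_Fix])
  then have "psi r ((x ^ (p ^ n)) ^ p) = psi r x" using Suc psi_frob by simp
  then show ?case by (simp add: mult.commute flip: power_mult)
qed simp

lemma psi_minus: "x \<in> Fix (p ^ r) \<Longrightarrow> psi r (- x) = cnj (psi r x)"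
proof -
  assume x: "x \<in> Fix (p ^ r)"
  have "psi r x * psi r (- x) = 1"
    using psi_add[of x r "- x"] x subfield_set.uminus_K[OF subfield_Fix] by simp
  moreover have "psi r x * cnj (psi r x) = 1"
    by (simp add: psi_def prime_addchar_def cis_cnj cis_mult)
  ultimately have "psi r x * psi r (- x) = psi r x * cnj (psi r x)" by simp
  moreover have "psi r x \<noteq> 0" by (simp add: psi_def prime_addchar_def)
  ultimately show ?thesis by simp
qed

text \<open>Otherwise the trace, a nonzero polynomial of degree at most \<open>p ^ (r - 1)\<close>,
  would vanish on all \<open>p ^ r\<close> elements of the subfield.\<close>

lemma psi_nontrivial:
  assumes "r dvd f"
  shows "\<exists>x\<in>Fix (p ^ r). psi r x \<noteq> 1"
proof (rule ccontr)
  assume "\<not> ?thesis"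
  then have *: "\<And>x. x \<in> Fix (p ^ r) \<Longrightarrow> psi r x = 1" by blast
  have 0: "tr r x = 0" if "x \<in> Fix (p ^ r)" for x
    using *[OF that] prime_addchar_eq_1_iff[OF tr_in_prime[OF that]] unfolding psi_def by simp
  define T where "T = (\<Sum>i<r. monom (1 :: 'b) (p ^ i))"
  have r: "r > 0" using assms f_pos by (rule dvd_pos_nat[rotated])
  have poly_T: "poly T x = tr r x" for x
    by (simp add: T_def tr_def poly_sum poly_monom)
  have "coeff T 1 = (\<Sum>i<r. if i = 0 then 1 else 0)"
    unfolding T_def coeff_sum using p_gt_1 by (intro sum.cong) (auto simp: coeff_monom)
  then have T0: "T \<noteq> 0" using r by auto
  have "degree T \<le> p ^ (r - 1)" unfolding T_def
  proof (rule degree_sum_le)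
    fix i assume "i \<in> {..<r}"
    then have "p ^ i \<le> p ^ (r - 1)" using p_gt_1 by (intro power_increasing) auto
    then show "degree (monom (1 :: 'b) (p ^ i)) \<le> p ^ (r - 1)" by (simp add: degree_monom_eq)
  qed simp
  also have "\<dots> < p ^ r" using p_gt_1 r by simp
  finally have "card {x. poly T x = 0} < p ^ r" using card_poly_roots_bound[OF T0] by simp
  moreover have "Fix (p ^ r) \<subseteq> {x. poly T x = 0}" using 0 poly_T by auto
  then have "card (Fix (p ^ r) :: 'b set) \<le> card {x. poly T x = 0}" by (intro card_mono) auto
  ultimately show False using card_Fix[OF assms] by simp
qed

lemma psi_orth:
  assumes "r dvd f" "z \<in> Fix (p ^ r)"
  shows "(\<Sum>x\<in>Fix (p ^ r). psi r (x * z)) = (if z = 0 then of_nat (p ^ r) else 0)"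
proof (cases "z = 0")
  case False
  interpret S: subfield_set "Fix (p ^ r) :: 'b set" by (rule subfield_Fix)
  obtain y where y: "y \<in> Fix (p ^ r)" "psi r y \<noteq> 1" using psi_nontrivial[OF assms(1)] by auto
  define w where "w = y / z"
  have w: "w \<in> Fix (p ^ r)" "w * z = y" using False y assms S.divide_K by (auto simp: w_def)
  have "(\<Sum>x\<in>Fix (p ^ r). psi r (x * z)) = (\<Sum>x\<in>Fix (p ^ r). psi r ((x + w) * z))"
    by (rule sum.reindex_bij_witness[of _ "\<lambda>x. x + w" "\<lambda>x. x - w"])
      (use w S.add_K S.diff_K in auto)
  also have "\<dots> = (\<Sum>x\<in>Fix (p ^ r). psi r (x * z)) * psi r y"
    unfolding sum_distrib_right
    by (intro sum.cong refl) (use w y assms S.mult_K in \<open>auto simp: distrib_right psi_add\<close>)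
  finally show ?thesis using False y by simp
qed (use card_Fix[OF assms(1)] in simp)

end

section \<open>Power sums of roots\<close>

text \<open>
  For \<open>F = \<Prod>(1 - y t)\<close> and \<open>n > 0\<close> this is \<open>\<Sum>y\<^sup>n\<close>. The logarithmic derivative gives it without
  reference to a splitting field.
\<close>

definition rootsum :: "nat \<Rightarrow> 'b::field poly \<Rightarrow> 'b" where
  "rootsum n F = - fps_nth (fps_deriv (fps_of_poly F) * inverse (fps_of_poly F)) (n - 1)"

lemma rootsum_mult:
  assumes "coeff F 0 \<noteq> 0" "coeff G 0 \<noteq> 0"
  shows "rootsum n (F * G) = rootsum n F + rootsum n G"
proof -
  define f g where "f = fps_of_poly F" and "g = fps_of_poly G"
  have u: "f * inverse f = 1" "g * inverse g = 1"
    using assms by (simp_all add: f_def g_def inverse_mult_eq_1')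
  have "fps_deriv (f * g) * inverse (f * g) =
      fps_deriv f * inverse f * (g * inverse g) + fps_deriv g * inverse g * (f * inverse f)"
    by (simp add: fps_inverse_mult algebra_simps)
  also have "\<dots> = fps_deriv f * inverse f + fps_deriv g * inverse g" by (simp add: u)
  finally show ?thesis by (simp add: rootsum_def fps_of_poly_mult f_def g_def)
qed

lemma rootsum_1 [simp]: "rootsum n 1 = 0"
  by (simp add: rootsum_def)

lemma rootsum_prod:
  assumes "\<And>i. i \<in> A \<Longrightarrow> coeff (F i) 0 = 1"
  shows "coeff (prod F A) 0 = 1 \<and> rootsum n (prod F A) = (\<Sum>i\<in>A. rootsum n (F i))"
  using assms by (induction A rule: infinite_finite_induct) (auto simp: coeff_mult rootsum_mult)

lemma rootsum_linear:
  assumes "n > 0"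
  shows "rootsum n [:1, - y:] = y ^ n"
proof -
  define G where "G = Abs_fps (\<lambda>i. y ^ i)"
  have "fps_of_poly [:1, - y:] * G = 1"
  proof (rule fps_ext)
    fix i show "fps_nth (fps_of_poly [:1, - y:] * G) i = fps_nth 1 i"
      by (cases i) (auto simp: fps_of_poly_linear' distrib_right G_def mult.assoc)
  qed
  then have "inverse (fps_of_poly [:1, - y:]) = G"
    by (metis fps_inverse_unique mult.commute)
  then have "rootsum n [:1, - y:] = - fps_nth (fps_const (- y) * G) (n - 1)"
    unfolding rootsum_def by (simp add: fps_of_poly_linear' flip: fps_const_neg)
  also have "\<dots> = y ^ n" using assms by (simp add: G_def flip: power_Suc)
  finally show ?thesis .
qed

lemma fps_mult_low_zero:
  fixes f g :: "'b::comm_ring_1 fps"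
  assumes "\<And>i. i < a \<Longrightarrow> fps_nth f i = 0" "\<And>i. i < b \<Longrightarrow> fps_nth g i = 0" "n < a + b"
  shows "fps_nth (f * g) n = 0"
  unfolding fps_mult_nth
proof (intro sum.neutral ballI)
  fix i assume "i \<in> {0..n}"
  then have "i < a \<or> n - i < b" using assms(3) by auto
  then show "fps_nth f i * fps_nth g (n - i) = 0" using assms by auto
qed

text \<open>In effect \<open>log (F + z * t ^ N) = log F + log (1 + z * t ^ N / F)\<close>; as
  \<open>n < 2 * N\<close>, only the linear term of the last logarithm reaches \<open>t ^ n\<close>.
  Logarithmic derivatives replace logarithms, whose denominators may vanish in the field.\<close>

lemma rootsum_perturb:
  fixes F :: "'b::field poly"
  assumes F0: "coeff F 0 = 1" and N: "N \<ge> 1" "N \<le> n" "n < 2 * N"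
  shows "rootsum n (F + monom z N) = rootsum n F - of_nat n * z * fps_nth (inverse (fps_of_poly F)) (n - N)"
proof -
  define f where "f = fps_of_poly F"
  define h where "h = fps_const z * fps_X ^ N"
  define g where "g = f + h"
  have f0: "fps_nth f 0 = 1" using F0 by (simp add: f_def)
  have g0: "fps_nth g 0 = 1" using f0 N by (simp add: g_def h_def)
  have uf: "f * inverse f = 1" and ug: "g * inverse g = 1"
    using f0 g0 by (simp_all add: inverse_mult_eq_1')
  have gp: "fps_of_poly (F + monom z N) = g"
    by (simp add: g_def f_def h_def fps_of_poly_add fps_of_poly_monom)
  define w where "w = fps_deriv h * f - h * fps_deriv f"
  have d: "fps_deriv (h * inverse f) = w * (inverse f)\<^sup>2"
  proof -
    have "fps_deriv (h * inverse f) = fps_deriv h * inverse f - h * fps_deriv f * (inverse f)\<^sup>2"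
      using f0 by (simp add: fps_inverse_deriv algebra_simps)
    also have "fps_deriv h * inverse f = fps_deriv h * inverse f * (f * inverse f)" by (simp add: uf)
    finally show ?thesis by (simp add: w_def algebra_simps power2_eq_square)
  qed
  \<comment> \<open>Uses \<open>1 / (f * g) = 1 / f ^ 2 - h / (g * f ^ 2)\<close>. The correction
    \<open>w * h\<close> starts at order at least \<open>2 * N - 1\<close>, beyond
    \<open>n - 1\<close>.\<close>
  have e: "fps_deriv g * inverse g - fps_deriv f * inverse f = w * (inverse f)\<^sup>2 - w * h * (inverse g * (inverse f)\<^sup>2)"
  proof -
    have "fps_deriv g * inverse g - fps_deriv f * inverse f =
        fps_deriv g * inverse g * (f * inverse f) - fps_deriv f * inverse f * (g * inverse g)"
      by (simp add: uf ug)
    also have "\<dots> = w * (inverse g * inverse f)"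
      by (simp add: w_def g_def algebra_simps)
    also have "\<dots> = w * (inverse g * inverse f) * (f * inverse f)" by (simp add: uf)
    also have "\<dots> = w * (inverse f)\<^sup>2 * (g * inverse g) - w * h * (inverse g * (inverse f)\<^sup>2)"
      by (simp add: g_def algebra_simps power2_eq_square)
    finally show ?thesis by (simp add: ug)
  qed
  have h_low: "fps_nth h i = 0" if "i < N" for i using that by (simp add: h_def)
  have dh_low: "fps_nth (fps_deriv h) i = 0" if "i < N - 1" for i using that h_low by simp
  have w_low: "fps_nth w i = 0" if "i < N - 1" for i
  proof -
    have "fps_nth (fps_deriv h * f) i = 0" by (rule fps_mult_low_zero[of "N - 1" _ 0]) (use that dh_low in auto)
    moreover have "fps_nth (h * fps_deriv f) i = 0" by (rule fps_mult_low_zero[of N _ 0]) (use that h_low in auto)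
    ultimately show ?thesis by (simp add: w_def)
  qed
  have wh_low: "fps_nth (w * h) i = 0" if "i < n" for i
    by (rule fps_mult_low_zero[of "N - 1" _ N]) (use that w_low h_low N in auto)
  have z: "fps_nth (w * h * (inverse g * (inverse f)\<^sup>2)) (n - 1) = 0"
    by (rule fps_mult_low_zero[of n _ 0]) (use wh_low N in auto)
  have "fps_nth (fps_deriv g * inverse g) (n - 1) - fps_nth (fps_deriv f * inverse f) (n - 1) =
      fps_nth (fps_deriv (h * inverse f)) (n - 1)"
    using arg_cong[OF e, of "\<lambda>f. fps_nth f (n - 1)"] z d by simp
  also have "\<dots> = of_nat n * fps_nth (h * inverse f) n" using N by (simp only: fps_deriv_nth) simp
  also have "fps_nth (h * inverse f) n = z * fps_nth (inverse f) (n - N)"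
    using N by (simp add: h_def mult.assoc fps_X_power_mult_nth)
  finally show ?thesis unfolding rootsum_def gp by (simp add: f_def algebra_simps)
qed

text \<open>The same truncation around 1: in effect \<open>log F\<close> agrees with
  \<open>F - 1\<close> below order \<open>2 * N\<close>.\<close>

lemma rootsum_top:
  fixes F :: "'b::field poly"
  assumes F0: "coeff F 0 = 1" and low: "\<And>i. 0 < i \<Longrightarrow> i < N \<Longrightarrow> coeff F i = 0"
    and n: "0 < n" "n < 2 * N"
  shows "rootsum n F = - of_nat n * coeff F n"
proof -
  define f where "f = fps_of_poly F"
  have f0: "fps_nth f 0 = 1" using F0 by (simp add: f_def)
  have uf: "f * inverse f = 1" using f0 by (simp add: inverse_mult_eq_1')
  have e: "fps_deriv f * inverse f = fps_deriv f - fps_deriv f * ((f - 1) * inverse f)"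
    using uf by (simp add: algebra_simps)
  have "fps_nth (f - 1) i = 0" if "i < N" for i
    using that low F0 by (cases "i = 0") (auto simp: f_def)
  then have A: "fps_nth ((f - 1) * inverse f) i = 0" if "i < N" for i
    using that by (intro fps_mult_low_zero[of N _ 0]) auto
  have B: "fps_nth (fps_deriv f) i = 0" if "i < N - 1" for i
    using that low by (simp add: f_def)
  have "n - 1 < N - 1 + N" using n by simp
  then have "fps_nth (fps_deriv f * ((f - 1) * inverse f)) (n - 1) = 0"
    by (intro fps_mult_low_zero[of "N - 1" "fps_deriv f" N "(f - 1) * inverse f"] A B)
  then show ?thesis using n unfolding rootsum_def f_def[symmetric] e fps_sub_nth by (simp add: f_def)
qed

text \<open>The inverse of a series \<open>1 + c * t ^ s + ...\<close> begins with
  \<open>1 - c * t ^ s\<close>.\<close>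

lemma fps_inverse_low:
  fixes F :: "'b::field poly"
  assumes F0: "coeff F 0 = 1" and low: "\<And>i. 0 < i \<Longrightarrow> i < s \<Longrightarrow> coeff F i = 0" and s: "s > 0"
  shows "fps_nth (inverse (fps_of_poly F)) s = - coeff F s"
proof -
  define f where "f = fps_of_poly F"
  have f0: "fps_nth f 0 = 1" using F0 by (simp add: f_def)
  have uf: "f * inverse f = 1" using f0 by (simp add: inverse_mult_eq_1')
  have "0 = fps_nth (f * inverse f) s" using s by (simp add: uf)
  also have "\<dots> = (\<Sum>i\<in>{0..s}. fps_nth f i * fps_nth (inverse f) (s - i))" by (simp add: fps_mult_nth)
  also have "\<dots> = (\<Sum>i\<in>{0, s}. fps_nth f i * fps_nth (inverse f) (s - i))"
    using low by (intro sum.mono_neutral_right) (auto simp: f_def)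
  also have "\<dots> = fps_nth (inverse f) s + coeff F s"
    using s f0 by (simp add: f_def F0)
  finally show ?thesis by (simp add: f_def eq_neg_iff_add_eq_0)
qed

text \<open>The substitution multiplies each reciprocal root by \<open>w\<close>, an
  \<open>n\<close>-th root of unity.\<close>

lemma rootsum_scale:
  fixes F :: "'b::field poly"
  assumes F0: "coeff F 0 = 1" and w: "w ^ n = 1" "n > 0"
  shows "rootsum n (pcompose F [:0, w:]) = rootsum n F"
proof -
  define T where "T = (\<lambda>f :: 'b fps. Abs_fps (\<lambda>i. w ^ i * fps_nth f i))"
  have T_mult: "T (f * g) = T f * T g" for f g
  proof (rule fps_ext)
    fix i
    have "w ^ i * (\<Sum>j=0..i. fps_nth f j * fps_nth g (i - j)) =
        (\<Sum>j=0..i. (w ^ j * fps_nth f j) * (w ^ (i - j) * fps_nth g (i - j)))"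
      unfolding sum_distrib_left
    proof (intro sum.cong refl)
      fix j assume "j \<in> {0..i}"
      then have "w ^ i = w ^ j * w ^ (i - j)" by (simp flip: power_add)
      then show "w ^ i * (fps_nth f j * fps_nth g (i - j)) =
        (w ^ j * fps_nth f j) * (w ^ (i - j) * fps_nth g (i - j))" by simp
    qed
    then show "fps_nth (T (f * g)) i = fps_nth (T f * T g) i" by (simp add: T_def fps_mult_nth)
  qed
  have T_1: "T 1 = 1" by (rule fps_ext) (simp add: T_def)
  define f where "f = fps_of_poly F"
  have f0: "fps_nth f 0 = 1" using F0 by (simp add: f_def)
  have c: "fps_of_poly (pcompose F [:0, w:]) = T f"
    by (rule fps_ext) (simp add: T_def f_def coeff_pcompose_linear)
  have "T f * T (inverse f) = 1" using f0 by (simp add: inverse_mult_eq_1' T_1 flip: T_mult)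
  then have inv: "inverse (T f) = T (inverse f)" by (metis fps_inverse_unique mult.commute)
  have der: "fps_deriv (T f) = fps_const w * T (fps_deriv f)"
    by (rule fps_ext) (simp add: T_def mult_ac)
  have "fps_deriv (T f) * inverse (T f) = fps_const w * T (fps_deriv f * inverse f)"
    by (simp add: inv der T_mult mult.assoc)
  then have "rootsum n (pcompose F [:0, w:]) = - (w * (w ^ (n - 1) * fps_nth (fps_deriv f * inverse f) (n - 1)))"
    by (simp add: rootsum_def c T_def)
  also have "w * (w ^ (n - 1) * fps_nth (fps_deriv f * inverse f) (n - 1)) =
     w ^ n * fps_nth (fps_deriv f * inverse f) (n - 1)"
    using w(2) by (cases n) auto
  finally show ?thesis by (simp add: w rootsum_def f_def)
qed

context subfield_set
begin

lemma inverse_fps_K: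
  assumes "F \<in> upoly"
  shows "fps_nth (inverse (fps_of_poly F)) n \<in> K"
proof (induction n rule: less_induct)
  case (less n)
  define f where "f = fps_of_poly F"
  have f0: "fps_nth f 0 = 1" using assms by (simp add: upoly_def f_def)
  show ?case
  proof (cases "n = 0")
    case False
    have "0 = fps_nth (f * inverse f) n" using False f0 by (simp add: inverse_mult_eq_1')
    also have "\<dots> = (\<Sum>i\<in>insert 0 {1..n}. fps_nth f i * fps_nth (inverse f) (n - i))"
      unfolding fps_mult_nth by (intro sum.cong) auto
    also have "\<dots> = fps_nth (inverse f) n + (\<Sum>i=1..n. fps_nth f i * fps_nth (inverse f) (n - i))"
      using f0 by simp
    finally have "fps_nth (inverse f) n = - (\<Sum>i=1..n. fps_nth f i * fps_nth (inverse f) (n - i))"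
      by (simp add: eq_neg_iff_add_eq_0)
    moreover have "(\<Sum>i=1..n. fps_nth f i * fps_nth (inverse f) (n - i)) \<in> K"
      using less assms False by (intro sum_K mult_K) (auto simp: upoly_def Kpoly_def f_def)
    ultimately show ?thesis by (auto simp: f_def intro: uminus_K)
  qed (use f0 in \<open>auto simp: f_def\<close>)
qed

lemma of_nat_K: "of_nat n \<in> K"
  by (induction n) (auto intro: add_K)

lemma rootsum_K: "F \<in> upoly \<Longrightarrow> rootsum n F \<in> K"
proof -
  assume F: "F \<in> upoly"
  have "fps_nth (fps_deriv (fps_of_poly F)) i \<in> K" for i
    unfolding fps_deriv_nth using F by (intro mult_K of_nat_K) (simp add: upoly_def Kpoly_def)
  then show ?thesis unfolding rootsum_def fps_mult_nth by (intro uminus_K sum_K mult_K inverse_fps_K F)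
qed

end

section \<open>Conjugates in an extension of prime degree\<close>

text \<open>One step of the climb, of degree \<open>P\<close> over the field of order
  \<open>p ^ r\<close>. \<open>P \<noteq> p\<close> keeps \<open>P\<close> invertible in the field,
  and \<open>P\<close> odd makes \<open>(P - 1) div 2\<close> exact.\<close>

locale prime_step = prim_field \<gamma> p f for \<gamma> :: "'b::finite_field" and p f :: nat +
  fixes r P :: nat
  assumes rP: "r * P dvd f" and P_prime: "prime P" and P_odd: "odd P" and Pp: "P \<noteq> p"
begin

abbreviation Q where "Q \<equiv> p ^ r"
abbreviation KK where "KK \<equiv> (Fix (p ^ r) :: 'b set)"
abbreviation LL where "LL \<equiv> (Fix (p ^ (r * P)) :: 'b set)"

sublocale K: subfield_set "Fix (p ^ r) :: 'b set"
  by (rule subfield_Fix)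
sublocale L: subfield_set "Fix (p ^ (r * P)) :: 'b set"
  by (rule subfield_Fix)

lemma r_dvd: "r dvd f" using rP by (rule dvd_mult_left)
lemma P_gt_1: "P > 1" using P_prime prime_gt_1_nat by blast
lemma Q_gt_1: "Q > 1" using pr_gt_1[OF r_dvd] .
lemma card_KK: "card KK = Q" using card_Fix[OF r_dvd] .
lemma card_LL: "card LL = Q ^ P" using card_Fix[OF rP] by (simp add: power_mult)
lemma KL: "KK \<subseteq> LL" by (rule Fix_mono) simp

lemma P_nz: "of_nat P \<noteq> (0 :: 'b)"
  using P_prime p_prime Pp primes_dvd_imp_eq by (auto simp: of_nat_eq_0_iff_char_dvd char_p)

text \<open>For \<open>y\<close> in \<open>LL\<close>, the characteristic polynomial of
  \<open>y\<close> over \<open>KK\<close> with its coefficients reversed.\<close>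

definition conj_poly :: "'b \<Rightarrow> 'b poly" where
  "conj_poly y = (\<Prod>i<P. [:1, - (y ^ (Q ^ i)):])"

lemma conj_pow: "(y :: 'b) ^ (Q ^ P) = y \<longleftrightarrow> y \<in> LL"
  by (simp add: Fix_def power_mult)

lemma conj_shift:
  fixes g :: "'b \<Rightarrow> 'c::comm_monoid_mult"
  assumes "y \<in> LL"
  shows "(\<Prod>i<P. g (y ^ (Q ^ Suc i))) = (\<Prod>i<P. g (y ^ (Q ^ i)))"
proof -
  obtain m where m: "P = Suc m" using P_gt_1 by (cases P) auto
  have "(\<Prod>i<P. g (y ^ (Q ^ i))) = g y * (\<Prod>i<m. g (y ^ (Q ^ Suc i)))"
    unfolding m by (subst prod.lessThan_Suc_shift) simp
  moreover have "(\<Prod>i<P. g (y ^ (Q ^ Suc i))) = (\<Prod>i<m. g (y ^ (Q ^ Suc i))) * g (y ^ (Q ^ P))"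
    unfolding m by simp
  moreover have "y ^ (Q ^ P) = y" using assms conj_pow by blast
  ultimately show ?thesis by (simp only: mult.commute)
qed

text \<open>Frobenius on coefficients; its fixed polynomials are those over
  \<open>KK\<close>.\<close>

definition Phi :: "'b poly \<Rightarrow> 'b poly" where "Phi = map_poly (\<lambda>x. x ^ Q)"

lemma coeff_Phi: "coeff (Phi F) i = coeff F i ^ Q"
  using p_gt_1 by (simp add: Phi_def coeff_map_poly power_0_left)

lemma Phi_mult: "Phi (F * G) = Phi F * Phi G"
  by (rule poly_eqI) (simp add: coeff_Phi coeff_mult frob_sum power_mult_distrib)

lemma Phi_prod: "Phi (prod F A) = (\<Prod>i\<in>A. Phi (F i))"
proof (induction A rule: infinite_finite_induct)
  case empty
  have "Phi 1 = 1" using p_gt_1 by (intro poly_eqI) (simp add: coeff_Phi coeff_1 power_0_left)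
  then show ?case by simp
next
  case (infinite A)
  have "Phi 1 = 1" using p_gt_1 by (intro poly_eqI) (simp add: coeff_Phi coeff_1 power_0_left)
  then show ?case using infinite by simp
qed (simp add: Phi_mult)

lemma Phi_lin: "Phi [:1, - y:] = [:1, - (y ^ Q):]"
  using p_gt_1 by (intro poly_eqI) (auto simp: coeff_Phi coeff_pCons frob_minus power_0_left split: nat.splits)

lemma conj_poly_upoly:
  assumes "y \<in> LL"
  shows "conj_poly y \<in> K.upoly"
proof -
  have "Phi (conj_poly y) = (\<Prod>i<P. [:1, - (y ^ (Q ^ Suc i)):])"
    by (simp add: conj_poly_def Phi_prod Phi_lin mult.commute flip: power_mult)
  also have "\<dots> = conj_poly y" unfolding conj_poly_def by (rule conj_shift[OF assms])
  finally have "coeff (conj_poly y) i ^ Q = coeff (conj_poly y) i" for i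
    by (metis coeff_Phi)
  then have "coeff (conj_poly y) i \<in> Fix (p ^ r)" for i by (simp add: Fix_def)
  moreover have "coeff (conj_poly y) 0 = 1"
    unfolding conj_poly_def by (intro rootsum_prod[THEN conjunct1]) simp
  ultimately show ?thesis by (auto simp: K.upoly_def K.Kpoly_def)
qed

text \<open>On \<open>LL\<close> this is the norm to \<open>KK\<close>.\<close>

definition cnorm :: "'b \<Rightarrow> 'b" where "cnorm y = (\<Prod>i<P. y ^ (Q ^ i))"

lemma degree_conj_poly: "y \<noteq> 0 \<Longrightarrow> degree (conj_poly y) = P"
  unfolding conj_poly_def by (subst degree_prod_eq_sum_degree) auto

lemma lead_conj_poly: "y \<noteq> 0 \<Longrightarrow> lead_coeff (conj_poly y) = - cnorm y"
  unfolding conj_poly_def lead_coeff_prod using P_odd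
  by (simp add: cnorm_def prod_uminus)

lemma rootsum_conj_poly: "n > 0 \<Longrightarrow> rootsum n (conj_poly y) = (\<Sum>i<P. (y ^ n) ^ (Q ^ i))"
  unfolding conj_poly_def using rootsum_prod[of "{..<P}" "\<lambda>i. [:1, - (y ^ (Q ^ i)):]" n]
  by (simp add: rootsum_linear mult.commute flip: power_mult)

text \<open>A coincidence among conjugates gives \<open>y ^ (Q ^ t) = y\<close> with
  \<open>0 < t < P\<close>. Since \<open>t\<close> is invertible modulo the prime \<open>P\<close>,
  iterating yields \<open>y ^ Q = y\<close>, contrary to \<open>y \<notin> KK\<close>.\<close>

lemma orbit_card:
  assumes y: "y \<in> LL - KK"
  shows "inj_on (\<lambda>i. y ^ (Q ^ i)) {..<P}"
proof -
  have Qm: "y ^ (Q ^ (P * m)) = y" for m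
    using y Fix_pow[of y "Q ^ P" m] by (auto simp: Fix_def power_mult)
  have key: "y ^ (Q ^ t) \<noteq> y" if "0 < t" "t < P" for t
  proof
    assume e: "y ^ (Q ^ t) = y"
    have "coprime t P" using that P_prime
      by (metis coprime_commute nat_dvd_not_less prime_imp_coprime_nat)
    then obtain x where x: "[t * x = 1] (mod P)" using cong_solve_coprime_nat by auto
    then obtain m where m: "t * x = P * m + 1"
      using P_gt_1 by (metis cong_def mod_less mult_div_mod_eq)
    have "y = y ^ (Q ^ (t * x))" using Fix_pow[of y "Q ^ t" x] e by (simp add: Fix_def power_mult)
    also have "\<dots> = (y ^ (Q ^ (P * m))) ^ Q" unfolding m by (simp only: power_add power_one_right power_mult)
    also have "\<dots> = y ^ Q" by (simp only: Qm)
    finally show False using y by (simp add: Fix_def)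
  qed
  have "y ^ (Q ^ i) \<noteq> y ^ (Q ^ j)" if "i < j" "j < P" for i j
  proof
    assume "y ^ (Q ^ i) = y ^ (Q ^ j)"
    then have "(y ^ (Q ^ i)) ^ (Q ^ (P - i)) = (y ^ (Q ^ j)) ^ (Q ^ (P - i))" by simp
    moreover have "i + (P - i) = P * 1" "j + (P - i) = (j - i) + P * 1" using that by auto
    ultimately have "y ^ (Q ^ (P * 1)) = (y ^ (Q ^ (P * 1))) ^ (Q ^ (j - i))"
      by (metis (no_types, lifting) power_add power_mult mult.commute)
    then have "y = y ^ (Q ^ (j - i))" by (simp only: Qm)
    moreover have "0 < j - i" "j - i < P" using that by auto
    ultimately show False using key[of "j - i"] by metis
  qed
  then show ?thesis by (intro linorder_inj_onI) auto
qed

lemma poly_frob: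
  assumes "a \<in> K.upoly"
  shows "poly a (x ^ Q) = poly a x ^ Q"
proof -
  have "coeff a i \<in> Fix (p ^ r)" for i
    using assms by (auto simp: K.upoly_def K.Kpoly_def)
  then have "coeff a i ^ Q = coeff a i" for i by (simp add: Fix_def)
  then show ?thesis unfolding poly_altdef frob_sum
    by (simp add: power_mult_distrib mult.commute flip: power_mult)
qed

lemma conj_poly_root_iff: "poly (conj_poly y) x = 0 \<longleftrightarrow> (\<exists>i<P. x * y ^ (Q ^ i) = 1)"
  by (auto simp: conj_poly_def poly_prod)

lemma conj_poly_frob:
  assumes "y \<in> LL" shows "conj_poly (y ^ (Q ^ i)) = conj_poly y"
proof (induction i)
  case (Suc i)
  have "y ^ (Q ^ i) \<in> LL" using assms by (rule L.power_K)
  then have "conj_poly ((y ^ (Q ^ i)) ^ Q) = conj_poly (y ^ (Q ^ i))"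
    using conj_shift[of "y ^ (Q ^ i)" "\<lambda>z. [:1, - z:]"] by (simp add: conj_poly_def power_mult)
  then show ?case using Suc by (simp add: mult.commute flip: power_mult)
qed simp

text \<open>\<open>inverse z\<close> is a root of \<open>conj_poly z\<close>, hence of
  \<open>conj_poly y\<close>, whose roots are the inverses of the conjugates of
  \<open>y\<close>.\<close>

lemma conj_poly_inj:
  assumes "y \<in> LL" "z \<in> LL" "y \<noteq> 0" "conj_poly z = conj_poly y"
  shows "\<exists>i<P. z = y ^ (Q ^ i)"
proof -
  have z0: "z \<noteq> 0"
  proof
    assume "z = 0"
    then have "conj_poly z = 1" using p_gt_1 by (simp add: conj_poly_def power_0_left flip: one_pCons)
    then show False using degree_conj_poly[OF assms(3)] P_gt_1 assms(4) by simp
  qed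
  have "\<exists>i<P. inverse z * z ^ (Q ^ i) = 1" using z0 P_gt_1 by (intro exI[of _ 0]) auto
  then have "poly (conj_poly y) (inverse z) = 0"
    using conj_poly_root_iff[of z "inverse z"] assms(4) by simp
  then obtain i where "i < P" "inverse z * y ^ (Q ^ i) = 1"
    using conj_poly_root_iff by blast
  then show ?thesis using z0 by (intro exI[of _ i]) (simp add: field_simps)
qed

text \<open>A factor over \<open>KK\<close> vanishing at one inverse conjugate vanishes, by
  Frobenius, at all \<open>P\<close> of them, so its degree is already at least
  \<open>P\<close>.\<close>

lemma uirr_conj_poly:
  assumes y: "y \<in> LL - KK"
  shows "K.uirr (conj_poly y)"
proof -
  have y0: "y \<noteq> 0" using y by auto
  have yP: "y ^ (Q ^ P) = y" using y conj_pow by auto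
  define x where "x = inverse y"
  have xP: "x ^ (Q ^ P) = x" by (simp add: x_def power_inverse yP)
  have inj: "inj_on (\<lambda>i. x ^ (Q ^ i)) {..<P}"
    using orbit_card[OF y] by (simp add: x_def power_inverse inj_on_def)
  have big: "degree a \<ge> P" if a: "a \<in> K.upoly" "poly a (x ^ (Q ^ i)) = 0" "i < P" for a i
  proof -
    have all: "poly a (x ^ (Q ^ (i + j))) = 0" for j
    proof (induction j)
      case (Suc j)
      have "poly a ((x ^ (Q ^ (i + j))) ^ Q) = 0" using Suc poly_frob[OF a(1)] p_gt_1 by simp
      then show ?case by (simp add: mult.commute flip: power_mult)
    qed (use a in simp)
    have sub: "(\<lambda>j. x ^ (Q ^ j)) ` {..<P} \<subseteq> {x. poly a x = 0}"
    proof
      fix z assume "z \<in> (\<lambda>j. x ^ (Q ^ j)) ` {..<P}"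
      then obtain j where z: "z = x ^ (Q ^ j)" by auto
      have "z = x ^ (Q ^ (P + j))" by (simp add: z power_add power_mult xP)
      moreover have "P + j = i + (P + j - i)" using a(3) by simp
      ultimately have "poly a z = 0" using all by metis
      then show "z \<in> {x. poly a x = 0}" by simp
    qed
    have "P = card ((\<lambda>j. x ^ (Q ^ j)) ` {..<P})" using inj by (simp add: card_image)
    also have "\<dots> \<le> card {x. poly a x = 0}" using sub by (intro card_mono) auto
    also have "\<dots> \<le> degree a" using K.upoly_nz[OF a(1)] by (rule card_poly_roots_bound)
    finally show ?thesis .
  qed
  have root: "poly (conj_poly y) (x ^ (Q ^ i)) = 0" if "i < P" for i
    unfolding conj_poly_root_iff using that y0 by (intro exI[of _ i]) (simp add: x_def power_inverse)
  show ?thesis unfolding K.uirr_def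
  proof (intro conjI ballI impI)
    show "conj_poly y \<in> K.upoly" using y conj_poly_upoly by simp
    show "0 < degree (conj_poly y)" using y0 degree_conj_poly P_gt_1 by simp
    fix a b assume ab: "a \<in> K.upoly" "b \<in> K.upoly" "conj_poly y = a * b"
    have deg: "P = degree a + degree b"
      using ab K.upoly_degree_mult degree_conj_poly[OF y0] by metis
    have "poly a x = 0 \<or> poly b x = 0" using root[of 0] P_gt_1 ab(3) by simp
    then have "degree a \<ge> P \<or> degree b \<ge> P" using big[OF ab(1), of 0] big[OF ab(2), of 0] P_gt_1 by auto
    then show "degree a = 0 \<or> degree b = 0" using deg by auto
  qed
qed

section \<open>Irreducible polynomials of degree 1 and of prime degree\<close>

definition Irr where "Irr n = {g. K.uirr g \<and> degree g = n}"

lemma finite_Irr: "finite (Irr n)"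
  by (rule finite_subset[OF _ K.finite_coeff_polys[of n]]) (auto simp: Irr_def)

lemma upairs_prime: "K.upairs P = (\<lambda>g. (g, 1)) ` Irr P \<union> (\<lambda>g. (g, P)) ` Irr 1"
proof (intro equalityI subsetI)
  fix x assume "x \<in> K.upairs P"
  then obtain g j where x: "x = (g, j)" "K.uirr g" "j \<ge> 1" "j * degree g = P" by (auto simp: K.upairs_def)
  then have "j dvd P" by (metis dvd_triv_left)
  then have "j = 1 \<or> j = P" using P_prime by (auto simp: prime_nat_iff)
  then show "x \<in> (\<lambda>g. (g, 1)) ` Irr P \<union> (\<lambda>g. (g, P)) ` Irr 1"
    using x P_gt_1 by (auto simp: Irr_def)
next
  fix x assume "x \<in> (\<lambda>g. (g, 1)) ` Irr P \<union> (\<lambda>g. (g, P)) ` Irr 1"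
  then show "x \<in> K.upairs P" using P_gt_1 by (auto simp: K.upairs_def Irr_def)
qed

lemma psum_prime:
  "K.psum lam P = of_nat P * (\<Sum>g\<in>Irr P. lam g) + (\<Sum>g\<in>Irr 1. lam g ^ P)"
proof -
  have d: "((\<lambda>g. (g, 1 :: nat)) ` Irr P) \<inter> ((\<lambda>g. (g, P)) ` Irr 1) = {}" using P_gt_1 by auto
  have "K.psum lam P = (\<Sum>x\<in>(\<lambda>g. (g, 1)) ` Irr P. case x of (g, j) \<Rightarrow> of_nat (degree g) * lam g ^ j)
      + (\<Sum>x\<in>(\<lambda>g. (g, P)) ` Irr 1. case x of (g, j) \<Rightarrow> of_nat (degree g) * lam g ^ j)"
    unfolding K.psum_def upairs_prime using d finite_Irr by (intro sum.union_disjoint) auto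
  also have "(\<Sum>x\<in>(\<lambda>g. (g, 1)) ` Irr P. case x of (g, j) \<Rightarrow> of_nat (degree g) * lam g ^ j) =
      (\<Sum>g\<in>Irr P. of_nat P * lam g)"
    by (subst sum.reindex) (auto simp: inj_on_def Irr_def intro!: sum.cong)
  also have "(\<Sum>x\<in>(\<lambda>g. (g, P)) ` Irr 1. case x of (g, j) \<Rightarrow> of_nat (degree g) * lam g ^ j) =
      (\<Sum>g\<in>Irr 1. lam g ^ P)"
    by (subst sum.reindex) (auto simp: inj_on_def Irr_def intro!: sum.cong)
  finally show ?thesis by (simp add: sum_distrib_left)
qed

lemma Irr_1: "Irr 1 = (\<lambda>y. [:1, - y:]) ` (KK - {0})"
proof (intro equalityI subsetI)
  fix g assume "g \<in> Irr 1"
  then have g: "g \<in> K.upoly" "degree g = 1" by (auto simp: Irr_def K.uirr_def)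
  define y where "y = - coeff g 1"
  have "g = [:1, - y:]"
  proof (rule poly_eqI)
    fix n show "coeff g n = coeff [:1, - y:] n"
      using g by (cases n rule: nat.exhaust; cases "n = 1")
        (auto simp: y_def K.upoly_def coeff_pCons coeff_eq_0 split: nat.splits)
  qed
  moreover have "coeff g 1 \<noteq> 0" using g by (metis degree_0 leading_coeff_0_iff zero_neq_one)
  then have "y \<in> KK - {0}" using g
    by (auto simp: y_def K.upoly_def K.Kpoly_def intro!: K.uminus_K)
  ultimately show "g \<in> (\<lambda>y. [:1, - y:]) ` (KK - {0})" by auto
next
  fix g assume "g \<in> (\<lambda>y. [:1, - y:]) ` (KK - {0})"
  then obtain y where y: "y \<in> KK" "y \<noteq> 0" "g = [:1, - y:]" by auto
  have "g \<in> K.upoly" using y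
    by (auto simp: K.upoly_def K.Kpoly_def coeff_pCons K.uminus_K split: nat.splits)
  moreover have "degree g = 1" using y by simp
  moreover have "degree a = 0 \<or> degree b = 0" if "a \<in> K.upoly" "b \<in> K.upoly" "g = a * b" for a b
    using K.upoly_degree_mult[OF that(1,2)] that(3) \<open>degree g = 1\<close> by auto
  ultimately show "g \<in> Irr 1" unfolding Irr_def K.uirr_def by auto
qed

lemma card_Irr_1: "card (Irr 1) = Q - 1"
  unfolding Irr_1 by (subst card_image) (auto simp: inj_on_def card_Diff_singleton card_KK)

text \<open>Equates two evaluations of \<open>K.psum\<close> at \<open>P\<close> for the constant
  weight 1: the closed form, and the split into irreducible polynomials of degrees \<open>P\<close>
  and 1.\<close>

lemma card_Irr_P: "P * card (Irr P) = Q ^ P - Q"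
proof -
  have "complex_of_nat (Q ^ P - 1) = of_nat P * of_nat (card (Irr P)) + of_nat (Q - 1)"
    using K.psum_1[of P] P_gt_1 psum_prime[of "\<lambda>_. 1"] card_Irr_1 by (simp add: card_KK)
  then have "complex_of_nat (Q ^ P - 1) = of_nat (P * card (Irr P) + (Q - 1))" by simp
  then have "Q ^ P - 1 = P * card (Irr P) + (Q - 1)" by (simp only: of_nat_eq_iff)
  moreover have "Q ^ 1 \<le> Q ^ P" using Q_gt_1 P_gt_1 by (intro power_increasing) auto
  ultimately show ?thesis using Q_gt_1 by simp
qed

lemma conj_fiber:
  assumes y: "y \<in> LL - KK"
  shows "card {z \<in> LL - KK. conj_poly z = conj_poly y} = P"
proof -
  have "{z \<in> LL - KK. conj_poly z = conj_poly y} = (\<lambda>i. y ^ (Q ^ i)) ` {..<P}"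
  proof (intro equalityI subsetI)
    fix z assume "z \<in> {z \<in> LL - KK. conj_poly z = conj_poly y}"
    moreover have "y \<noteq> 0" using y by auto
    ultimately show "z \<in> (\<lambda>i. y ^ (Q ^ i)) ` {..<P}"
      using conj_poly_inj[of y z] y by auto
  next
    fix z assume "z \<in> (\<lambda>i. y ^ (Q ^ i)) ` {..<P}"
    then obtain i where i: "i < P" "z = y ^ (Q ^ i)" by auto
    have z: "z \<in> LL" "conj_poly z = conj_poly y" using y i conj_poly_frob L.power_K by auto
    have "z \<notin> KK"
    proof
      assume zK: "z \<in> KK"
      have "y \<noteq> 0" using y by auto
      then have "z \<noteq> 0" using i by simp
      then obtain j where "y = z ^ (Q ^ j)" using conj_poly_inj[of z y] y z by auto
      then have "y \<in> KK" using K.power_K[OF zK] by simp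
      then show False using y by simp
    qed
    then show "z \<in> {z \<in> LL - KK. conj_poly z = conj_poly y}" using z by simp
  qed
  then show ?thesis using orbit_card[OF y] by (simp add: card_image)
qed

text \<open>Surjectivity comes from counting: both sides have \<open>(Q ^ P - Q) / P\<close>
  elements. No root of an irreducible polynomial has to be constructed.\<close>

lemma conj_image: "conj_poly ` (LL - KK) = Irr P"
proof (rule card_subset_eq[OF finite_Irr])
  show sub: "conj_poly ` (LL - KK) \<subseteq> Irr P"
  proof
    fix g assume "g \<in> conj_poly ` (LL - KK)"
    then obtain y where y: "y \<in> LL - KK" "g = conj_poly y" by auto
    then have "y \<noteq> 0" by auto
    then show "g \<in> Irr P" using uirr_conj_poly[OF y(1)] degree_conj_poly y(2) by (simp add: Irr_def)
  qed
  have "card (LL - KK) = (\<Sum>g\<in>conj_poly ` (LL - KK). card {z \<in> LL - KK. conj_poly z = g})"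
    using sum.image_gen[of "LL - KK" "\<lambda>_. 1 :: nat" conj_poly] by simp
  also have "\<dots> = (\<Sum>g\<in>conj_poly ` (LL - KK). P)"
    by (intro sum.cong refl) (use conj_fiber in auto)
  finally have "card (LL - KK) = P * card (conj_poly ` (LL - KK))" by simp
  moreover have "card (LL - KK) = Q ^ P - Q" using KL by (simp add: card_Diff_subset card_KK card_LL)
  ultimately show "card (conj_poly ` (LL - KK)) = card (Irr P)"
    using card_Irr_P P_gt_1 by simp
qed

text \<open>Each irreducible polynomial of degree \<open>P\<close> arises from \<open>P\<close>
  conjugate elements, and \<open>y\<close> in \<open>KK\<close> gives
  \<open>(1 - y * t) ^ P\<close>; these are the two kinds of pairs in
  \<open>K.upairs P\<close>.\<close>

lemma sum_conj_poly:
  fixes lam :: "'b poly \<Rightarrow> complex"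
  assumes lam1: "lam 1 = 1"
    and lam_mult: "\<And>F G. F \<in> K.upoly \<Longrightarrow> G \<in> K.upoly \<Longrightarrow> lam (F * G) = lam F * lam G"
  shows "(\<Sum>y\<in>LL - {0}. lam (conj_poly y)) = K.psum lam P"
proof -
  have "LL - {0} = (LL - KK) \<union> (KK - {0})" using KL by auto
  then have "(\<Sum>y\<in>LL - {0}. lam (conj_poly y)) =
      (\<Sum>y\<in>LL - KK. lam (conj_poly y)) + (\<Sum>y\<in>KK - {0}. lam (conj_poly y))"
    by (simp only:) (intro sum.union_disjoint; auto)
  also have "(\<Sum>y\<in>LL - KK. lam (conj_poly y)) =
      (\<Sum>g\<in>conj_poly ` (LL - KK). \<Sum>z\<in>{z \<in> LL - KK. conj_poly z = g}. lam (conj_poly z))"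
    by (rule sum.image_gen) simp
  also have "\<dots> = (\<Sum>g\<in>conj_poly ` (LL - KK). of_nat P * lam g)"
  proof (intro sum.cong refl)
    fix g assume "g \<in> conj_poly ` (LL - KK)"
    then obtain y where "y \<in> LL - KK" "g = conj_poly y" by auto
    then show "(\<Sum>z\<in>{z \<in> LL - KK. conj_poly z = g}. lam (conj_poly z)) = of_nat P * lam g"
      using conj_fiber by simp
  qed
  also have "\<dots> = of_nat P * (\<Sum>g\<in>Irr P. lam g)" by (simp add: conj_image sum_distrib_left)
  also have "(\<Sum>y\<in>KK - {0}. lam (conj_poly y)) = (\<Sum>y\<in>KK - {0}. lam [:1, - y:] ^ P)"
  proof (intro sum.cong refl)
    fix y assume y: "y \<in> KK - {0}"
    then have "conj_poly y = [:1, - y:] ^ P"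
      using Fix_pow[of y Q] by (simp add: conj_poly_def)
    moreover have "[:1, - y:] \<in> K.upoly" using y Irr_1 by (auto simp: Irr_def K.uirr_def)
    then have "lam ([:1, - y:] ^ n) = lam [:1, - y:] ^ n" for n
    proof (induction n)
      case (Suc n)
      then show ?case using lam_mult[of "[:1, - y:]" "[:1, - y:] ^ n"] K.upoly_power by (simp only: power_Suc)
    qed (simp add: lam1)
    ultimately show "lam (conj_poly y) = lam [:1, - y:] ^ P" by simp
  qed
  also have "\<dots> = (\<Sum>g\<in>Irr 1. lam g ^ P)"
    unfolding Irr_1 by (subst sum.reindex) (auto simp: inj_on_def)
  finally show ?thesis by (simp add: psum_prime)
qed

end

section \<open>Gauss sums of characters ramified at the degree\<close>

definition mchar :: "('b::field \<Rightarrow> complex) \<Rightarrow> bool" where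
  "mchar \<chi> \<longleftrightarrow> \<chi> 0 = 0 \<and> \<chi> 1 = 1 \<and> (\<forall>x y. \<chi> (x * y) = \<chi> x * \<chi> y)"

lemma mchar_simps:
  assumes "mchar \<chi>"
  shows "\<chi> 0 = 0" "\<chi> 1 = 1" "\<chi> (x * y) = \<chi> x * \<chi> y" "\<chi> (x ^ n) = \<chi> x ^ n"
proof -
  show *: "\<chi> 0 = 0" "\<chi> 1 = 1" "\<chi> (x * y) = \<chi> x * \<chi> y" for x y
    using assms by (auto simp: mchar_def)
  show "\<chi> (x ^ n) = \<chi> x ^ n" by (induction n) (simp_all add: *)
qed

lemma mchar_nz: "mchar \<chi> \<Longrightarrow> x \<noteq> 0 \<Longrightarrow> \<chi> x \<noteq> 0"
  using mchar_simps(2)[of \<chi>] mchar_simps(3)[of \<chi> x "inverse x"] by auto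

context prime_step
begin

text \<open>
  For \<open>y\<close> in the large field, \<open>lam \<kappa> (conj_poly y)\<close> is \<open>\<kappa>\<close> of the norm of \<open>y\<close> times \<open>\<psi>\<close> of the trace of
  \<open>y\<^bsup>P\<^esup>\<close>. By multiplicativity, sums of such values are coefficients of an L-function.
\<close>

definition lam :: "('b \<Rightarrow> complex) \<Rightarrow> 'b poly \<Rightarrow> complex" where
  "lam \<kappa> F = \<kappa> ((-1) ^ degree F * lead_coeff F) * psi r (rootsum P F)"

lemma lam_1: "mchar \<kappa> \<Longrightarrow> lam \<kappa> 1 = 1"
  by (simp add: lam_def mchar_simps)

lemma lam_mult:
  assumes "mchar \<kappa>" "F \<in> K.upoly" "G \<in> K.upoly"
  shows "lam \<kappa> (F * G) = lam \<kappa> F * lam \<kappa> G"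
proof -
  have 1: "coeff F 0 \<noteq> 0" "coeff G 0 \<noteq> 0" using assms by (auto simp: K.upoly_def)
  have "rootsum P (F * G) = rootsum P F + rootsum P G" using 1 by (rule rootsum_mult)
  then have "psi r (rootsum P (F * G)) = psi r (rootsum P F) * psi r (rootsum P G)"
    using psi_add[OF K.rootsum_K[OF assms(2)] K.rootsum_K[OF assms(3)]] by simp
  moreover have "(-1) ^ degree (F * G) * lead_coeff (F * G) =
      ((-1) ^ degree F * lead_coeff F) * ((-1) ^ degree G * lead_coeff G)"
    unfolding lead_coeff_mult using K.upoly_degree_mult[OF assms(2,3)] by (simp add: power_add)
  ultimately show ?thesis unfolding lam_def using mchar_simps(3)[OF assms(1)] by simp
qed

text \<open>The substitution \<open>t \<mapsto> \<omega>t\<close> preserves the \<open>P\<close>-th power sum.\<close>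

lemma sum_lam_low:
  assumes k: "mchar \<kappa>" and w: "\<omega> \<in> KK" "\<omega> ^ P = 1" "\<kappa> \<omega> \<noteq> 1" and n: "0 < n" "n < P"
  shows "(\<Sum>F\<in>K.upoly_deg n. lam \<kappa> F) = 0"
proof -
  have w0: "\<omega> \<noteq> 0" using w(2) P_gt_1 by (auto simp: power_0_left)
  have scale: "pcompose F [:0, c:] \<in> K.upoly_deg n \<and> lam \<kappa> (pcompose F [:0, c:]) = \<kappa> c ^ n * lam \<kappa> F"
    if F: "F \<in> K.upoly_deg n" and c: "c \<in> KK" "c ^ P = 1" for F c
  proof -
    have c0: "c \<noteq> 0" using c P_gt_1 by (auto simp: power_0_left)
    have d: "degree (pcompose F [:0, c:]) = n" using F c0 by (simp add: K.upoly_deg_def degree_pcompose)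
    have "coeff (pcompose F [:0, c:]) 0 = 1"
      using F by (subst coeff_pcompose_linear) (simp add: K.upoly_deg_def K.upoly_def)
    moreover have "pcompose F [:0, c:] \<in> K.Kpoly"
      using F c by (auto simp: K.upoly_deg_def K.upoly_def K.Kpoly_def coeff_pcompose_linear intro!: K.mult_K K.power_K)
    ultimately have "pcompose F [:0, c:] \<in> K.upoly" by (simp add: K.upoly_def)
    moreover have e1: "rootsum P (pcompose F [:0, c:]) = rootsum P F"
      using F c P_gt_1 by (intro rootsum_scale) (auto simp: K.upoly_deg_def K.upoly_def)
    moreover have "lam \<kappa> (pcompose F [:0, c:]) = \<kappa> c ^ n * lam \<kappa> F"
    proof -
      have "(-1) ^ n * coeff (pcompose F [:0, c:]) n = c ^ n * ((-1) ^ n * coeff F n)"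
        unfolding coeff_pcompose_linear by (simp only: mult.left_commute)
      then have "lam \<kappa> (pcompose F [:0, c:]) = \<kappa> (c ^ n * ((-1) ^ n * coeff F n)) * psi r (rootsum P F)"
        unfolding lam_def d e1 by (rule arg_cong)
      also have "\<dots> = \<kappa> c ^ n * (\<kappa> ((-1) ^ n * coeff F n) * psi r (rootsum P F))"
        by (simp only: mchar_simps[OF k] mult.assoc)
      also have "\<kappa> ((-1) ^ n * coeff F n) * psi r (rootsum P F) = lam \<kappa> F"
        using F by (simp add: lam_def K.upoly_deg_def)
      finally show ?thesis .
    qed
    ultimately show ?thesis using d by (simp add: K.upoly_deg_def)
  qed
  have iw: "inverse \<omega> \<in> KK" "inverse \<omega> ^ P = 1" using w K.inverse_K by (auto simp: power_inverse)
  have comp: "pcompose (pcompose F [:0, a:]) [:0, b:] = F" if "a * b = 1" for F :: "'b poly" and a b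
  proof (rule poly_eqI)
    fix i
    have "b ^ i * a ^ i = 1" using that by (simp add: mult.commute flip: power_mult_distrib)
    then show "coeff (pcompose (pcompose F [:0, a:]) [:0, b:]) i = coeff F i"
      by (simp add: coeff_pcompose_linear flip: mult.assoc)
  qed
  have "(\<Sum>F\<in>K.upoly_deg n. lam \<kappa> F) = (\<Sum>F\<in>K.upoly_deg n. lam \<kappa> (pcompose F [:0, \<omega>:]))"
  proof (rule sum.reindex_bij_witness[of _ "\<lambda>F. pcompose F [:0, \<omega>:]" "\<lambda>F. pcompose F [:0, inverse \<omega>:]"])
    fix F assume F: "F \<in> K.upoly_deg n"
    show "pcompose (pcompose F [:0, inverse \<omega>:]) [:0, \<omega>:] = F"
      "pcompose (pcompose F [:0, \<omega>:]) [:0, inverse \<omega>:] = F"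
      using w0 by (auto intro!: comp)
    then show "lam \<kappa> (pcompose (pcompose F [:0, inverse \<omega>:]) [:0, \<omega>:]) = lam \<kappa> F" by simp
    show "pcompose F [:0, inverse \<omega>:] \<in> K.upoly_deg n" using scale[OF F iw] by simp
    show "pcompose F [:0, \<omega>:] \<in> K.upoly_deg n" using scale[OF F w(1,2)] by simp
  qed
  also have "\<dots> = \<kappa> \<omega> ^ n * (\<Sum>F\<in>K.upoly_deg n. lam \<kappa> F)"
    unfolding sum_distrib_left using scale[OF _ w(1,2)] by (intro sum.cong refl) blast
  finally have e: "(1 - \<kappa> \<omega> ^ n) * (\<Sum>F\<in>K.upoly_deg n. lam \<kappa> F) = 0" by (simp add: algebra_simps)
  have kP: "\<kappa> \<omega> ^ P = 1" using mchar_simps[OF k] w(2) by metis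
  \<comment> \<open>\<open>\<kappa> \<omega>\<close> is a nontrivial \<open>P\<close>-th root of
    unity and \<open>n\<close> is prime to \<open>P\<close>.\<close>
  have "\<kappa> \<omega> ^ n \<noteq> 1"
  proof
    assume 1: "\<kappa> \<omega> ^ n = 1"
    have "coprime n P" using n P_prime
      by (metis coprime_commute nat_dvd_not_less prime_imp_coprime_nat)
    then obtain x where x: "[n * x = 1] (mod P)" using cong_solve_coprime_nat by auto
    then obtain m where m: "n * x = P * m + 1"
      using P_gt_1 by (metis cong_def mod_less mult_div_mod_eq)
    have "1 = \<kappa> \<omega> ^ (n * x)" by (simp add: power_mult 1)
    also have "\<dots> = \<kappa> \<omega>" unfolding m by (simp add: power_add power_mult kP)
    finally show False using w(3) by simp
  qed
  then show ?thesis using e by simp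
qed

text \<open>
  If \<open>a\<^sub>s\<close> is the first nonzero coefficient with \<open>1 \<le> s \<le> (P - 1) / 2\<close>, then adding
  \<open>(z / a\<^sub>s) t\<^bsup>P - s\<^esup>\<close> changes the \<open>P\<close>-th power sum by \<open>P z\<close>, so the polynomials with such a coefficient cancel.
\<close>

lemma sum_lam_top:
  assumes k: "mchar \<kappa>"
  shows "(\<Sum>F\<in>K.upoly_deg P. lam \<kappa> F) =
    of_nat (Q ^ ((P - 1) div 2)) * (\<Sum>x\<in>KK. \<kappa> (- x) * psi r (- (of_nat P * x)))"
proof -
  define R where "R = (P - 1) div 2"
  have PR: "P = 2 * R + 1" using P_odd by (simp add: R_def)
  have R1: "R \<ge> 1" using PR P_gt_1 by (cases R) auto
  define V where "V = {F \<in> K.upoly. degree F \<le> P}"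
  have finV: "finite V" unfolding V_def by (rule finite_subset[OF _ K.finite_coeff_polys[of P]]) auto
  define mu where "mu = (\<lambda>F. \<kappa> (- coeff F P) * psi r (rootsum P F))"
  have "(\<Sum>F\<in>K.upoly_deg P. lam \<kappa> F) = (\<Sum>F\<in>K.upoly_deg P. mu F)"
    using P_odd by (intro sum.cong refl) (auto simp: K.upoly_deg_def lam_def mu_def)
  also have "\<dots> = sum mu V"
  proof (rule sum.mono_neutral_left[OF finV])
    show "K.upoly_deg P \<subseteq> V" by (auto simp: K.upoly_deg_def V_def)
    show "\<forall>F\<in>V - K.upoly_deg P. mu F = 0"
    proof
      fix F assume "F \<in> V - K.upoly_deg P"
      then have "degree F < P" by (auto simp: V_def K.upoly_deg_def)
      then have "coeff F P = 0" by (rule coeff_eq_0)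
      then show "mu F = 0" using mchar_simps[OF k] by (simp add: mu_def)
    qed
  qed
  finally have 1: "(\<Sum>F\<in>K.upoly_deg P. lam \<kappa> F) = sum mu V" .
  define V0 where "V0 = {F \<in> V. \<forall>i\<in>{1..R}. coeff F i = 0}"
  define s where "s = (\<lambda>F :: 'b poly. LEAST i. i \<in> {1..R} \<and> coeff F i \<noteq> 0)"
  have s: "s F \<in> {1..R} \<and> coeff F (s F) \<noteq> 0 \<and> (\<forall>i. 0 < i \<and> i < s F \<longrightarrow> coeff F i = 0)"
    if "F \<in> V - V0" for F
  proof -
    have ex: "\<exists>i. i \<in> {1..R} \<and> coeff F i \<noteq> 0" using that by (auto simp: V0_def)
    have a: "s F \<in> {1..R} \<and> coeff F (s F) \<noteq> 0" unfolding s_def using LeastI_ex[OF ex] .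
    have "coeff F i = 0" if "0 < i" "i < s F" for i
      using not_less_Least[of i "\<lambda>i. i \<in> {1..R} \<and> coeff F i \<noteq> 0"] that a by (auto simp: s_def)
    then show ?thesis using a by blast
  qed
  obtain y where y: "y \<in> KK" "psi r y \<noteq> 1" using psi_nontrivial[OF r_dvd] by auto
  define T where "T = (\<lambda>z (F :: 'b poly). F + monom (z / coeff F (s F)) (P - s F))"
  have T: "T z F \<in> V - V0 \<and> s (T z F) = s F \<and> coeff (T z F) (s F) = coeff F (s F) \<and>
      mu (T z F) = mu F * psi r (of_nat P * z)"
    if F: "F \<in> V - V0" and z: "z \<in> KK" for F z
  proof -
    note sF = s[OF F]
    define N where "N = P - s F"
    define c where "c = z / coeff F (s F)"
    \<comment> \<open>\<open>s F \<le> R\<close> places the altered coefficient above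
      \<open>R\<close> and gives \<open>P < 2 * N\<close>, as \<open>rootsum_perturb\<close>
      requires.\<close>
    have N: "R < N" "N < P" "N \<ge> 1" "P < 2 * N" "P - N = s F" using sF PR by (auto simp: N_def)
    have FV: "F \<in> K.upoly" "degree F \<le> P" "coeff F 0 = 1" "\<And>i. coeff F i \<in> KK"
      using F by (auto simp: V_def K.upoly_def K.Kpoly_def)
    have c: "c \<in> KK" using z FV K.divide_K by (auto simp: c_def)
    have co: "coeff (T z F) i = coeff F i" if "i \<le> R" for i
      using that N by (simp add: T_def flip: N_def c_def)
    have coP: "coeff (T z F) P = coeff F P" using N by (simp add: T_def flip: N_def c_def)
    have "T z F \<in> K.Kpoly" using FV c unfolding T_def N_def[symmetric] c_def[symmetric]
      by (intro K.Kpoly_add K.Kpoly_monom) (auto simp: K.upoly_def)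
    moreover have "degree (T z F) \<le> P" unfolding T_def N_def[symmetric] c_def[symmetric]
      using FV N by (intro degree_add_le) (auto intro: order_trans[OF degree_monom_le])
    ultimately have TV: "T z F \<in> V" using co[of 0] FV by (simp add: V_def K.upoly_def)
    have "T z F \<notin> V0" using F co TV by (auto simp: V0_def)
    moreover have "s (T z F) = s F" unfolding s_def
      by (rule arg_cong[where f = Least]) (use co in \<open>auto simp: fun_eq_iff\<close>)
    moreover have "mu (T z F) = mu F * psi r (of_nat P * z)"
    proof -
      have "rootsum P (T z F) = rootsum P F - of_nat P * c * fps_nth (inverse (fps_of_poly F)) (P - N)"
        unfolding T_def N_def[symmetric] c_def[symmetric]
        using N FV by (intro rootsum_perturb) auto
      also have "fps_nth (inverse (fps_of_poly F)) (P - N) = - coeff F (s F)"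
        unfolding N(5) using sF FV by (intro fps_inverse_low) auto
      finally have "rootsum P (T z F) = rootsum P F + of_nat P * z" using sF by (simp add: c_def)
      moreover have "of_nat P * z \<in> KK" using z K.of_nat_K K.mult_K by simp
      ultimately show ?thesis using K.rootsum_K[OF FV(1)] by (simp add: mu_def coP psi_add)
    qed
    ultimately show ?thesis using TV co sF by auto
  qed
  have Tinv: "T (- z) (T z F) = F" if F: "F \<in> V - V0" and z: "z \<in> KK" for F z
  proof -
    have "T (- z) G = G + monom (- z / coeff G (s G)) (P - s G)" for G by (simp add: T_def)
    then have "T (- z) (T z F) = T z F + monom (- z / coeff F (s F)) (P - s F)"
      using T[OF F z] by simp
    then show ?thesis by (simp add: T_def add_monom)
  qed
  \<comment> \<open>Chosen so that the \<open>P\<close>-th power sum moves by exactly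
    \<open>y\<close>, where \<open>psi r\<close> is not 1.\<close>
  define z0 where "z0 = y / of_nat P"
  have z0: "z0 \<in> KK" "of_nat P * z0 = y" using y K.divide_K K.of_nat_K P_nz by (auto simp: z0_def)
  have "sum mu (V - V0) = (\<Sum>F\<in>V - V0. mu (T z0 F))"
  proof (rule sum.reindex_bij_witness[of _ "T z0" "T (- z0)"])
    fix F assume F: "F \<in> V - V0"
    have mz: "- z0 \<in> KK" using z0 K.uminus_K by simp
    show "T z0 (T (- z0) F) = F" using Tinv[OF F mz] by simp
    show "T (- z0) F \<in> V - V0" using T[OF F mz] by simp
    show "mu (T z0 (T (- z0) F)) = mu F" using Tinv[OF F mz] by simp
    show "T (- z0) (T z0 F) = F" using Tinv[OF F z0(1)] .
    show "T z0 F \<in> V - V0" using T[OF F z0(1)] by simp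
  qed
  also have "\<dots> = sum mu (V - V0) * psi r y"
    unfolding sum_distrib_right using T z0 by (intro sum.cong refl) auto
  finally have 2: "sum mu (V - V0) = 0" using y(2) by simp
  have 3: "mu F = \<kappa> (- coeff F P) * psi r (- (of_nat P * coeff F P))" if "F \<in> V0" for F
  proof -
    have "rootsum P F = - of_nat P * coeff F P"
      using that PR by (intro rootsum_top[of _ "R + 1"]) (auto simp: V0_def V_def K.upoly_def)
    then show ?thesis by (simp add: mu_def)
  qed
  have 4: "card {F \<in> V0. coeff F P = x} = Q ^ R" if x: "x \<in> KK" for x
  proof -
    \<comment> \<open>The free coefficients are those in positions \<open>R + 1\<close> to
      \<open>P - 1\<close>, and there are \<open>R\<close> of them since
      \<open>P = 2 * R + 1\<close>.\<close>
    define X where "X = (\<lambda>i. if i = 0 then {1} else if i \<le> R then {0} else if i < P then KK else {x})"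
    have "{F \<in> V0. coeff F P = x} = {F :: 'b poly. (\<forall>i\<le>P. coeff F i \<in> X i) \<and> (\<forall>i>P. coeff F i = 0)}"
    proof (intro equalityI subsetI)
      fix F assume "F \<in> {F \<in> V0. coeff F P = x}"
      then show "F \<in> {F. (\<forall>i\<le>P. coeff F i \<in> X i) \<and> (\<forall>i>P. coeff F i = 0)}"
        by (auto simp: X_def V0_def V_def K.upoly_def K.Kpoly_def coeff_eq_0)
    next
      fix F assume F: "F \<in> {F. (\<forall>i\<le>P. coeff F i \<in> X i) \<and> (\<forall>i>P. coeff F i = 0)}"
      have X: "coeff F i \<in> X i" if "i \<le> P" for i using F that by simp
      have "coeff F i \<in> KK" for i
      proof -
        consider "i = 0" | "0 < i \<and> i \<le> R" | "R < i \<and> i < P" | "i = P" | "i > P" by linarith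
        then show ?thesis
          by cases (use X[of i] F x PR R1 in \<open>auto simp: X_def\<close>)
      qed
      moreover have "coeff F 0 = 1" using X[of 0] by (simp add: X_def)
      moreover have "coeff F P = x" using X[of P] PR R1 by (simp add: X_def)
      moreover have "coeff F i = 0" if "i \<in> {1..R}" for i
        using X[of i] that PR by (simp add: X_def)
      moreover have "degree F \<le> P" using F by (auto intro: degree_le)
      ultimately show "F \<in> {F \<in> V0. coeff F P = x}"
        by (auto simp: V0_def V_def K.upoly_def K.Kpoly_def)
    qed
    then have "card {F \<in> V0. coeff F P = x} = (\<Prod>i\<le>P. card (X i))"
      by (simp add: K.card_polys_coeffs)
    also have "\<dots> = (\<Prod>i\<in>{R+1..P-1}. card (X i))"
      using PR by (intro prod.mono_neutral_right) (auto simp: X_def)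
    also have "\<dots> = (\<Prod>i\<in>{R+1..P-1}. Q)"
      using PR by (intro prod.cong) (auto simp: X_def card_KK)
    also have "\<dots> = Q ^ R" using PR by simp
    finally show ?thesis .
  qed
  have "sum mu V = sum mu (V - V0) + sum mu V0"
    using finV by (intro sum.subset_diff) (auto simp: V0_def)
  also have "\<dots> = (\<Sum>F\<in>V0. \<kappa> (- coeff F P) * psi r (- (of_nat P * coeff F P)))"
    using 2 3 by (simp cong: sum.cong)
  also have "\<dots> = (\<Sum>x\<in>KK. \<Sum>F\<in>{F \<in> V0. coeff F P = x}. \<kappa> (- coeff F P) * psi r (- (of_nat P * coeff F P)))"
  proof (rule sum.group[symmetric])
    show "finite V0" using finV by (auto simp: V0_def)
    show "(\<lambda>F. coeff F P) ` V0 \<subseteq> KK" by (auto simp: V0_def V_def K.upoly_def K.Kpoly_def)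
  qed simp
  also have "\<dots> = (\<Sum>x\<in>KK. of_nat (Q ^ R) * (\<kappa> (- x) * psi r (- (of_nat P * x))))"
    using 4 by (intro sum.cong refl) simp
  finally show ?thesis using 1 by (simp add: R_def sum_distrib_left)
qed

text \<open>The L-function has no coefficients strictly between degrees 0 and \<open>P\<close>, so
  Newton's identity at \<open>P\<close> keeps only the term \<open>s = P\<close>.\<close>

lemma gauss_core:
  assumes k: "mchar \<kappa>" and w: "\<omega> \<in> KK" "\<omega> ^ P = 1" "\<kappa> \<omega> \<noteq> 1"
  shows "(\<Sum>y\<in>LL - {0}. \<kappa> (cnorm y) * psi r (\<Sum>i<P. (y ^ P) ^ (Q ^ i))) =
    of_nat P * of_nat (Q ^ ((P - 1) div 2)) * (\<Sum>x\<in>KK. \<kappa> (- x) * psi r (- (of_nat P * x)))"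
proof -
  have "(\<Sum>y\<in>LL - {0}. \<kappa> (cnorm y) * psi r (\<Sum>i<P. (y ^ P) ^ (Q ^ i))) =
     (\<Sum>y\<in>LL - {0}. lam \<kappa> (conj_poly y))"
  proof (intro sum.cong refl)
    fix y assume "y \<in> LL - {0}"
    then have "y \<noteq> 0" by simp
    then show "\<kappa> (cnorm y) * psi r (\<Sum>i<P. (y ^ P) ^ (Q ^ i)) = lam \<kappa> (conj_poly y)"
      using lead_conj_poly[of y] degree_conj_poly[of y] P_odd P_gt_1
      by (simp add: lam_def rootsum_conj_poly)
  qed
  also have "\<dots> = K.psum (lam \<kappa>) P"
    by (rule sum_conj_poly) (use k lam_1 lam_mult in auto)
  also have "\<dots> = of_nat P * (\<Sum>F\<in>K.upoly_deg P. lam \<kappa> F)"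
  proof -
    have "of_nat P * (\<Sum>F\<in>K.upoly_deg P. lam \<kappa> F) =
       (\<Sum>s\<in>{1..P}. K.psum (lam \<kappa>) s * (\<Sum>F\<in>K.upoly_deg (P - s). lam \<kappa> F))"
      by (rule K.newton_upoly) (use k lam_1 lam_mult in auto)
    also have "\<dots> = (\<Sum>s\<in>{P}. K.psum (lam \<kappa>) s * (\<Sum>F\<in>K.upoly_deg (P - s). lam \<kappa> F))"
    proof (rule sum.mono_neutral_right)
      show "\<forall>s\<in>{1..P} - {P}. K.psum (lam \<kappa>) s * (\<Sum>F\<in>K.upoly_deg (P - s). lam \<kappa> F) = 0"
        using sum_lam_low[OF k w] by auto
    qed (use P_gt_1 in auto)
    also have "\<dots> = K.psum (lam \<kappa>) P" by (simp add: K.upoly_deg_0 lam_1[OF k])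
    finally show ?thesis by simp
  qed
  finally show ?thesis by (simp add: sum_lam_top[OF k] mult.assoc)
qed

end

context prim_field
begin

text \<open>\<open>\<chi>\<close> lives on the whole field and is only restricted, so that sums at
  different levels can be compared for one character.\<close>

definition gauss :: "nat \<Rightarrow> ('b \<Rightarrow> complex) \<Rightarrow> complex" where
  "gauss r \<chi> = (\<Sum>x\<in>Fix (p ^ r). \<chi> x * psi r x)"

lemma gauss_nz:
  assumes "mchar \<chi>"
  shows "gauss r \<chi> = (\<Sum>x\<in>Fix (p ^ r) - {0}. \<chi> x * psi r x)"
  unfolding gauss_def using mchar_simps[OF assms] by (intro sum.mono_neutral_right) auto

lemma tr_tower: "tr (r * n) x = tr r (\<Sum>i<n. x ^ (p ^ r) ^ i)"
proof -
  have "tr (r * n) x = (\<Sum>i<n. \<Sum>j\<in>{i * r..<i * r + r}. x ^ (p ^ j))"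
    unfolding tr_def using sum.nat_group[of "\<lambda>j. x ^ (p ^ j)" r n] by (simp add: mult.commute)
  also have "\<dots> = (\<Sum>i<n. \<Sum>j<r. (x ^ (p ^ r) ^ i) ^ (p ^ j))"
  proof (rule sum.cong[OF refl])
    fix i
    have "(\<Sum>j\<in>{i * r..<i * r + r}. x ^ (p ^ j)) = (\<Sum>j<r. x ^ (p ^ (j + i * r)))"
      using sum.shift_bounds_nat_ivl[of "\<lambda>j. x ^ (p ^ j)" 0 "i * r" r] by (simp add: atLeast0LessThan add.commute)
    then show "(\<Sum>j\<in>{i * r..<i * r + r}. x ^ (p ^ j)) = (\<Sum>j<r. (x ^ (p ^ r) ^ i) ^ (p ^ j))"
      by (simp add: power_add mult.commute flip: power_mult)
  qed
  also have "\<dots> = tr r (\<Sum>i<n. x ^ (p ^ r) ^ i)"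
    unfolding tr_def frob_sum by (rule sum.swap)
  finally show ?thesis .
qed

lemma psi_tower: "psi (r * n) x = psi r (\<Sum>i<n. x ^ (p ^ r) ^ i)"
  by (simp add: psi_def tr_tower)

end

lemma geom_sum_nat: "(Q :: nat) \<ge> 1 \<Longrightarrow> Q ^ n - 1 = (Q - 1) * (\<Sum>i<n. Q ^ i)"
proof -
  assume Q: "Q \<ge> 1"
  have "int (Q ^ n) - 1 = (int Q - 1) * (\<Sum>i<n. int Q ^ i)"
    using power_diff_1_eq[of "int Q" n] by (simp add: mult.commute)
  then have "int (Q ^ n - 1) = int ((Q - 1) * (\<Sum>i<n. Q ^ i))"
    using Q by (simp add: of_nat_diff)
  then show ?thesis by (simp only: of_nat_eq_iff)
qed

lemma sum_power_expand: "\<exists>R::nat. (\<Sum>i<n. (1 + w) ^ i) = n + w * (\<Sum>i<n. i) + w\<^sup>2 * R"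
proof (induction n)
  case (Suc n)
  have "\<exists>S::nat. (1 + w) ^ n = 1 + n * w + w\<^sup>2 * S"
  proof (induction n)
    case (Suc n)
    then obtain S where "(1 + w) ^ n = 1 + n * w + w\<^sup>2 * S" by auto
    then have "(1 + w) ^ Suc n = 1 + Suc n * w + w\<^sup>2 * (S + n + w * S)"
      by (simp add: algebra_simps power2_eq_square)
    then show ?case by blast
  qed auto
  then obtain S where S: "(1 + w) ^ n = 1 + n * w + w\<^sup>2 * S" by auto
  from Suc obtain R where "(\<Sum>i<n. (1 + w) ^ i) = n + w * (\<Sum>i<n. i) + w\<^sup>2 * R" by auto
  then have "(\<Sum>i<Suc n. (1 + w) ^ i) = Suc n + w * (\<Sum>i<Suc n. i) + w\<^sup>2 * (R + S)"
    using S by (simp add: algebra_simps)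
  then show ?case by blast
qed auto

text \<open>Put \<open>w = Q - 1\<close>: the linear term of the expansion is
  \<open>w * P * (P - 1) / 2\<close>, a multiple of \<open>w * P\<close> as \<open>P\<close> is odd,
  and \<open>w ^ 2\<close> is one as \<open>P dvd w\<close>. Hence the norm of \<open>y\<close> is
  \<open>y ^ P\<close> up to a power of \<open>y ^ ((Q - 1) * P)\<close>.\<close>

lemma geom_sum_expand:
  fixes Q P :: nat
  assumes "P dvd Q - 1" "odd P" "Q > 1"
  shows "\<exists>t. (\<Sum>i<P. Q ^ i) = P + (Q - 1) * P * t"
proof -
  define w where "w = Q - 1"
  have Q: "Q = 1 + w" using assms by (simp add: w_def)
  obtain v where v: "w = P * v" using assms by (auto simp: w_def)
  obtain u where u: "P = 2 * u + 1" using assms(2) by (auto elim: oddE)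
  obtain R where "(\<Sum>i<P. (1 + w) ^ i) = P + w * (\<Sum>i<P. i) + w\<^sup>2 * R"
    using sum_power_expand by blast
  moreover have "(\<Sum>i<P. i) = P * u"
  proof -
    have "(\<Sum>i<P. i) = P * (P - 1) div 2"
      using gauss_sum_nat[of "P - 1"] u by (simp add: atLeast0AtMost lessThan_Suc_atMost flip: lessThan_Suc_atMost)
    then show ?thesis using u by simp
  qed
  moreover have "w\<^sup>2 * R = w * P * (v * R)" unfolding power2_eq_square using v by (simp add: mult_ac)
  ultimately have "(\<Sum>i<P. (1 + w) ^ i) = P + w * P * (u + v * R)" by (simp add: algebra_simps)
  then show ?thesis unfolding Q by auto
qed

context prime_step
begin

lemma power_period:
  fixes u :: 'b
  assumes "u ^ M = 1" shows "u ^ (i mod M) = u ^ i"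
proof -
  have "u ^ (M * (i div M) + i mod M) = u ^ (i mod M)"
    by (simp only: power_add power_mult assms) simp
  then show ?thesis by simp
qed

lemma LL_nz_iff: "x \<in> LL - {0} \<longleftrightarrow> (\<exists>i. x = (\<gamma> ^ stride (r * P)) ^ i)"
  by (simp only: Fix_nz_iff[OF rP] power_mult[of \<gamma> "stride (r * P)"])

lemma gen_LL_order: "(\<gamma> ^ stride (r * P)) ^ (Q ^ P - 1) = 1"
proof -
  have "stride (r * P) * (Q ^ P - 1) = qm" using stride_mult[OF rP] by (simp only: power_mult)
  then show ?thesis using gamma_pow_card by (simp only: power_mult[of \<gamma> "stride (r * P)", symmetric])
qed

lemma QP_gt_1: "1 < Q ^ P"
  by (rule one_less_power) (use Q_gt_1 P_gt_1 in \<open>simp_all only:\<close>)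

lemma pow_Q: "x ^ Q = x * x ^ (Q - 1)" for x :: "'c::monoid_mult"
  by (metis Q_gt_1 gr_implies_not0 power_eq_if)

lemma bij_LL:
  defines "u \<equiv> \<gamma> ^ stride (r * P)"
  shows "bij_betw (\<lambda>j. u ^ j) {..<Q ^ P - 1} (LL - {0})"
proof -
  have u_order: "u ^ (Q ^ P - 1) = 1"
    unfolding u_def by (rule gen_LL_order)
  have im: "(\<lambda>j. u ^ j) ` {..<Q ^ P - 1} = LL - {0}"
  proof (intro equalityI subsetI)
    fix x assume "x \<in> LL - {0}"
    then obtain i where "x = u ^ i" using LL_nz_iff[of x] unfolding u_def by blast
    then have "x = u ^ (i mod (Q ^ P - 1))" using power_period[OF u_order] by simp
    moreover have "i mod (Q ^ P - 1) < Q ^ P - 1" using QP_gt_1 by simp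
    ultimately show "x \<in> (\<lambda>j. u ^ j) ` {..<Q ^ P - 1}" by blast
  next
    fix x assume "x \<in> (\<lambda>j. u ^ j) ` {..<Q ^ P - 1}"
    then show "x \<in> LL - {0}" using LL_nz_iff[of x] unfolding u_def by blast
  qed
  have "card (LL - {0}) = Q ^ P - 1" by (simp add: card_Diff_singleton card_LL)
  then have "inj_on (\<lambda>j. u ^ j) {..<Q ^ P - 1}"
    by (intro eq_card_imp_inj_on) (simp_all only: im card_lessThan finite_lessThan)
  then show ?thesis using im by (simp add: bij_betw_def)
qed

text \<open>
  The Frobenius replaces \<open>\<chi>\<close> by \<open>\<chi>\<eta>\<close> with \<open>\<eta> = \<chi>\<^bsup>Q - 1\<^esup>\<close> of order \<open>P\<close>. Averaging over the powers of \<open>\<eta>\<close>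
  restricts the Gauss sum to \<open>P\<close>-th powers, where \<open>\<chi>(y\<^bsup>P\<^esup>)\<close> is \<open>\<chi>\<close> of the norm of \<open>y\<close>.
\<close>

lemma gauss_step_ramified:
  assumes chi: "mchar \<chi>" and PQ: "P dvd Q - 1"
    and h1: "\<And>z. z \<in> LL - {0} \<Longrightarrow> \<chi> z ^ ((Q - 1) * P) = 1"
    and h2: "z0 \<in> LL - {0}" "\<chi> z0 ^ (Q - 1) \<noteq> 1"
    and h3: "\<And>x. x \<in> Fix p - {0} \<Longrightarrow> \<chi> x = 1"
  shows "gauss (r * P) \<chi> = of_nat (Q ^ ((P - 1) div 2)) * gauss r \<chi>"
proof -
  note cs = mchar_simps[OF chi]
  define \<eta> where "\<eta> = (\<lambda>z. \<chi> z ^ (Q - 1))"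
  \<comment> \<open>The number of nonzero \<open>P\<close>-th powers in the large field.\<close>
  define N' where "N' = (Q ^ P - 1) div P"
  define u where "u = \<gamma> ^ stride (r * P)"
  have u_iff: "x \<in> LL - {0} \<longleftrightarrow> (\<exists>i. x = u ^ i)" for x
    using LL_nz_iff[of x] unfolding u_def .
  have uL: "u ^ i \<in> LL - {0}" for i using u_iff by blast
  have u_order: "u ^ (Q ^ P - 1) = 1"
    unfolding u_def by (rule gen_LL_order)
  obtain t where t: "(\<Sum>i<P. Q ^ i) = P + (Q - 1) * P * t"
    using geom_sum_expand[OF PQ P_odd Q_gt_1] by blast
  have QP1: "Q ^ P - 1 = (Q - 1) * (\<Sum>i<P. Q ^ i)"
    using geom_sum_nat[of Q P] Q_gt_1 by linarith
  have N': "Q ^ P - 1 = P * N'" "N' = (Q - 1) * (1 + (Q - 1) * t)"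
  proof -
    have e: "Q ^ P - 1 = P * ((Q - 1) * (1 + (Q - 1) * t))" unfolding QP1 t by (simp add: algebra_simps)
    then show "N' = (Q - 1) * (1 + (Q - 1) * t)" using P_gt_1 by (simp add: N'_def)
    then show "Q ^ P - 1 = P * N'" using e by simp
  qed
  have eta_P: "\<eta> z ^ P = 1" if "z \<in> LL - {0}" for z using h1[OF that] by (simp add: \<eta>_def power_mult)
  have eta_Q1: "\<eta> z ^ (Q - 1) = 1" if "z \<in> LL - {0}" for z
    using eta_P[OF that] PQ by (auto simp: power_mult elim!: dvdE)
  have eta_pow: "\<eta> (x ^ n) = \<eta> x ^ n" for x n by (simp add: \<eta>_def cs flip: power_mult) (simp add: mult.commute)
  have eta_u: "\<eta> u \<noteq> 1"
  proof
    assume 1: "\<eta> u = 1"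
    obtain i where "z0 = u ^ i" using h2(1) u_iff by blast
    then have "\<eta> z0 = 1" using 1 by (simp add: eta_pow)
    then show False using h2(2) by (simp add: \<eta>_def)
  qed
  have eta_u_dvd: "\<eta> (u ^ n) = 1 \<longleftrightarrow> P dvd n" for n
  proof
    assume 1: "\<eta> (u ^ n) = 1"
    show "P dvd n"
    proof (rule ccontr)
      assume "\<not> P dvd n"
      then have "coprime n P" using P_prime by (metis coprime_commute prime_imp_coprime_nat)
      then obtain x where x: "[n * x = 1] (mod P)" using cong_solve_coprime_nat by auto
      then obtain m where m: "n * x = P * m + 1"
        using P_gt_1 by (metis cong_def mod_less mult_div_mod_eq)
      have "1 = \<eta> u ^ (n * x)" using 1 by (simp add: eta_pow power_mult)
      also have "\<dots> = \<eta> u" unfolding m using eta_P[of u] uL[of 1] by (simp add: power_add power_mult)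
      finally show False using eta_u by simp
    qed
  next
    assume "P dvd n"
    then show "\<eta> (u ^ n) = 1" using eta_P[of u] uL[of 1] by (auto simp: eta_pow power_mult elim!: dvdE)
  qed
  \<comment> \<open>A \<open>P\<close>-th root of unity in \<open>KK\<close>. As
    \<open>N' = (Q - 1) * (1 + (Q - 1) * t)\<close> and \<open>\<eta> u ^ (Q - 1) = 1\<close>, the
    value of \<open>\<chi>\<close> there is \<open>\<eta> u\<close>, which is not 1.\<close>
  define \<omega> where "\<omega> = u ^ N'"
  have w1: "\<omega> ^ P = 1" using u_order N'(1) by (simp add: \<omega>_def mult.commute flip: power_mult)
  have w2: "\<omega> \<in> KK"
  proof -
    have "\<omega> ^ (Q - 1) = 1" using w1 PQ by (auto simp: power_mult elim!: dvdE)
    then have "\<omega> ^ Q = \<omega>" by (subst pow_Q) simp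
    then show ?thesis by (simp add: Fix_def)
  qed
  have w3: "\<chi> \<omega> \<noteq> 1"
  proof -
    have "\<chi> \<omega> = \<eta> u ^ (1 + (Q - 1) * t)" unfolding \<omega>_def N'(2) by (simp only: cs power_mult \<eta>_def)
    also have "\<dots> = \<eta> u" using eta_Q1[of u] uL[of 1] by (simp add: power_mult)
    finally show ?thesis using eta_u by simp
  qed
  define S where "S = (\<lambda>i. \<Sum>z\<in>LL - {0}. \<chi> z * \<eta> z ^ i * psi (r * P) z)"
  have Sstep: "S (Suc i) = S i" for i
  proof -
    have fr: "(z ^ Q) ^ (Q ^ (P - 1)) = z" if "z \<in> LL" for z
    proof -
      have "Q * Q ^ (P - 1) = Q ^ P" using P_gt_1 by (cases P) auto
      then show ?thesis using that conj_pow by (simp flip: power_mult)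
    qed
    have "S i = (\<Sum>z\<in>LL - {0}. \<chi> (z ^ Q) * \<eta> (z ^ Q) ^ i * psi (r * P) (z ^ Q))"
      unfolding S_def
    proof (rule sum.reindex_bij_witness[of _ "\<lambda>z. z ^ Q" "\<lambda>z. z ^ (Q ^ (P - 1))"])
      fix z assume z: "z \<in> LL - {0}"
      show "(z ^ (Q ^ (P - 1))) ^ Q = z" using fr[of z] z by (simp add: mult.commute flip: power_mult)
      show "z ^ (Q ^ (P - 1)) \<in> LL - {0}" using z L.power_K by auto
      show "(z ^ Q) ^ (Q ^ (P - 1)) = z" using fr[of z] z by simp
      show "z ^ Q \<in> LL - {0}" using z L.power_K by auto
      show "\<chi> ((z ^ (Q ^ (P - 1))) ^ Q) * \<eta> ((z ^ (Q ^ (P - 1))) ^ Q) ^ i * psi (r * P) ((z ^ (Q ^ (P - 1))) ^ Q)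
        = \<chi> z * \<eta> z ^ i * psi (r * P) z" using fr[of z] z by (simp add: mult.commute flip: power_mult)
    qed
    also have "\<dots> = S (Suc i)" unfolding S_def
    proof (intro sum.cong refl)
      fix z assume z: "z \<in> LL - {0}"
      have "\<chi> (z ^ Q) = \<chi> z * \<eta> z" by (simp only: cs \<eta>_def) (rule pow_Q)
      moreover have "\<eta> (z ^ Q) = \<eta> z"
      proof -
        have "\<eta> z ^ Q = \<eta> z * \<eta> z ^ (Q - 1)" by (rule pow_Q)
        then show ?thesis using eta_Q1[OF z] by (simp only: eta_pow mult_1_right)
      qed
      moreover have "psi (r * P) (z ^ Q) = psi (r * P) z" using z by (intro psi_frob_pow) simp
      ultimately show "\<chi> (z ^ Q) * \<eta> (z ^ Q) ^ i * psi (r * P) (z ^ Q) = \<chi> z * \<eta> z ^ Suc i * psi (r * P) z"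
        by simp
    qed
    finally show ?thesis by simp
  qed
  have S0: "S i = gauss (r * P) \<chi>" for i
    by (induction i) (simp_all add: Sstep, simp add: S_def gauss_nz[OF chi])
  have "of_nat P * gauss (r * P) \<chi> = (\<Sum>i<P. S i)" by (simp add: S0)
  also have "\<dots> = (\<Sum>z\<in>LL - {0}. \<chi> z * psi (r * P) z * (\<Sum>i<P. \<eta> z ^ i))"
    unfolding S_def sum_distrib_left by (subst sum.swap) (intro sum.cong refl, simp only: mult_ac)
  \<comment> \<open>The geometric sum detects \<open>\<eta> z = 1\<close>, which by
    \<open>eta_u_dvd\<close> means that \<open>z\<close> is a \<open>P\<close>-th power.\<close>
  also have "\<dots> = (\<Sum>z\<in>LL - {0}. if \<eta> z = 1 then of_nat P * (\<chi> z * psi (r * P) z) else 0)"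
    by (intro sum.cong refl) (auto simp: geometric_sum eta_P)
  also have "\<dots> = of_nat P * (\<Sum>z\<in>{z \<in> LL - {0}. \<eta> z = 1}. \<chi> z * psi (r * P) z)"
    by (simp add: sum.If_cases sum_distrib_left Int_def)
  also have "(\<Sum>z\<in>{z \<in> LL - {0}. \<eta> z = 1}. \<chi> z * psi (r * P) z) =
      (\<Sum>j<N'. \<chi> (u ^ (P * j)) * psi (r * P) (u ^ (P * j)))"
  proof -
    have inj: "inj_on (\<lambda>j. u ^ j) {..<Q ^ P - 1}" using bij_LL by (simp add: bij_betw_def u_def)
    have "bij_betw (\<lambda>j. u ^ (P * j)) {..<N'} {z \<in> LL - {0}. \<eta> z = 1}"
      unfolding bij_betw_def
    proof
      show "inj_on (\<lambda>j. u ^ (P * j)) {..<N'}"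
      proof
        fix i j assume ij: "i \<in> {..<N'}" "j \<in> {..<N'}" "u ^ (P * i) = u ^ (P * j)"
        have "P * i \<in> {..<Q ^ P - 1}" "P * j \<in> {..<Q ^ P - 1}"
          using ij(1,2) P_gt_1 unfolding N'(1) by auto
        then have "P * i = P * j" using inj_onD[OF inj ij(3)] by blast
        then show "i = j" using P_gt_1 by simp
      qed
      show "(\<lambda>j. u ^ (P * j)) ` {..<N'} = {z \<in> LL - {0}. \<eta> z = 1}"
      proof (intro equalityI subsetI)
        fix x assume x: "x \<in> {z \<in> LL - {0}. \<eta> z = 1}"
        then obtain i where i: "x = u ^ i" using u_iff by blast
        then have "P dvd i" using x eta_u_dvd by simp
        then obtain j where j: "i = P * j" by auto
        have uP: "(u ^ P) ^ N' = 1" using u_order unfolding N'(1) by (simp add: power_mult)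
        have "x = u ^ (P * (j mod N'))" using i j power_period[OF uP, of j] by (simp add: power_mult)
        moreover have "N' > 0" using N'(2) Q_gt_1 by simp
        then have "j mod N' < N'" by simp
        ultimately show "x \<in> (\<lambda>j. u ^ (P * j)) ` {..<N'}" by auto
      next
        fix x assume "x \<in> (\<lambda>j. u ^ (P * j)) ` {..<N'}"
        then obtain j where "x = u ^ (P * j)" by blast
        then show "x \<in> {z \<in> LL - {0}. \<eta> z = 1}" using uL[of "P * j"] eta_u_dvd[of "P * j"] dvd_triv_left[of P j]
          by (metis (mono_tags, lifting) mem_Collect_eq)
      qed
    qed
    then show ?thesis by (rule sum.reindex_bij_betw[symmetric])
  qed
  finally have A: "of_nat P * gauss (r * P) \<chi> = of_nat P * (\<Sum>j<N'. \<chi> (u ^ (P * j)) * psi (r * P) (u ^ (P * j)))" .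
  define g where "g = (\<lambda>j. \<chi> (u ^ (P * j)) * psi (r * P) (u ^ (P * j)))"
  \<comment> \<open>Summing over all \<open>y\<close> covers each \<open>P\<close>-th power
    \<open>P\<close> times: \<open>g\<close> has period \<open>N'\<close> in the exponent.\<close>
  have "(\<Sum>y\<in>LL - {0}. \<chi> (y ^ P) * psi (r * P) (y ^ P)) = sum g {..<Q ^ P - 1}"
  proof -
    have "(u ^ j) ^ P = u ^ (P * j)" for j by (simp only: mult.commute[of P] power_mult)
    then show ?thesis
      using sum.reindex_bij_betw[OF bij_LL[folded u_def], of "\<lambda>y. \<chi> (y ^ P) * psi (r * P) (y ^ P)"]
      by (simp only: g_def)
  qed
  also have "\<dots> = (\<Sum>i<P. sum g {i * N'..<i * N' + N'})"
    unfolding N'(1) by (rule sum.nat_group[symmetric])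
  also have "\<dots> = (\<Sum>i<P. sum g {..<N'})"
  proof (rule sum.cong[OF refl])
    fix i
    have uP: "(u ^ P) ^ N' = 1" using u_order unfolding N'(1) by (simp add: power_mult)
    have per: "g (j + i * N') = g j" for j
    proof -
      have "(u ^ P) ^ (j + i * N') = (u ^ P) ^ j"
        using uP by (simp add: power_add mult.commute[of i] power_mult)
      then show ?thesis by (simp add: g_def power_mult)
    qed
    show "sum g {i * N'..<i * N' + N'} = sum g {..<N'}"
      using sum.shift_bounds_nat_ivl[of g 0 "i * N'" N'] per by (simp add: atLeast0LessThan add.commute)
  qed
  finally have B: "(\<Sum>y\<in>LL - {0}. \<chi> (y ^ P) * psi (r * P) (y ^ P)) = of_nat P * sum g {..<N'}" by simp
  have "of_nat P * gauss (r * P) \<chi> = (\<Sum>y\<in>LL - {0}. \<chi> (y ^ P) * psi (r * P) (y ^ P))"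
    unfolding A B g_def ..
  also have "\<dots> = (\<Sum>y\<in>LL - {0}. \<chi> (cnorm y) * psi r (\<Sum>i<P. (y ^ P) ^ (Q ^ i)))"
  proof (rule sum.cong[OF refl])
    fix y assume y: "y \<in> LL - {0}"
    have "cnorm y = y ^ (\<Sum>i<P. Q ^ i)" by (simp add: cnorm_def power_sum)
    then have "\<chi> (cnorm y) = \<chi> y ^ P * (\<chi> y ^ ((Q - 1) * P)) ^ t"
      unfolding t by (simp only: cs power_add power_mult)
    then have "\<chi> (cnorm y) = \<chi> (y ^ P)" using h1[OF y] by (simp add: cs)
    then show "\<chi> (y ^ P) * psi (r * P) (y ^ P) = \<chi> (cnorm y) * psi r (\<Sum>i<P. (y ^ P) ^ (Q ^ i))"
      by (simp add: psi_tower)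
  qed
  also have "\<dots> = of_nat P * of_nat (Q ^ ((P - 1) div 2)) *
      (\<Sum>x\<in>KK. \<chi> (- x) * psi r (- (of_nat P * x)))"
    by (rule gauss_core[OF chi w2 w1 w3])
  \<comment> \<open>The substitution of \<open>- (of_nat P * x)\<close> for \<open>x\<close>;
    \<open>\<chi>\<close> takes the value 1 at \<open>P\<close>, an element of the prime
    field.\<close>
  also have "(\<Sum>x\<in>KK. \<chi> (- x) * psi r (- (of_nat P * x))) = gauss r \<chi>"
    unfolding gauss_def
  proof (rule sum.reindex_bij_witness[of _ "\<lambda>x. - (x / of_nat P)" "\<lambda>x. - (of_nat P * x)"])
    have PF: "of_nat P \<in> Fix p - {0 :: 'b}"
      using subfield_set.of_nat_K[OF subfield_Fix[of 1], of P] P_nz by simp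
    fix x assume x: "x \<in> KK"
    show "- (- (of_nat P * x) / of_nat P) = x" using P_nz by simp
    show "- (of_nat P * - (x / of_nat P)) = x" using P_nz by simp
    show "- (of_nat P * x) \<in> KK" using x K.of_nat_K K.mult_K K.uminus_K by simp
    show "- (x / of_nat P) \<in> KK" using x K.of_nat_K K.divide_K K.uminus_K by simp
    have "\<chi> (- (of_nat P * x)) = \<chi> (of_nat P * - x)" by simp
    also have "\<dots> = \<chi> (- x)" using h3[OF PF] by (simp only: cs mult_1_left)
    finally show "\<chi> (- (of_nat P * x)) * psi r (- (of_nat P * x)) = \<chi> (- x) * psi r (- (of_nat P * x))"
      by simp
  qed
  finally show ?thesis using P_gt_1 by (simp add: mult.assoc)
qed

end

section \<open>Gauss sums of pure characters\<close>

definition zroot :: "nat \<Rightarrow> complex" where "zroot n = cis (2 * pi / real n)"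

lemma zroot_pow: "zroot n ^ i = cis (2 * pi * real i / real n)"
  by (simp add: zroot_def DeMoivre mult.commute)

lemma zroot_order: "n > 0 \<Longrightarrow> zroot n ^ n = 1"
  by (simp add: zroot_pow)

text \<open>For \<open>n > 0\<close>, the ring generated over the integers by a primitive
  \<open>n\<close>-th root of unity.\<close>

definition cycint :: "nat \<Rightarrow> complex set" where
  "cycint n = range (\<lambda>f :: int poly. poly (of_int_poly f) (zroot n))"

lemma cycint_add: "x \<in> cycint n \<Longrightarrow> y \<in> cycint n \<Longrightarrow> x + y \<in> cycint n"
proof -
  assume "x \<in> cycint n" "y \<in> cycint n"
  then obtain f g where "x = poly (of_int_poly f) (zroot n)" "y = poly (of_int_poly g) (zroot n)"
    by (auto simp: cycint_def)
  then have "x + y = poly (of_int_poly (f + g)) (zroot n)"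
    by (simp add: of_int_poly_hom.hom_add)
  then show ?thesis by (auto simp: cycint_def)
qed

lemma cycint_mult: "x \<in> cycint n \<Longrightarrow> y \<in> cycint n \<Longrightarrow> x * y \<in> cycint n"
proof -
  assume "x \<in> cycint n" "y \<in> cycint n"
  then obtain f g where "x = poly (of_int_poly f) (zroot n)" "y = poly (of_int_poly g) (zroot n)"
    by (auto simp: cycint_def)
  then have "x * y = poly (of_int_poly (f * g)) (zroot n)"
    by (simp add: of_int_poly_hom.hom_mult)
  then show ?thesis by (auto simp: cycint_def)
qed

lemma cycint_of_int: "of_int c \<in> cycint n"
proof -
  have "coeff (of_int_poly [:c:]) i = coeff ([:of_int c:] :: complex poly) i" for i
    by (cases i) (simp_all add: coeff_map_poly)
  then have "of_int_poly [:c:] = ([:of_int c:] :: complex poly)" by (rule poly_eqI)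
  then have "of_int c = poly (of_int_poly [:c:]) (zroot n)" by (metis poly_const_conv)
  then show ?thesis unfolding cycint_def by (rule range_eqI)
qed

lemma cycint_uminus: "x \<in> cycint n \<Longrightarrow> - x \<in> cycint n"
  using cycint_mult[OF cycint_of_int[of "-1"], of x n] by simp

lemma cycint_sum: "(\<And>i. i \<in> A \<Longrightarrow> g i \<in> cycint n) \<Longrightarrow> sum g A \<in> cycint n"
  by (induction A rule: infinite_finite_induct) (use cycint_of_int[of 0] in \<open>auto intro: cycint_add\<close>)

lemma cycint_zroot_pow: "zroot n ^ i \<in> cycint n"
proof -
  have "zroot n ^ i = poly (of_int_poly (monom 1 i)) (zroot n)" by (simp add: map_poly_monom poly_monom)
  then show ?thesis unfolding cycint_def by blast
qed

lemma cycint_root: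
  assumes "x ^ m = 1" "m > 0" "n = m * d" "n > 0"
  shows "x \<in> cycint n"
proof -
  obtain j where j: "x = cis (2 * pi * real j / real m)"
    using bij_betw_roots_unity[OF assms(2)] assms(1) by (auto simp: bij_betw_def)
  also have "\<dots> = zroot n ^ (j * d)" using assms by (simp add: zroot_pow field_simps)
  finally show ?thesis using cycint_zroot_pow by simp
qed

text \<open>Multiplication by \<open>a\<close> acts on the powers of \<open>zroot n\<close> through
  an integer matrix, so \<open>a\<close> is a root of its monic characteristic polynomial. The
  \<open>n\<close> powers need not be independent; a nonzero eigenvector is enough.\<close>

lemma cycint_algebraic_int:
  assumes n: "n > 0" and a: "a \<in> cycint n"
  shows "algebraic_int a"
proof -
  obtain f :: "int poly" where f: "a = poly (of_int_poly f) (zroot n)" using a by (auto simp: cycint_def)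
  define z where "z = zroot n"
  have zn: "z ^ n = 1" using zroot_order[OF n] by (simp add: z_def)
  have zmod: "z ^ (i mod n) = z ^ i" for i
  proof -
    have "z ^ (n * (i div n) + i mod n) = z ^ (i mod n)"
      by (simp only: power_add power_mult zn) simp
    then show ?thesis by simp
  qed
  \<comment> \<open>Expanding \<open>a * z ^ j\<close>, the power \<open>z ^ (m + j)\<close> is
    folded back to the exponent \<open>(m + j) mod n\<close>.\<close>
  define C where "C = (\<lambda>j i. \<Sum>m\<in>{m \<in> {..degree f}. (m + j) mod n = i}. coeff f m)"
  define A where "A = mat n n (\<lambda>(j, i). C j i)"
  have A: "A \<in> carrier_mat n n" by (simp add: A_def)
  define A' where "A' = map_mat (of_int :: int \<Rightarrow> complex) A"
  have A': "A' \<in> carrier_mat n n" using A by (simp add: A'_def)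
  define v where "v = vec n (\<lambda>i. z ^ i)"
  have row: "(\<Sum>i<n. of_int (C j i) * z ^ i) = a * z ^ j" for j
  proof -
    have "(\<Sum>i<n. of_int (C j i) * z ^ i) =
        (\<Sum>i<n. \<Sum>m\<in>{m \<in> {..degree f}. (m + j) mod n = i}. of_int (coeff f m) * z ^ (m + j))"
    proof (rule sum.cong[OF refl])
      fix i
      have "of_int (C j i) * z ^ i = (\<Sum>m\<in>{m \<in> {..degree f}. (m + j) mod n = i}. of_int (coeff f m) * z ^ i)"
        by (simp add: C_def sum_distrib_right)
      also have "\<dots> = (\<Sum>m\<in>{m \<in> {..degree f}. (m + j) mod n = i}. of_int (coeff f m) * z ^ (m + j))"
        by (rule sum.cong[OF refl]) (use zmod in auto)
      finally show "of_int (C j i) * z ^ i =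
        (\<Sum>m\<in>{m \<in> {..degree f}. (m + j) mod n = i}. of_int (coeff f m) * z ^ (m + j))" .
    qed
    also have "\<dots> = (\<Sum>m\<le>degree f. of_int (coeff f m) * z ^ (m + j))"
      by (rule sum.group) (use n in auto)
    also have "\<dots> = a * z ^ j"
      by (simp add: f poly_altdef z_def sum_distrib_right power_add mult.assoc)
    finally show ?thesis .
  qed
  have "A' *\<^sub>v v = a \<cdot>\<^sub>v v"
  proof (rule eq_vecI)
    fix j assume "j < dim_vec (a \<cdot>\<^sub>v v)"
    then have j: "j < n" by (simp add: v_def)
    then have "(A' *\<^sub>v v) $ j = (\<Sum>i<n. of_int (C j i) * z ^ i)"
      by (simp add: A'_def A_def v_def scalar_prod_def atLeast0LessThan)
    then show "(A' *\<^sub>v v) $ j = (a \<cdot>\<^sub>v v) $ j" using j row by (simp add: v_def)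
  qed (use A' in \<open>simp add: v_def\<close>)
  moreover have "v \<noteq> 0\<^sub>v n"
  proof
    assume "v = 0\<^sub>v n"
    then have "v $ 0 = 0" using n by simp
    then show False using n by (simp add: v_def)
  qed
  ultimately have "eigenvalue A' a"
    unfolding eigenvalue_def eigenvector_def using A' by (intro exI[of _ v]) (simp add: v_def)
  then have "poly (char_poly A') a = 0" using eigenvalue_root_char_poly[OF A'] by simp
  moreover have "char_poly A' = of_int_poly (char_poly A)"
    unfolding A'_def by (rule of_int_hom.char_poly_hom[OF A])
  moreover have "lead_coeff (char_poly A) = 1" using degree_monic_char_poly[OF A] by simp
  ultimately show ?thesis unfolding algebraic_int_altdef_ipoly by metis
qed

text \<open>The quotient \<open>a / b\<close> is rational and an algebraic integer, hence an
  integer.\<close>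

lemma cycint_int_dvd:
  assumes n: "n > 0" and x: "x \<in> cycint n" and e: "of_nat a = of_nat b * x" and b: "b > 0"
  shows "b dvd (a :: nat)"
proof -
  have "x = of_nat a / of_nat b" using e b by (simp add: field_simps)
  then have "x \<in> \<rat>" by simp
  then have "x \<in> \<int>" using rational_algebraic_int_is_int[OF cycint_algebraic_int[OF n x]] by simp
  then obtain c where "x = of_int c" by (auto elim: Ints_cases)
  then have "(of_int (int a) :: complex) = of_int (int b * c)" using e by simp
  then have "int a = int b * c" by (simp only: of_int_eq_iff)
  then show ?thesis by (metis dvd_triv_left int_dvd_int_iff)
qed

context prim_field
begin

lemma qm_power: "(x :: 'b) \<noteq> 0 \<Longrightarrow> x ^ qm = 1"
proof -
  assume "x \<noteq> 0"
  then obtain i where "x = \<gamma> ^ i" using gamma_exists by blast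
  then have "x ^ qm = (\<gamma> ^ qm) ^ i" by (simp only: power_mult[symmetric] mult.commute)
  then show ?thesis by (simp add: gamma_pow_card)
qed

lemma mchar_root:
  fixes x :: 'b assumes "mchar \<chi>" "x \<noteq> 0" shows "\<chi> x ^ qm = 1"
proof -
  have "\<chi> x ^ qm = \<chi> (x ^ qm)" by (rule mchar_simps(4)[OF assms(1), symmetric])
  then show ?thesis unfolding qm_power[OF assms(2)] mchar_simps(2)[OF assms(1)] .
qed

lemma mchar_cnj: "mchar \<chi> \<Longrightarrow> x \<noteq> (0 :: 'b) \<Longrightarrow> \<chi> x * cnj (\<chi> x) = 1"
proof -
  assume "mchar \<chi>" "x \<noteq> 0"
  then have "norm (\<chi> x) ^ qm = 1" using mchar_root[of \<chi> x] by (simp flip: norm_power)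
  then have "norm (\<chi> x) = 1" using qm_pos power_eq_imp_eq_base[of "norm (\<chi> x)" qm 1] by simp
  then show ?thesis by (simp add: complex_norm_square[symmetric])
qed

lemma psi_root: "psi r x ^ p = 1"
  using p_gt_1 by (simp add: psi_def prime_addchar_def DeMoivre cis_multiple_2pi)

lemma psi_cycint: "psi r x \<in> cycint (qm * p)"
  by (rule cycint_root[OF psi_root, of _ qm]) (use p_gt_1 qm_pos in auto)

lemma mchar_cycint: "mchar \<chi> \<Longrightarrow> \<chi> (x :: 'b) \<in> cycint (qm * p)"
  by (cases "x = 0") (use p_gt_1 qm_pos mchar_simps(1)[of \<chi>] cycint_of_int[of 0]
      cycint_root[OF mchar_root, of \<chi> x _ p] in auto)

lemma gauss_cycint: "mchar \<chi> \<Longrightarrow> gauss r \<chi> \<in> cycint (qm * p)"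
  unfolding gauss_def by (intro cycint_sum cycint_mult mchar_cycint psi_cycint)

text \<open>Substituting \<open>x = y * t\<close> separates the double sum; orthogonality in
  \<open>y\<close> leaves the term \<open>t = 1\<close>, and the sum of all \<open>\<chi> t\<close>
  vanishes.\<close>

lemma gauss_norm:
  assumes chi: "mchar \<chi>" and r: "r dvd f" and nt: "x0 \<in> Fix (p ^ r) - {0}" "\<chi> x0 \<noteq> 1"
  shows "gauss r \<chi> * cnj (gauss r \<chi>) = of_nat (p ^ r)"
proof -
  interpret S: subfield_set "Fix (p ^ r) :: 'b set" by (rule subfield_Fix)
  note cs = mchar_simps[OF chi]
  let ?F = "Fix (p ^ r) - {0 :: 'b}"
  have sum0: "sum \<chi> ?F = 0"
  proof -
    have "sum \<chi> ?F = (\<Sum>x\<in>?F. \<chi> (x0 * x))"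
    proof (rule sum.reindex_bij_witness[of _ "\<lambda>x. x0 * x" "\<lambda>x. x / x0"])
      fix x assume x: "x \<in> ?F"
      show "x0 * (x / x0) = x" "x0 * x / x0 = x" using nt by auto
      show "x / x0 \<in> ?F" using x nt S.divide_K by auto
      show "x0 * x \<in> ?F" using x nt S.mult_K by auto
      show "\<chi> (x0 * (x / x0)) = \<chi> x" using nt by simp
    qed
    also have "\<dots> = \<chi> x0 * sum \<chi> ?F" by (simp add: cs sum_distrib_left)
    finally show ?thesis using nt(2) by simp
  qed
  have orth: "(\<Sum>y\<in>?F. psi r (y * z)) = (if z = 0 then of_nat (p ^ r) else 0) - 1" if "z \<in> Fix (p ^ r)" for z
  proof -
    have "(\<Sum>y\<in>Fix (p ^ r). psi r (y * z)) = psi r (0 * z) + (\<Sum>y\<in>?F. psi r (y * z))"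
      by (rule sum.remove) auto
    then show ?thesis using psi_orth[OF r that] by simp
  qed
  have "gauss r \<chi> * cnj (gauss r \<chi>) = (\<Sum>y\<in>?F. \<Sum>x\<in>?F. (\<chi> x * psi r x) * cnj (\<chi> y * psi r y))"
    unfolding gauss_nz[OF chi] cnj_sum sum_product by (rule sum.swap)
  also have "\<dots> = (\<Sum>y\<in>?F. \<Sum>t\<in>?F. \<chi> t * psi r (y * (t - 1)))"
  proof (rule sum.cong[OF refl])
    fix y assume y: "y \<in> ?F"
    show "(\<Sum>x\<in>?F. (\<chi> x * psi r x) * cnj (\<chi> y * psi r y)) = (\<Sum>t\<in>?F. \<chi> t * psi r (y * (t - 1)))"
    proof (rule sum.reindex_bij_witness[of _ "\<lambda>t. y * t" "\<lambda>x. x / y"])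
      fix x assume x: "x \<in> ?F"
      show "y * (x / y) = x" "y * x / y = x" using y by auto
      show "x / y \<in> ?F" using x y S.divide_K by auto
      show "y * x \<in> ?F" using x y S.mult_K by auto
      have "\<chi> x = \<chi> (x / y) * \<chi> y" using y by (simp flip: cs(3))
      then have 1: "\<chi> (x / y) = \<chi> x * cnj (\<chi> y)" using mchar_cnj[OF chi, of y] y by simp
      have "psi r (x + - y) = psi r x * cnj (psi r y)"
        using x y S.uminus_K by (simp add: psi_add psi_minus del: add_uminus_conv_diff)
      moreover have "y * (x / y - 1) = x + - y" using y by (simp add: field_simps)
      ultimately show "\<chi> (x / y) * psi r (y * (x / y - 1)) = (\<chi> x * psi r x) * cnj (\<chi> y * psi r y)"
        using 1 by simp
    qed
  qed
  also have "\<dots> = (\<Sum>t\<in>?F. \<chi> t * (\<Sum>y\<in>?F. psi r (y * (t - 1))))"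
    unfolding sum_distrib_left by (rule sum.swap)
  also have "\<dots> = (\<Sum>t\<in>?F. \<chi> t * ((if t = 1 then of_nat (p ^ r) else 0) - 1))"
    by (rule sum.cong[OF refl]) (subst orth, use S.diff_K in auto)
  also have "\<dots> = (\<Sum>t\<in>?F. (if t = 1 then of_nat (p ^ r) * \<chi> t else 0)) - sum \<chi> ?F"
    unfolding sum_subtractf[symmetric] by (rule sum.cong[OF refl]) (auto simp: algebra_simps)
  also have "\<dots> = of_nat (p ^ r)" unfolding sum0 by (simp add: cs)
  finally show ?thesis .
qed

text \<open>Conjugation replaces \<open>\<chi>\<close> by its conjugate and \<open>psi r x\<close>
  by \<open>psi r (- x)\<close>. The sign is absorbed by \<open>\<chi> (-1) = 1\<close>, and the
  Frobenius power \<open>x ^ (p ^ s)\<close>, invisible to \<open>psi r\<close>, turns the conjugate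
  character back into \<open>\<chi>\<close>.\<close>

lemma gauss_real:
  assumes chi: "mchar \<chi>" and m1: "\<chi> (-1) = 1"
    and s: "\<And>x. x \<in> Fix (p ^ r) - {0} \<Longrightarrow> \<chi> (x ^ (p ^ s)) = cnj (\<chi> x)" and r: "r dvd f"
  shows "cnj (gauss r \<chi>) = gauss r \<chi>"
proof -
  interpret S: subfield_set "Fix (p ^ r) :: 'b set" by (rule subfield_Fix)
  note cs = mchar_simps[OF chi]
  let ?F = "Fix (p ^ r) - {0 :: 'b}"
  have inj: "inj_on (\<lambda>x. x ^ (p ^ s)) ?F"
  proof
    fix x y assume xy: "x \<in> ?F" "y \<in> ?F" "x ^ (p ^ s) = y ^ (p ^ s)"
    have "(x + - y) ^ (p ^ s) = 0" unfolding frob_add frob_minus using xy(3) by simp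
    then show "x = y" by simp
  qed
  have bij: "bij_betw (\<lambda>x. x ^ (p ^ s)) ?F ?F"
    unfolding bij_betw_def
    by (intro conjI inj endo_inj_surj) (use S.power_K in auto)
  have "cnj (gauss r \<chi>) = (\<Sum>x\<in>?F. cnj (\<chi> x) * psi r (- x))"
    unfolding gauss_nz[OF chi] by (simp add: psi_minus)
  also have "\<dots> = (\<Sum>x\<in>?F. cnj (\<chi> x) * psi r x)"
  proof (rule sum.reindex_bij_witness[of _ uminus uminus])
    fix x assume x: "x \<in> ?F"
    have "\<chi> (- x) = \<chi> (-1) * \<chi> x" by (simp flip: cs(3))
    then show "cnj (\<chi> (- x)) * psi r (- x) = cnj (\<chi> x) * psi r (- x)" using m1 by simp
  qed (use S.uminus_K in auto)
  also have "\<dots> = (\<Sum>x\<in>?F. \<chi> (x ^ (p ^ s)) * psi r (x ^ (p ^ s)))"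
    by (rule sum.cong[OF refl]) (simp add: s psi_frob_pow)
  also have "\<dots> = (\<Sum>x\<in>?F. \<chi> x * psi r x)"
    by (rule sum.reindex_bij_betw[OF bij, of "\<lambda>x. \<chi> x * psi r x"])
  also have "\<dots> = gauss r \<chi>" by (rule gauss_nz[OF chi, symmetric])
  finally show ?thesis .
qed

end

context prime_step
begin

text \<open>
  Both Gauss sums square to the order of their field, so they agree up to a sign and a power of
  \<open>Q\<close>. Frobenius orbits outside the small field have length \<open>P\<close>, so the sums are congruent
  modulo \<open>P\<close> in a cyclotomic ring, and the wrong sign would give \<open>P dvd 2\<close>.
\<close>

lemma gauss_step_pure:
  assumes chi: "mchar \<chi>" and PQ: "P dvd Q - 1"
    and inv: "\<And>z. z \<in> LL - {0} \<Longrightarrow> \<chi> (z ^ Q) = \<chi> z"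
    and nt: "x0 \<in> KK - {0}" "\<chi> x0 \<noteq> 1"
    and pure: "\<And>x. x \<noteq> 0 \<Longrightarrow> \<chi> (x ^ (p ^ s)) = cnj (\<chi> x)"
    and h3: "\<And>x. x \<in> Fix p - {0} \<Longrightarrow> \<chi> x = 1"
  shows "gauss (r * P) \<chi> = of_nat (Q ^ ((P - 1) div 2)) * gauss r \<chi>"
proof -
  note cs = mchar_simps[OF chi]
  define N where "N = qm * p"
  have N: "N > 0" using qm_pos p_gt_1 by (simp add: N_def)
  have F1: "subfield_set (Fix p :: 'b set)" using subfield_Fix[of 1] by simp
  have m1: "\<chi> (-1) = 1"
    by (rule h3) (use subfield_set.uminus_K[OF F1, of 1] subfield_set.one_K[OF F1] in simp)
  have PF: "\<chi> (of_nat P) = 1" using h3 subfield_set.of_nat_K[OF F1, of P] P_nz by simp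
  define GL GK where "GL = gauss (r * P) \<chi>" and "GK = gauss r \<chi>"
  have x0L: "x0 \<in> LL - {0}" using nt KL by auto
  have sqK: "GK * GK = of_nat Q"
    using gauss_norm[OF chi r_dvd nt] gauss_real[OF chi m1 _ r_dvd, of s] pure by (simp add: GK_def)
  have sqL: "GL * GL = of_nat (Q ^ P)"
    using gauss_norm[OF chi rP x0L nt(2)] gauss_real[OF chi m1 _ rP, of s] pure
    by (simp add: GL_def power_mult)
  define F where "F = (\<lambda>z. \<chi> z * psi (r * P) z)"
  have F_frob: "F (z ^ (Q ^ i)) = F z" if "z \<in> LL - {0}" for z i
  proof (induction i)
    case (Suc i)
    have z: "z ^ (Q ^ i) \<in> LL - {0}" using that L.power_K by simp
    have "F ((z ^ (Q ^ i)) ^ Q) = F (z ^ (Q ^ i))"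
      unfolding F_def using inv[OF z] psi_frob_pow[of "z ^ (Q ^ i)" "r * P" r] z by simp
    then show ?case using Suc by (simp add: mult.commute flip: power_mult)
  qed simp
  \<comment> \<open>One representative of each Frobenius orbit outside \<open>KK\<close>;
    \<open>F\<close> is constant on the orbit.\<close>
  define rep where "rep = (\<lambda>g. SOME y. y \<in> LL - KK \<and> conj_poly y = g)"
  define \<beta> where "\<beta> = (\<Sum>g\<in>Irr P. F (rep g))"
  have beta: "\<beta> \<in> cycint N" unfolding \<beta>_def F_def N_def
    by (intro cycint_sum cycint_mult mchar_cycint psi_cycint chi)
  have "GL = (\<Sum>y\<in>LL - {0}. F y)" unfolding GL_def F_def by (rule gauss_nz[OF chi])
  also have "LL - {0} = (LL - KK) \<union> (KK - {0})" using KL by auto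
  also have "sum F \<dots> = sum F (LL - KK) + sum F (KK - {0})"
    by (rule sum.union_disjoint) auto
  also have "sum F (LL - KK) = (\<Sum>g\<in>conj_poly ` (LL - KK). \<Sum>z\<in>{z \<in> LL - KK. conj_poly z = g}. F z)"
    by (rule sum.image_gen) simp
  also have "\<dots> = (\<Sum>g\<in>Irr P. of_nat P * F (rep g))"
    unfolding conj_image
  proof (rule sum.cong[OF refl])
    fix g assume "g \<in> Irr P"
    then have "\<exists>y. y \<in> LL - KK \<and> conj_poly y = g" using conj_image by (metis imageE)
    then have y: "rep g \<in> LL - KK" "conj_poly (rep g) = g" unfolding rep_def by (metis (mono_tags, lifting) someI_ex)+
    have y0: "rep g \<noteq> 0" using y(1) by auto
    have "(\<Sum>z\<in>{z \<in> LL - KK. conj_poly z = g}. F z) = (\<Sum>z\<in>{z \<in> LL - KK. conj_poly z = g}. F (rep g))"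
    proof (rule sum.cong[OF refl])
      fix z assume z: "z \<in> {z \<in> LL - KK. conj_poly z = g}"
      have "\<exists>i<P. z = rep g ^ (Q ^ i)" by (rule conj_poly_inj) (use y y0 z in auto)
      then show "F z = F (rep g)" using F_frob[of "rep g"] y y0 by auto
    qed
    also have "\<dots> = of_nat P * F (rep g)" using conj_fiber[OF y(1)] y(2) by simp
    finally show "(\<Sum>z\<in>{z \<in> LL - KK. conj_poly z = g}. F z) = of_nat P * F (rep g)" .
  qed
  also have "\<dots> = of_nat P * \<beta>" by (simp add: \<beta>_def sum_distrib_left)
  \<comment> \<open>On \<open>KK\<close> the trace from \<open>LL\<close> is multiplication by
    \<open>P\<close>, and \<open>\<chi>\<close> takes the value 1 at \<open>P\<close>.\<close>
  also have "sum F (KK - {0}) = GK"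
    unfolding GK_def gauss_nz[OF chi]
  proof (rule sum.reindex_bij_witness[of _ "\<lambda>x. x / of_nat P" "\<lambda>x. of_nat P * x"])
    fix x assume x: "x \<in> KK - {0}"
    show "of_nat P * x / of_nat P = x" "of_nat P * (x / of_nat P) = x" using P_nz by auto
    show "of_nat P * x \<in> KK - {0}" using x P_nz K.of_nat_K K.mult_K by simp
    show "x / of_nat P \<in> KK - {0}" using x P_nz K.of_nat_K K.divide_K by simp
    have "(\<Sum>i<P. x ^ Q ^ i) = of_nat P * x" using Fix_pow[of x Q] x by simp
    then have "psi (r * P) x = psi r (of_nat P * x)" by (simp only: psi_tower)
    then show "\<chi> (of_nat P * x) * psi r (of_nat P * x) = F x" by (simp add: F_def cs PF)
  qed
  finally have diff: "GL = of_nat P * \<beta> + GK" .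
  define c where "c = Q ^ ((P - 1) div 2)"
  have cQ: "Q ^ P = c\<^sup>2 * Q"
  proof -
    have "P = (P - 1) div 2 * 2 + 1" using P_odd by simp
    then have "Q ^ P = Q ^ ((P - 1) div 2 * 2 + 1)" by simp
    then show ?thesis by (simp only: power_add power_mult c_def power_one_right)
  qed
  have "(GL - of_nat c * GK) * (GL + of_nat c * GK) = GL * GL - (of_nat c)\<^sup>2 * (GK * GK)"
    by (simp add: algebra_simps power2_eq_square)
  also have "\<dots> = 0" unfolding sqL sqK cQ by simp
  finally consider "GL = of_nat c * GK" | "GL = - of_nat c * GK"
    by (auto simp: add_eq_0_iff2)
  then show ?thesis
  proof cases
    case 2
    \<comment> \<open>The wrong sign gives \<open>P * \<beta> = - (c + 1) * GK\<close>; a further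
      factor \<open>GK\<close> with \<open>GK * GK = Q\<close> yields a rational integer, to which
      \<open>cycint_int_dvd\<close> applies.\<close>
    have "of_nat ((c + 1) * Q) = of_nat P * (- \<beta> * GK)"
    proof -
      have "of_nat P * \<beta> = GL - GK" using diff by simp
      also have "\<dots> = - of_nat (c + 1) * GK" unfolding 2 by (simp add: algebra_simps)
      finally have e: "of_nat P * \<beta> = - of_nat (c + 1) * GK" .
      have "of_nat P * (- \<beta> * GK) = - (of_nat P * \<beta>) * GK" by simp
      also have "\<dots> = of_nat (c + 1) * (GK * GK)" unfolding e by (simp only: minus_mult_left minus_minus mult.assoc)
      finally show ?thesis unfolding sqK of_nat_mult by (rule sym)
    qed
    moreover have "- \<beta> * GK \<in> cycint N"
      using beta gauss_cycint[OF chi] by (intro cycint_mult cycint_uminus) (simp_all add: N_def GK_def)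
    ultimately have "P dvd (c + 1) * Q" using cycint_int_dvd[OF N] P_gt_1 by simp
    moreover have "\<not> P dvd Q" using P_prime p_prime Pp
      by (metis prime_dvd_power primes_dvd_imp_eq)
    ultimately have "P dvd c + 1" using P_prime prime_dvd_mult_iff by blast
    moreover have "[c = 1] (mod P)"
    proof -
      have "[Q = 1] (mod P)" using PQ Q_gt_1 by (subst cong_altdef_nat) simp_all
      then have "[c = 1 ^ ((P - 1) div 2)] (mod P)" unfolding c_def by (rule cong_pow)
      then show ?thesis by simp
    qed
    then have "[c + 1 = 1 + 1] (mod P)" by (rule cong_add) simp
    ultimately have "P dvd 2" using cong_dvd_iff[of "c + 1" "1 + 1" P] by (simp add: numeral_2_eq_2)
    then have "P \<le> 2" by (rule dvd_imp_le) simp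
    then show ?thesis using P_gt_1 P_odd by (cases "P = 2") auto
  qed (simp add: GL_def GK_def c_def)
qed

end

section \<open>Relative Gauss sums\<close>

text \<open>For a prime \<open>r\<close> dividing \<open>n\<close>, \<open>a ^ r - b ^ r\<close> is
  \<open>a - b\<close> times a sum of \<open>r\<close> terms which are congruent to each other
  modulo \<open>r\<close>, hence divisible by \<open>n * r\<close>. This is iterated over the prime
  factors of \<open>T\<close>.\<close>

lemma power_cong_lift:
  fixes a b :: int
  assumes "[a = b] (mod int n)" "T > 0" "\<And>r. prime r \<Longrightarrow> r dvd T \<Longrightarrow> r dvd n"
  shows "[a ^ T = b ^ T] (mod int (n * T))"
  using assms
proof (induction T arbitrary: a b n rule: prime_divisors_induct)
  case (factor r T)
  have rn: "r dvd n" using factor.prems(3)[of r] factor.hyps by simp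
  have ab: "[a = b] (mod int r)"
    using factor.prems(1) rn by (meson cong_dvd_modulus int_dvd_int_iff)
  have "[(\<Sum>i<r. a ^ i * b ^ (r - Suc i)) = (\<Sum>i<r. b ^ i * b ^ (r - Suc i))] (mod int r)"
    by (intro cong_sum cong_mult cong_pow ab cong_refl)
  also have "(\<Sum>i<r. b ^ i * b ^ (r - Suc i)) = (\<Sum>i<r. b ^ (r - 1))"
    by (rule sum.cong) (auto simp flip: power_add)
  also have "[(\<Sum>i<r. b ^ (r - 1)) = 0] (mod int r)" by (simp add: cong_0_iff)
  finally have "int r dvd (\<Sum>i<r. a ^ i * b ^ (r - Suc i))" by (simp add: cong_0_iff)
  moreover have "int n dvd a - b" using factor.prems(1) by (simp add: cong_iff_dvd_diff)
  ultimately have "int n * int r dvd (a - b) * (\<Sum>i<r. a ^ i * b ^ (r - Suc i))"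
    by (rule mult_dvd_mono[rotated])
  moreover have "a ^ r - b ^ r = (a - b) * (\<Sum>i<r. a ^ i * b ^ (r - Suc i))"
    by (subst power_diff_sumr2) (simp add: mult.commute)
  ultimately have "[a ^ r = b ^ r] (mod int (n * r))" by (simp add: cong_iff_dvd_diff)
  then have "[(a ^ r) ^ T = (b ^ r) ^ T] (mod int (n * r * T))"
    using factor.prems by (intro factor.IH) auto
  then show ?case by (simp add: mult.assoc flip: power_mult)
next
  case (unit T)
  then have "T = 1" by simp
  then show ?case using unit.prems(1) by simp
qed simp

lemma power_minus_1_lift:
  fixes a n T :: nat
  assumes "n dvd a - 1" "a \<ge> 1" "T > 0" "\<And>r. prime r \<Longrightarrow> r dvd T \<Longrightarrow> r dvd n"
  shows "n * T dvd a ^ T - 1"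
proof -
  have "int n dvd int (a - 1)" using assms(1) by simp
  then have "[int a = 1] (mod int n)" using assms(2) by (simp add: cong_iff_dvd_diff of_nat_diff)
  then have "[int a ^ T = 1 ^ T] (mod int (n * T))" using assms by (intro power_cong_lift)
  then have "int (n * T) dvd int (a ^ T - 1)" using assms(2) by (simp add: cong_iff_dvd_diff of_nat_diff)
  then show ?thesis by (simp only: int_dvd_int_iff)
qed

lemma coprime_prod_dvd:
  fixes g :: "'a \<Rightarrow> nat"
  assumes "finite A" "\<And>i j. i \<in> A \<Longrightarrow> j \<in> A \<Longrightarrow> i \<noteq> j \<Longrightarrow> coprime (g i) (g j)"
    "\<And>i. i \<in> A \<Longrightarrow> g i dvd x"
  shows "prod g A dvd x"
  using assms
proof (induction A rule: finite_induct)
  case (insert i A)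
  have "coprime (g i) (prod g A)" using insert by (intro prod_coprime_right) auto
  then show ?case using insert by (simp add: divides_mult)
qed simp

lemma cong_solve_unique:
  fixes n N a :: nat
  assumes "coprime n N" "N > 0"
  shows "\<exists>!t. t < N \<and> N dvd a + t * n"
proof (rule ex_ex1I)
  obtain x where x: "[n * x = 1] (mod N)" using cong_solve_coprime_nat[OF assms(1)] by auto
  \<comment> \<open>\<open>N - 1\<close> stands for -1: this is \<open>- a\<close> times the inverse
    of \<open>n\<close> modulo \<open>N\<close>.\<close>
  define t where "t = (a * (N - 1) * x) mod N"
  have "[a + t * n = a + a * (N - 1) * x * n] (mod N)"
    unfolding t_def by (intro cong_add cong_mult cong_refl) (simp add: cong_def)
  also have "a + a * (N - 1) * x * n = a + a * (N - 1) * (n * x)" by (simp add: mult_ac)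
  also have "[a + a * (N - 1) * (n * x) = a + a * (N - 1) * 1] (mod N)"
    by (intro cong_add cong_mult cong_refl x)
  also have "a + a * (N - 1) * 1 = a * N" using assms(2) by (cases N) auto
  also have "[a * N = 0] (mod N)" by (simp add: cong_0_iff)
  finally have "N dvd a + t * n" by (simp add: cong_0_iff)
  moreover have "t < N" using assms(2) by (simp add: t_def)
  ultimately show "\<exists>t. t < N \<and> N dvd a + t * n" by blast
next
  fix t t' assume t: "t < N \<and> N dvd a + t * n" "t' < N \<and> N dvd a + t' * n"
  then have "[a + t * n = a + t' * n] (mod N)" by (simp add: cong_def dvd_eq_mod_eq_0)
  then have "[t * n = t' * n] (mod N)" by (simp add: cong_add_lcancel_nat)
  then have "[t = t'] (mod N)" using assms(1) by (simp add: cong_mult_rcancel_nat)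
  then show "t = t'" using t by (simp add: cong_def)
qed

text \<open>
  The assumption \<open>exact_k\<close> is what the stability of the index of \<open>\<langle>p\<rangle>\<close> under raising a single exponent
  amounts to.
\<close>

locale tower = prim_field \<gamma> p f for \<gamma> :: "'b::finite_field" and p f :: nat +
  fixes P ex :: "nat \<Rightarrow> nat" and l m d h k M :: nat
  assumes P_prime: "\<And>i. i \<in> {1..l} \<Longrightarrow> prime (P i)" and P_odd: "\<And>i. i \<in> {1..l} \<Longrightarrow> odd (P i)"
    and P_inj: "inj_on P {1..l}"
    and ex_pos: "\<And>i. i \<in> {1..l} \<Longrightarrow> ex i \<ge> 1"
    and h_def: "h = (\<Prod>i\<in>{1..l}. P i)"
    and k_def: "k = (\<Prod>i\<in>{1..l}. P i ^ ex i)"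
    and M_def: "M = (\<Prod>i\<in>{1..l}. P i ^ (ex i - 1))"
    and fdM: "f = d * M" and h_dvd: "h dvd p ^ d - 1"
    and exact_k: "\<And>i. i \<in> {1..l} \<Longrightarrow> \<not> P i ^ Suc (ex i) dvd p ^ f - 1"
    and P_not_dvd: "\<And>i. i \<in> {1..l} \<Longrightarrow> \<not> P i dvd p - 1"
    and P_ne_p: "\<And>i. i \<in> {1..l} \<Longrightarrow> P i \<noteq> p"
    and ml: "m \<le> l" and ex_one: "\<And>i. i \<in> {m+1..l} \<Longrightarrow> ex i = 1"
    and pure: "\<And>j. j \<in> {1..m} \<Longrightarrow> \<exists>s. (k div P j ^ ex j) dvd p ^ s + 1"
begin

lemma P_gt_1: "i \<in> {1..l} \<Longrightarrow> P i > 1"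
  using P_prime prime_gt_1_nat by blast

lemma M_pos: "M > 0"
  unfolding M_def using P_gt_1 by (intro prod_pos) (metis gr_implies_not0 gr0I power_eq_0_iff)

lemma k_eq: "k = h * M"
proof -
  have "P i ^ ex i = P i * P i ^ (ex i - 1)" if "i \<in> {1..l}" for i
    using ex_pos[OF that] by (simp flip: power_Suc)
  then show ?thesis unfolding k_def h_def M_def by (simp flip: prod.distrib)
qed

lemma h_pos: "h > 0"
  unfolding h_def using P_gt_1 by (intro prod_pos) (metis gr_implies_not0 gr0I)

lemma k_pos: "k > 0" using k_eq h_pos M_pos by simp

text \<open>Exponents beyond \<open>m\<close> are 1 and contribute nothing to \<open>M\<close>.
  Hence the climb meets only degrees \<open>P j\<close> with \<open>j \<le> m\<close>, for which
  \<open>pure\<close> is available.\<close>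

lemma prime_dvd_M:
  assumes "prime r" "r dvd M"
  shows "\<exists>j\<in>{1..m}. r = P j \<and> ex j \<ge> 2"
proof -
  obtain j where j: "j \<in> {1..l}" "r dvd P j ^ (ex j - 1)"
    using assms prime_dvd_prod_iff[of "{1..l}" r "\<lambda>i. P i ^ (ex i - 1)"] by (auto simp: M_def)
  have e: "ex j - 1 \<noteq> 0" using j(2) assms(1) by (cases "ex j - 1 = 0") auto
  have "r dvd P j" using j(2) assms(1) prime_dvd_power by blast
  then have "r = P j" using P_prime[OF j(1)] assms(1) primes_dvd_imp_eq by blast
  moreover have "j \<le> m"
  proof (rule ccontr)
    assume "\<not> j \<le> m"
    then have "ex j = 1" using j(1) by (intro ex_one) auto
    then show False using e by simp
  qed
  ultimately show ?thesis using j(1) e by auto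
qed

lemma P_dvd_h: "i \<in> {1..l} \<Longrightarrow> P i dvd h"
  unfolding h_def by (rule dvd_prodI) auto

lemma prime_dvd_M_h: "prime r \<Longrightarrow> r dvd M \<Longrightarrow> r dvd h"
proof -
  assume "prime r" "r dvd M"
  then obtain j where "j \<in> {1..m}" "r = P j" using prime_dvd_M by blast
  then show ?thesis using P_dvd_h[of j] ml by simp
qed

lemma Pex_dvd_k: "i \<in> {1..l} \<Longrightarrow> P i ^ ex i dvd k"
  unfolding k_def by (rule dvd_prodI) auto

lemma coprime_PP: "i \<in> {1..l} \<Longrightarrow> j \<in> {1..l} \<Longrightarrow> i \<noteq> j \<Longrightarrow> coprime (P i ^ a) (P j ^ b)"
proof -
  assume ij: "i \<in> {1..l}" "j \<in> {1..l}" "i \<noteq> j"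
  then have "P i \<noteq> P j" using P_inj by (auto dest: inj_onD)
  then have "coprime (P i) (P j)" using primes_coprime[OF P_prime[OF ij(1)] P_prime[OF ij(2)]] by simp
  then show ?thesis by simp
qed

lemma k_dvdI: "(\<And>i. i \<in> {1..l} \<Longrightarrow> P i ^ ex i dvd x) \<Longrightarrow> k dvd x"
  unfolding k_def by (rule coprime_prod_dvd) (blast intro: coprime_PP)+

lemma M_dvdI: "(\<And>i. i \<in> {1..l} \<Longrightarrow> P i ^ (ex i - 1) dvd x) \<Longrightarrow> M dvd x"
  unfolding M_def by (rule coprime_prod_dvd) (blast intro: coprime_PP)+

lemma d_dvd: "d dvd f" by (simp add: fdM)

text \<open>Raising \<open>p ^ d\<close> to the power \<open>T\<close> gains a factor
  \<open>T\<close>, since every prime of \<open>T\<close> already divides \<open>h\<close>.\<close>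

lemma level_dvd:
  assumes "T dvd M" shows "h * T dvd p ^ (d * T) - 1"
proof -
  have T: "T > 0" using assms M_pos by (rule dvd_pos_nat[rotated])
  have "h * T dvd (p ^ d) ^ T - 1"
    using h_dvd p_gt_1 T assms prime_dvd_M_h by (intro power_minus_1_lift) (auto intro: dvd_trans)
  then show ?thesis by (simp add: power_mult)
qed

lemma qm_eq: "qm = p ^ (d * M) - 1"
  unfolding qm_def by (simp only: fdM)

lemma k_dvd_qm: "k dvd qm"
  unfolding qm_eq k_eq by (rule level_dvd) simp

text \<open>The same lifting between level \<open>T\<close> and the top: the order of the
  multiplicative group gains the factor \<open>S\<close>.\<close>

lemma stride_level_dvd:
  assumes "T * S = M" shows "S dvd stride (d * T)"
proof -
  have T: "d * T dvd f" using assms by (metis fdM dvd_triv_left mult.assoc)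
  have S: "S > 0" "S dvd M" using assms M_pos by (auto intro: Nat.gr0I)
  define A where "A = p ^ (d * T)"
  have A: "A > 1" unfolding A_def by (rule pr_gt_1[OF T])
  have "(A - 1) * S dvd A ^ S - 1"
  proof (rule power_minus_1_lift)
    fix r assume "prime r" "r dvd S"
    then have "r dvd h" using S prime_dvd_M_h dvd_trans by blast
    also have "h dvd p ^ d - 1" by (rule h_dvd)
    also have "p ^ d - 1 dvd A - 1" unfolding A_def by (rule power_minus_1_dvd) simp
    finally show "r dvd A - 1" .
  qed (use A S in auto)
  also have "A ^ S - 1 = qm" unfolding A_def qm_eq power_mult[symmetric] mult.assoc assms ..
  also have "qm = (A - 1) * stride (d * T)" using stride_mult[OF T] by (simp add: A_def mult.commute)
  finally show ?thesis using A by simp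
qed

text \<open>The form in which \<open>exact_k\<close> is applied: \<open>P i\<close> would divide
  \<open>q - 1\<close> once too often.\<close>

lemma no_extra:
  assumes "i \<in> {1..l}" "P i ^ ex i dvd x" "P i dvd y" "x * y dvd qm"
  shows False
proof -
  have "P i ^ ex i * P i dvd x * y" using assms by (intro mult_dvd_mono)
  then have "P i ^ Suc (ex i) dvd qm" using assms(4) dvd_trans by (simp add: mult.commute) blast
  then show False using exact_k[OF assms(1)] by (simp add: qm_def)
qed

definition dlog :: "'b \<Rightarrow> nat" where "dlog x = (LEAST i. \<gamma> ^ i = x)"

lemma dlog: "x \<noteq> 0 \<Longrightarrow> \<gamma> ^ dlog x = x"
  unfolding dlog_def using gamma_exists[of x] by (metis (mono_tags, lifting) LeastI)

lemma dlog_gamma: "[dlog (\<gamma> ^ i) = i] (mod k)"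
  using dlog[of "\<gamma> ^ i"] gamma_nz gamma_eq_iff k_dvd_qm by (metis cong_dvd_modulus_nat power_not_zero)

lemma zk_cong: "[i = j] (mod k) \<Longrightarrow> zroot k ^ i = zroot k ^ j"
  unfolding zroot_pow using k_pos by (intro cis_cong)

lemma zk_eq_1: "zroot k ^ i = 1 \<longleftrightarrow> k dvd i"
  unfolding zroot_pow using k_pos by (rule cis_eq_1_iff_dvd)

text \<open>The character of order dividing \<open>k\<close> whose value at \<open>\<gamma>\<close>
  is \<open>zroot k ^ c\<close>; as \<open>k\<close> divides \<open>qm\<close>, the choice of
  logarithm is immaterial.\<close>

definition chi :: "nat \<Rightarrow> 'b \<Rightarrow> complex" where
  "chi c x = (if x = 0 then 0 else zroot k ^ (c * dlog x))"

lemma chi_gamma: "chi c (\<gamma> ^ i) = zroot k ^ (c * i)"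
proof -
  have "[c * dlog (\<gamma> ^ i) = c * i] (mod k)" by (intro cong_scalar_left dlog_gamma)
  then show ?thesis using gamma_nz zk_cong by (simp add: chi_def)
qed

lemma mchar_chi: "mchar (chi c)"
  unfolding mchar_def
proof (intro conjI allI)
  show "chi c 0 = 0" by (simp add: chi_def)
  show "chi c 1 = 1" using chi_gamma[of c 0] by simp
  fix x y :: 'b
  show "chi c (x * y) = chi c x * chi c y"
  proof (cases "x = 0 \<or> y = 0")
    case False
    then obtain i j where "x = \<gamma> ^ i" "y = \<gamma> ^ j" using gamma_exists by blast
    then have "x * y = \<gamma> ^ (i + j)" "x = \<gamma> ^ i" "y = \<gamma> ^ j" by (simp_all add: power_add)
    then show ?thesis by (simp only: chi_gamma) (simp add: distrib_left power_add)
  qed (auto simp: chi_def)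
qed

text \<open>\<open>k\<close> is prime to \<open>p - 1\<close>, so it divides
  \<open>qm div (p - 1)\<close>, and every nonzero element of the prime field is a
  \<open>k\<close>-th power.\<close>

lemma chi_prime_field:
  assumes "x \<in> Fix p - {0}" shows "chi c x = 1"
proof -
  have "coprime (P i) (p - 1)" if "i \<in> {1..l}" for i
    by (rule prime_imp_coprime[OF P_prime[OF that] P_not_dvd[OF that]])
  then have cop: "coprime k (p - 1)" unfolding k_def by (intro prod_coprime_left) (auto simp: coprime_power_left_iff)
  have "stride 1 * (p - 1) = qm" using stride_mult[of 1] by simp
  then have "k dvd stride 1" using k_dvd_qm cop by (simp only: coprime_dvd_mult_left_iff flip: \<open>stride 1 * (p - 1) = qm\<close>)
  moreover obtain i where "x = \<gamma> ^ (stride 1 * i)" using Fix_nz_iff[of 1 x] assms by auto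
  ultimately show ?thesis by (simp add: chi_gamma zk_eq_1)
qed

text \<open>The order of \<open>chi c\<close> contains each \<open>P i\<close> either not at all or to the full power \<open>ex i\<close>.\<close>

definition exact :: "nat \<Rightarrow> bool" where
  "exact c \<longleftrightarrow> (\<forall>i\<in>{1..l}. P i dvd c \<longrightarrow> P i ^ ex i dvd c)"

lemma dvd_of_coprime_P:
  assumes "i \<in> {1..l}" "\<not> P i dvd c" "P i ^ n dvd c * x"
  shows "P i ^ n dvd x"
proof -
  have "coprime (P i ^ n) c" using prime_imp_coprime[OF P_prime[OF assms(1)] assms(2)] by simp
  then show ?thesis using assms(3) by (simp only: coprime_dvd_mult_right_iff)
qed

text \<open>Induction splits one prime \<open>\<pi>\<close> off \<open>T\<close>. Exactness of
  \<open>c\<close> decides between the two kinds of step: either \<open>\<pi>\<close> does not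
  divide \<open>c\<close>, or it does not divide the order of the character, and then
  \<open>pure\<close> applies to the remaining modulus.\<close>

lemma relative_gauss:
  assumes c: "exact c" "\<not> k dvd c" and "T dvd M"
  shows "gauss (d * T) (chi c) = of_nat ((p ^ d) ^ ((T - 1) div 2)) * gauss d (chi c)"
  using assms(3)
proof (induction T rule: less_induct)
  case (less T)
  have T0: "T > 0" using less.prems M_pos by (rule dvd_pos_nat[rotated])
  show ?case
  proof (cases "T = 1")
    case False
    then obtain \<pi> where pi: "prime \<pi>" "\<pi> dvd T" using prime_factor_nat by blast
    then obtain j where j: "j \<in> {1..m}" "\<pi> = P j" using prime_dvd_M[of \<pi>] less.prems dvd_trans by blast
    have jl: "j \<in> {1..l}" using j ml by auto
    obtain T' where T': "T = T' * \<pi>" using pi(2) by (metis dvdE mult.commute)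
    obtain S where S: "T * S = M" using less.prems by (metis dvdE)
    have pi1: "\<pi> > 1" using pi(1) prime_gt_1_nat by blast
    have T'0: "T' > 0" "T' < T" using T' T0 pi1 by auto
    have T'M: "T' dvd M" using S T' by (metis dvd_triv_left mult.assoc)
    define r where "r = d * T'"
    have rpi: "r * \<pi> = d * T" by (simp add: r_def T')
    have rf: "r * \<pi> dvd f" unfolding rpi using S by (metis fdM dvd_triv_left mult.assoc)
    interpret St: prime_step \<gamma> p f r \<pi>
      by unfold_locales (use rf pi P_odd[OF jl] P_ne_p[OF jl] j in auto)
    have Q1: "p ^ r > 1" by (rule St.Q_gt_1)
    have hT': "h * T' dvd p ^ r - 1" unfolding r_def by (rule level_dvd[OF T'M])
    then have hQ: "h dvd p ^ r - 1" by (rule dvd_mult_left)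
    have piQ: "\<pi> dvd p ^ r - 1" unfolding j(2) by (rule dvd_trans[OF P_dvd_h[OF jl] hQ])
    have S_stp: "S dvd stride (r * \<pi>)" unfolding rpi by (rule stride_level_dvd[OF S])
    have kk: "k = h * T' * (\<pi> * S)" using k_eq S T' by simp
    \<comment> \<open>On the field of the upper level, \<open>\<chi> ^ (p ^ r - 1)\<close> thus has
      order dividing \<open>\<pi>\<close>.\<close>
    have k1: "k dvd stride (r * \<pi>) * ((p ^ r - 1) * \<pi>)"
    proof -
      have "(h * T') * (\<pi> * S) dvd (p ^ r - 1) * (\<pi> * stride (r * \<pi>))"
        by (intro mult_dvd_mono hT' dvd_refl S_stp)
      then show ?thesis unfolding kk by (simp add: mult_ac)
    qed
    have step: "gauss (r * \<pi>) (chi c) = of_nat ((p ^ r) ^ ((\<pi> - 1) div 2)) * gauss r (chi c)"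
    proof (cases "\<pi> dvd c")
      case False
      show ?thesis
      proof (rule St.gauss_step_ramified[OF mchar_chi piQ])
        fix z :: 'b assume "z \<in> Fix (p ^ (r * \<pi>)) - {0}"
        then obtain i where z: "z = \<gamma> ^ (stride (r * \<pi>) * i)" using Fix_nz_iff[OF rf] by blast
        have "chi c z ^ ((p ^ r - 1) * \<pi>) = zroot k ^ (c * (stride (r * \<pi>) * i) * ((p ^ r - 1) * \<pi>))"
          unfolding z chi_gamma by (rule power_mult[symmetric])
        also have "\<dots> = 1" unfolding zk_eq_1
          using dvd_mult[OF k1, of "c * i"] by (simp add: mult_ac)
        finally show "chi c z ^ ((p ^ r - 1) * \<pi>) = 1" .
      next
        show "\<gamma> ^ stride (r * \<pi>) \<in> Fix (p ^ (r * \<pi>)) - {0}"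
          using Fix_nz_iff[OF rf, of "\<gamma> ^ stride (r * \<pi>)"] by (metis mult.right_neutral)
        \<comment> \<open>Otherwise \<open>P j ^ ex j\<close> divides
          \<open>stride (r * \<pi>) * (p ^ r - 1)\<close>, while the remaining factor
          \<open>(\<Sum>i<\<pi>. (p ^ r) ^ i)\<close> of \<open>q - 1\<close> contributes one more
          \<open>\<pi>\<close>.\<close>
        show "chi c (\<gamma> ^ stride (r * \<pi>)) ^ (p ^ r - 1) \<noteq> 1"
        proof
          assume "chi c (\<gamma> ^ stride (r * \<pi>)) ^ (p ^ r - 1) = 1"
          then have "zroot k ^ (c * stride (r * \<pi>) * (p ^ r - 1)) = 1"
            unfolding chi_gamma by (simp only: power_mult)
          then have "k dvd c * (stride (r * \<pi>) * (p ^ r - 1))" unfolding zk_eq_1 by (simp add: mult.assoc)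
          then have "P j ^ ex j dvd c * (stride (r * \<pi>) * (p ^ r - 1))" by (rule dvd_trans[OF Pex_dvd_k[OF jl]])
          then have 1: "P j ^ ex j dvd stride (r * \<pi>) * (p ^ r - 1)"
            by (rule dvd_of_coprime_P[OF jl, rotated]) (use False j in simp)
          obtain t where t: "(\<Sum>i<\<pi>. (p ^ r) ^ i) = \<pi> + (p ^ r - 1) * \<pi> * t"
            using geom_sum_expand[OF piQ St.P_odd Q1] by blast
          have "\<pi> dvd (\<Sum>i<\<pi>. (p ^ r) ^ i)" unfolding t by simp
          moreover have "stride (r * \<pi>) * (p ^ r - 1) * (\<Sum>i<\<pi>. (p ^ r) ^ i) dvd qm"
          proof -
            have "(p ^ r - 1) * (\<Sum>i<\<pi>. (p ^ r) ^ i) = p ^ (r * \<pi>) - 1"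
              using geom_sum_nat[of "p ^ r" \<pi>] Q1 by (simp add: power_mult)
            then have "stride (r * \<pi>) * (p ^ r - 1) * (\<Sum>i<\<pi>. (p ^ r) ^ i) = qm"
              using stride_mult[OF rf] by (simp only: mult.assoc)
            then show ?thesis by simp
          qed
          ultimately show False using no_extra[OF jl 1] j by simp
        qed
      qed (rule chi_prime_field)
    next
      case True
      have ed: "P j ^ ex j dvd c" using True c(1) jl j by (simp add: exact_def)
      define k' where "k' = k div P j ^ ex j"
      have kk': "k = P j ^ ex j * k'" using Pex_dvd_k[OF jl] by (simp add: k'_def)
      obtain s where s: "k' dvd p ^ s + 1" using pure[OF j(1)] by (auto simp: k'_def)
      have "k = P j ^ ex j * (\<Prod>i\<in>{1..l} - {j}. P i ^ ex i)"
        unfolding k_def by (rule prod.remove) (use jl in auto)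
      then have k'e: "k' = (\<Prod>i\<in>{1..l} - {j}. P i ^ ex i)"
        using P_gt_1[OF jl] by (simp add: k'_def)
      have cop: "coprime k' \<pi>" unfolding k'e
        by (rule prod_coprime_left) (use coprime_PP[of _ j _ 1] jl j in auto)
      have k'2: "k' dvd stride (r * \<pi>) * (p ^ r - 1)"
      proof -
        have "k' dvd k" unfolding kk' by simp
        then have "k' dvd stride (r * \<pi>) * (p ^ r - 1) * \<pi>" using k1 unfolding mult.assoc by (rule dvd_trans)
        then show ?thesis using cop by (simp only: coprime_dvd_mult_left_iff)
      qed
      \<comment> \<open>As \<open>k\<close> does not divide \<open>c\<close>, exactness leaves some
        prime \<open>P i0\<close> not dividing \<open>c\<close>; it makes the character nontrivial
        on the smaller field.\<close>
      obtain i0 where i0: "i0 \<in> {1..l}" "\<not> P i0 dvd c"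
        using c k_dvdI[of c] unfolding exact_def by blast
      show ?thesis
      proof (rule St.gauss_step_pure[OF mchar_chi piQ, of _ _ s])
        fix z :: 'b assume "z \<in> Fix (p ^ (r * \<pi>)) - {0}"
        then obtain i where z: "z = \<gamma> ^ (stride (r * \<pi>) * i)" using Fix_nz_iff[OF rf] by blast
        have "z ^ (p ^ r) = z * z ^ (p ^ r - 1)" by (rule St.pow_Q)
        then have "chi c (z ^ (p ^ r)) = chi c z * chi c z ^ (p ^ r - 1)"
          using mchar_simps[OF mchar_chi] by simp
        also have "chi c z ^ (p ^ r - 1) = zroot k ^ (c * (stride (r * \<pi>) * i) * (p ^ r - 1))"
          unfolding z chi_gamma by (rule power_mult[symmetric])
        also have "\<dots> = 1"
        proof -
          have "k dvd i * (c * (stride (r * \<pi>) * (p ^ r - 1)))"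
            by (subst kk') (intro dvd_mult mult_dvd_mono ed k'2)
          then show ?thesis unfolding zk_eq_1 by (simp add: mult_ac)
        qed
        finally show "chi c (z ^ (p ^ r)) = chi c z" by simp
      next
        show "\<gamma> ^ stride r \<in> Fix (p ^ r) - {0}"
          using Fix_nz_iff[OF St.r_dvd, of "\<gamma> ^ stride r"] by (metis mult.right_neutral)
        show "chi c (\<gamma> ^ stride r) \<noteq> 1"
        proof
          assume "chi c (\<gamma> ^ stride r) = 1"
          then have "k dvd c * stride r" unfolding chi_gamma zk_eq_1 .
          then have "P i0 ^ ex i0 dvd c * stride r" by (rule dvd_trans[OF Pex_dvd_k[OF i0(1)]])
          then have 1: "P i0 ^ ex i0 dvd stride r" by (rule dvd_of_coprime_P[OF i0])
          have "P i0 dvd p ^ r - 1" by (rule dvd_trans[OF P_dvd_h[OF i0(1)] hQ])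
          then show False by (rule no_extra[OF i0(1) 1]) (simp only: stride_mult[OF St.r_dvd] dvd_refl)
        qed
      next
        fix x :: 'b assume "x \<noteq> 0"
        then obtain i where x: "x = \<gamma> ^ i" using gamma_exists by blast
        have "k dvd c * i * p ^ s + c * i"
        proof -
          have "k dvd i * (c * (p ^ s + 1))" unfolding kk' by (intro dvd_mult mult_dvd_mono ed s)
          then show ?thesis by (simp add: algebra_simps)
        qed
        then have "chi c (x ^ (p ^ s)) * chi c x = 1"
          unfolding x power_mult[symmetric] chi_gamma by (simp add: zk_eq_1 mult.assoc flip: power_add)
        moreover have "cnj (chi c x) * chi c x = 1"
          using mchar_cnj[OF mchar_chi \<open>x \<noteq> 0\<close>] by (simp add: mult.commute)
        ultimately show "chi c (x ^ (p ^ s)) = cnj (chi c x)"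
          using mchar_nz[OF mchar_chi \<open>x \<noteq> 0\<close>, of c] by (metis mult_cancel_right)
      qed (rule chi_prime_field)
    qed
    have "gauss (d * T) (chi c) = of_nat ((p ^ r) ^ ((\<pi> - 1) div 2)) * gauss r (chi c)"
      using step rpi by simp
    also have "gauss r (chi c) = of_nat ((p ^ d) ^ ((T' - 1) div 2)) * gauss d (chi c)"
      unfolding r_def by (rule less.IH[OF T'0(2) T'M])
    also have "of_nat ((p ^ r) ^ ((\<pi> - 1) div 2)) * (of_nat ((p ^ d) ^ ((T' - 1) div 2)) * gauss d (chi c)) =
       of_nat ((p ^ d) ^ ((T - 1) div 2)) * gauss d (chi c)"
    proof -
      have "odd T'"
      proof
        assume "even T'"
        then have "2 dvd M" using T'M dvd_trans by blast
        then obtain i where "i \<in> {1..m}" "2 = P i" using prime_dvd_M[of 2] by auto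
        then show False using P_odd[of i] ml by auto
      qed
      then obtain u where u: "T' = 2 * u + 1" by (auto elim: oddE)
      obtain v where v: "\<pi> = 2 * v + 1" using St.P_odd by (auto elim: oddE)
      \<comment> \<open>Adds up the exponents, \<open>p ^ r\<close> being the \<open>T'\<close>-th
        power of \<open>p ^ d\<close>.\<close>
      have "(T - 1) div 2 = T' * v + u" unfolding T' u v by (simp add: algebra_simps)
      then have "(p ^ d) ^ ((T - 1) div 2) = (p ^ r) ^ v * (p ^ d) ^ u"
        by (simp add: r_def power_add mult_ac flip: power_mult)
      then show ?thesis by (simp add: u v)
    qed
    finally show ?thesis .
  qed simp
qed

section \<open>Character sums over cyclotomic classes\<close>

text \<open>For \<open>j \<le> m\<close> these are the numbers \<open>n j\<close> of the
  theorem.\<close>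

definition cofac :: "nat \<Rightarrow> nat" where "cofac j = k div P j ^ ex j"

definition shifts :: "(nat \<Rightarrow> nat) set" where
  "shifts = (\<Pi>\<^sub>E j\<in>{1..m}. {..<P j ^ (ex j - 1)})"

definition shift_of :: "(nat \<Rightarrow> nat) \<Rightarrow> nat" where "shift_of t = (\<Sum>j\<in>{1..m}. t j * cofac j)"

lemma finite_shifts [simp]: "finite shifts"
  unfolding shifts_def by (intro finite_PiE) auto

lemma cofac_mult: "j \<in> {1..l} \<Longrightarrow> P j ^ ex j * cofac j = k"
  unfolding cofac_def using Pex_dvd_k by simp

lemma cofac_prod:
  assumes "j \<in> {1..l}" shows "cofac j = (\<Prod>i\<in>{1..l} - {j}. P i ^ ex i)"
proof -
  have "k = P j ^ ex j * (\<Prod>i\<in>{1..l} - {j}. P i ^ ex i)"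
    unfolding k_def by (rule prod.remove) (use assms in auto)
  then have "P j ^ ex j * cofac j = P j ^ ex j * (\<Prod>i\<in>{1..l} - {j}. P i ^ ex i)"
    by (rule trans[OF cofac_mult[OF assms]])
  then show ?thesis using P_gt_1[OF assms] by simp
qed

lemma cofac_coprime: "j \<in> {1..l} \<Longrightarrow> coprime (cofac j) (P j ^ n)"
  unfolding cofac_prod by (rule prod_coprime_left) (blast intro: coprime_PP)

lemma cofac_dvd:
  assumes "i \<in> {1..l}" "j \<in> {1..l}" "i \<noteq> j" shows "P j ^ ex j dvd cofac i"
  unfolding cofac_prod[OF assms(1)] by (rule dvd_prodI) (use assms in auto)

lemma Pe_pos: "j \<in> {1..l} \<Longrightarrow> P j ^ n > 0"
  using P_gt_1[of j] by simp

text \<open>Modulo \<open>P j ^ (ex j - 1)\<close> only the \<open>j\<close>-th summand of the shift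
  survives, the other cofactors being divisible by \<open>P j ^ ex j\<close>.\<close>

lemma M_dvd_iff: "M dvd a + shift_of t \<longleftrightarrow> (\<forall>j\<in>{1..m}. P j ^ (ex j - 1) dvd a + t j * cofac j)"
proof -
  have *: "P j ^ (ex j - 1) dvd a + shift_of t \<longleftrightarrow> P j ^ (ex j - 1) dvd a + t j * cofac j" if j: "j \<in> {1..m}" for j
  proof -
    have "shift_of t = t j * cofac j + (\<Sum>i\<in>{1..m} - {j}. t i * cofac i)"
      unfolding shift_of_def by (rule sum.remove) (use j in auto)
    then have e: "a + shift_of t = (a + t j * cofac j) + (\<Sum>i\<in>{1..m} - {j}. t i * cofac i)" by simp
    have "P j ^ (ex j - 1) dvd (\<Sum>i\<in>{1..m} - {j}. t i * cofac i)"
    proof (intro dvd_sum dvd_mult)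
      fix i assume "i \<in> {1..m} - {j}"
      then have "P j ^ ex j dvd cofac i" using j ml by (intro cofac_dvd) auto
      then show "P j ^ (ex j - 1) dvd cofac i" by (meson dvd_trans le_imp_power_dvd diff_le_self)
    qed
    then show ?thesis unfolding e by (rule dvd_add_left_iff)
  qed
  show ?thesis
  proof
    assume "M dvd a + shift_of t"
    moreover have "P j ^ (ex j - 1) dvd M" if "j \<in> {1..m}" for j
      unfolding M_def by (rule dvd_prodI) (use that ml in auto)
    ultimately show "\<forall>j\<in>{1..m}. P j ^ (ex j - 1) dvd a + t j * cofac j" using * by (meson dvd_trans)
  next
    assume R: "\<forall>j\<in>{1..m}. P j ^ (ex j - 1) dvd a + t j * cofac j"
    show "M dvd a + shift_of t"
    proof (rule M_dvdI)
      fix i assume i: "i \<in> {1..l}"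
      show "P i ^ (ex i - 1) dvd a + shift_of t"
      proof (cases "i \<le> m")
        case False
        then have "ex i = 1" using i by (intro ex_one) auto
        then show ?thesis by simp
      qed (use R * i in auto)
    qed
  qed
qed

text \<open>By the Chinese remainder theorem the shifts form a complete residue system modulo
  \<open>M\<close>.\<close>

lemma shifts_unique: "\<exists>!t. t \<in> shifts \<and> M dvd a + shift_of t"
proof -
  have ex1: "\<exists>!t. t < P j ^ (ex j - 1) \<and> P j ^ (ex j - 1) dvd a + t * cofac j" if "j \<in> {1..m}" for j
    using that ml by (intro cong_solve_unique cofac_coprime Pe_pos) auto
  then have "\<forall>j\<in>{1..m}. \<exists>t. t < P j ^ (ex j - 1) \<and> P j ^ (ex j - 1) dvd a + t * cofac j" by blast
  then obtain g where g: "\<forall>j\<in>{1..m}. g j < P j ^ (ex j - 1) \<and> P j ^ (ex j - 1) dvd a + g j * cofac j"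
    by (rule bchoice[THEN exE])
  show ?thesis
  proof (rule ex_ex1I)
    show "\<exists>t. t \<in> shifts \<and> M dvd a + shift_of t"
      by (rule exI[of _ "restrict g {1..m}"]) (use g in \<open>simp add: shifts_def M_dvd_iff\<close>)
    fix t t' assume t: "t \<in> shifts \<and> M dvd a + shift_of t" "t' \<in> shifts \<and> M dvd a + shift_of t'"
    show "t = t'"
    proof (rule PiE_ext[of t "{1..m}" "\<lambda>j. {..<P j ^ (ex j - 1)}"])
      fix j assume j: "j \<in> {1..m}"
      have "t j < P j ^ (ex j - 1)" "t' j < P j ^ (ex j - 1)"
        using t j by (auto simp: shifts_def dest: PiE_mem)
      then show "t j = t' j" using ex1[OF j] t j unfolding M_dvd_iff by blast
    qed (use t in \<open>auto simp: shifts_def\<close>)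
  qed
qed

text \<open>Distinct shifts give disjoint classes, so a sum over shifts counts each element of
  \<open>Dset\<close> once.\<close>

lemma shifts_cong_unique:
  assumes "t \<in> shifts" "t' \<in> shifts" "[a + shift_of t = a + shift_of t'] (mod k)"
  shows "t = t'"
proof -
  have Mk: "M dvd k" using k_eq by simp
  \<comment> \<open>A complement in the natural numbers that makes
    \<open>b + (a + shift_of t)\<close> a multiple of \<open>M\<close>, so that
    \<open>shifts_unique\<close> applies.\<close>
  define b where "b = (M - 1) * (a + shift_of t)"
  have "b + (a + shift_of t) = M * (a + shift_of t)" unfolding b_def using M_pos by (cases M) auto
  then have 1: "M dvd (b + a) + shift_of t" unfolding add.assoc by (rule dvdI)
  have "[b + (a + shift_of t) = b + (a + shift_of t')] (mod M)"
    by (rule cong_add[OF cong_refl cong_dvd_modulus_nat[OF assms(3) Mk]])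
  then have "M dvd (b + a) + shift_of t'" using 1 unfolding add.assoc by (simp only: cong_dvd_iff)
  then show ?thesis using shifts_unique[of "b + a"] 1 assms by blast
qed

text \<open>The factor \<open>k - 1\<close> in the exponent stands for \<open>-1\<close>.\<close>

definition shift_sum :: "nat \<Rightarrow> nat \<Rightarrow> complex" where
  "shift_sum c a = (\<Sum>t\<in>shifts. zroot k ^ ((k - 1) * (c * (a + shift_of t))))"

lemma k_dvd_pred_mult: "k dvd (k - 1) * x \<longleftrightarrow> k dvd x"
proof -
  have "coprime k (k - 1)" using k_pos by (rule coprime_diff_one_right_nat)
  then show ?thesis by (simp add: coprime_dvd_mult_right_iff)
qed

text \<open>The sum over tuples factors over \<open>j\<close>. If \<open>P j\<close> divides
  \<open>c\<close> but \<open>P j ^ ex j\<close> does not, then \<open>ex j \<noteq> 1\<close>,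
  hence \<open>j \<le> m\<close>, and the \<open>j\<close>-th factor is a full geometric sum of a
  nontrivial root of unity.\<close>

lemma shift_sum_zero:
  assumes "\<not> exact c"
  shows "shift_sum c a = 0"
proof -
  obtain j where j: "j \<in> {1..l}" "P j dvd c" "\<not> P j ^ ex j dvd c" using assms by (auto simp: exact_def)
  have "ex j \<noteq> 1" using j by auto
  then have jm: "j \<in> {1..m}" using j(1) ex_one[of j] by (cases "j \<le> m") auto
  define z where "z = (\<lambda>j. zroot k ^ ((k - 1) * (c * cofac j)))"
  have split: "zroot k ^ ((k - 1) * (c * (a + shift_of t))) =
      zroot k ^ ((k - 1) * (c * a)) * (\<Prod>j\<in>{1..m}. z j ^ t j)" for t
  proof -
    have "(\<Prod>j\<in>{1..m}. z j ^ t j) = (\<Prod>j\<in>{1..m}. zroot k ^ ((k - 1) * (c * (t j * cofac j))))"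
      unfolding z_def by (intro prod.cong refl) (simp add: mult_ac flip: power_mult)
    also have "\<dots> = zroot k ^ (\<Sum>j\<in>{1..m}. (k - 1) * (c * (t j * cofac j)))" by (rule power_sum[symmetric])
    also have "(\<Sum>j\<in>{1..m}. (k - 1) * (c * (t j * cofac j))) = (k - 1) * (c * shift_of t)"
      by (simp add: shift_of_def sum_distrib_left)
    finally have e: "(\<Prod>j\<in>{1..m}. z j ^ t j) = zroot k ^ ((k - 1) * (c * shift_of t))" .
    show ?thesis unfolding e by (simp add: distrib_left power_add)
  qed
  have "shift_sum c a = zroot k ^ ((k - 1) * (c * a)) * (\<Sum>t\<in>shifts. \<Prod>j\<in>{1..m}. z j ^ t j)"
    unfolding shift_sum_def split by (simp add: sum_distrib_left)
  also have "(\<Sum>t\<in>shifts. \<Prod>j\<in>{1..m}. z j ^ t j) = (\<Prod>j\<in>{1..m}. \<Sum>y<P j ^ (ex j - 1). z j ^ y)"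
    unfolding shifts_def by (rule prod_sum_PiE[symmetric]) auto
  also have "\<dots> = 0"
  proof (rule prod_zero)
    obtain c' where c': "c = P j * c'" using j(2) by auto
    have e: "P j * P j ^ (ex j - 1) = P j ^ ex j" using ex_pos[OF j(1)] by (simp flip: power_Suc)
    have "(k - 1) * (c * cofac j) * P j ^ (ex j - 1) = (k - 1) * c' * (P j * P j ^ (ex j - 1) * cofac j)"
      by (simp add: c' mult_ac)
    also have "\<dots> = (k - 1) * c' * k" unfolding e cofac_mult[OF j(1)] ..
    finally have "k dvd (k - 1) * (c * cofac j) * P j ^ (ex j - 1)" by (rule ssubst) (rule dvd_triv_right)
    then have 1: "z j ^ (P j ^ (ex j - 1)) = 1" unfolding z_def power_mult[symmetric] zk_eq_1 .
    have "\<not> k dvd c * cofac j"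
    proof
      assume "k dvd c * cofac j"
      then have "P j ^ ex j * cofac j dvd c * cofac j" unfolding cofac_mult[OF j(1)] .
      moreover have "cofac j \<noteq> 0" using cofac_mult[OF j(1)] k_pos by (cases "cofac j = 0") simp_all
      ultimately show False using j(3) by simp
    qed
    then have "z j \<noteq> 1" unfolding z_def zk_eq_1 k_dvd_pred_mult .
    then have "(\<Sum>y<P j ^ (ex j - 1). z j ^ y) = 0" using 1 by (simp add: geometric_sum)
    then show "\<exists>j\<in>{1..m}. (\<Sum>y<P j ^ (ex j - 1). z j ^ y) = 0" using jm by blast
  qed simp
  finally show ?thesis by simp
qed

lemma card_shifts: "card shifts = M"
proof -
  have "card shifts = (\<Prod>j\<in>{1..m}. P j ^ (ex j - 1))" unfolding shifts_def by (simp add: card_PiE)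
  also have "\<dots> = M" unfolding M_def
  proof (rule prod.mono_neutral_left)
    show "\<forall>i\<in>{1..l} - {1..m}. P i ^ (ex i - 1) = 1"
    proof
      fix i assume "i \<in> {1..l} - {1..m}"
      then have "ex i = 1" by (intro ex_one) auto
      then show "P i ^ (ex i - 1) = 1" by simp
    qed
  qed (use ml in auto)
  finally show ?thesis .
qed

lemma gauss_trivial: "r dvd f \<Longrightarrow> gauss r (chi 0) = -1"
proof -
  assume r: "r dvd f"
  interpret S: subfield_set "Fix (p ^ r) :: 'b set" by (rule subfield_Fix)
  have "gauss r (chi 0) = (\<Sum>x\<in>Fix (p ^ r) - {0}. psi r x)"
    unfolding gauss_nz[OF mchar_chi] by (intro sum.cong refl) (simp add: chi_def)
  moreover have "(\<Sum>x\<in>Fix (p ^ r). psi r x) = psi r 0 + (\<Sum>x\<in>Fix (p ^ r) - {0}. psi r x)"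
    by (rule sum.remove) auto
  moreover have "(\<Sum>x\<in>Fix (p ^ r). psi r x) = 0" using psi_orth[OF r, of 1] by simp
  ultimately show ?thesis by (simp add: eq_neg_iff_add_eq_0 add.commute)
qed

text \<open>\<open>Dset 0\<close> is the \<open>D\<close> of the theorem and \<open>Dset a\<close>
  its multiple by \<open>\<gamma> ^ a\<close>.\<close>

definition Dset :: "nat \<Rightarrow> 'b set" where
  "Dset a = {x. x \<noteq> 0 \<and> (\<exists>t\<in>shifts. [dlog x = a + shift_of t] (mod k))}"

text \<open>Fourier expansion of the indicator of \<open>Dset a\<close> in the characters
  \<open>chi c\<close>, used with \<open>r = f\<close> and \<open>r = d\<close>.\<close>

lemma sum_Dset:
  "of_nat k * (\<Sum>x\<in>Fix (p ^ r) \<inter> Dset a. psi r x) = (\<Sum>c<k. gauss r (chi c) * shift_sum c a)"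
proof -
  let ?F = "Fix (p ^ r) - {0 :: 'b}"
  have inner: "(\<Sum>c<k. zroot k ^ (c * u) * zroot k ^ ((k - 1) * (c * v))) = (if [u = v] (mod k) then of_nat k else 0)" for u v
  proof -
    define w where "w = zroot k ^ (u + (k - 1) * v)"
    have e: "zroot k ^ (c * u) * zroot k ^ ((k - 1) * (c * v)) = w ^ c" for c
      by (simp add: w_def algebra_simps flip: power_add power_mult)
    have "w ^ k = 1" unfolding w_def power_mult[symmetric] zk_eq_1 by simp
    then have s: "w \<noteq> 1 \<Longrightarrow> (\<Sum>c<k. w ^ c) = 0" by (simp add: geometric_sum)
    have "w = 1 \<longleftrightarrow> [u + (k - 1) * v = 0] (mod k)" unfolding w_def zk_eq_1 cong_0_iff ..
    also have "\<dots> \<longleftrightarrow> [u + (k - 1) * v + v = 0 + v] (mod k)" by (rule cong_add_rcancel_nat[symmetric])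
    also have "u + (k - 1) * v + v = u + k * v" using k_pos by (cases k) auto
    also have "[u + k * v = 0 + v] (mod k) \<longleftrightarrow> [u = v] (mod k)" by (simp add: cong_def)
    finally have "w = 1 \<longleftrightarrow> [u = v] (mod k)" .
    then show ?thesis unfolding e using s by (cases "w = 1") simp_all
  qed
  have "(\<Sum>c<k. gauss r (chi c) * shift_sum c a) =
      (\<Sum>c<k. \<Sum>x\<in>?F. \<Sum>t\<in>shifts. psi r x * (zroot k ^ (c * dlog x) * zroot k ^ ((k - 1) * (c * (a + shift_of t)))))"
    unfolding gauss_nz[OF mchar_chi] shift_sum_def sum_product
    by (intro sum.cong refl) (simp add: chi_def mult_ac)
  also have "\<dots> = (\<Sum>x\<in>?F. \<Sum>t\<in>shifts. \<Sum>c<k. psi r x * (zroot k ^ (c * dlog x) * zroot k ^ ((k - 1) * (c * (a + shift_of t)))))"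
    by (subst sum.swap) (intro sum.cong refl sum.swap)
  also have "\<dots> = (\<Sum>x\<in>?F. \<Sum>t\<in>shifts. psi r x * (if [dlog x = a + shift_of t] (mod k) then of_nat k else 0))"
    by (simp only: sum_distrib_left[symmetric] inner)
  also have "\<dots> = (\<Sum>x\<in>?F. if x \<in> Dset a then of_nat k * psi r x else 0)"
  proof (intro sum.cong refl)
    fix x assume x: "x \<in> ?F"
    show "(\<Sum>t\<in>shifts. psi r x * (if [dlog x = a + shift_of t] (mod k) then of_nat k else 0)) =
      (if x \<in> Dset a then of_nat k * psi r x else 0)"
    proof (cases "x \<in> Dset a")
      case True
      then obtain t0 where t0: "t0 \<in> shifts" "[dlog x = a + shift_of t0] (mod k)" by (auto simp: Dset_def)
      have "[dlog x = a + shift_of t] (mod k) \<longleftrightarrow> t = t0" if "t \<in> shifts" for t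
        using shifts_cong_unique[OF that t0(1), of a] t0(2) cong_trans[OF cong_sym[of "dlog x" "a + shift_of t" k] t0(2)]
        by blast
      then have "(\<Sum>t\<in>shifts. psi r x * (if [dlog x = a + shift_of t] (mod k) then of_nat k else 0)) =
         (\<Sum>t\<in>shifts. if t = t0 then of_nat k * psi r x else 0)" by (intro sum.cong refl) auto
      then show ?thesis using t0(1) True by simp
    next
      case False
      then have "\<not> [dlog x = a + shift_of t] (mod k)" if "t \<in> shifts" for t using x that by (auto simp: Dset_def)
      then show ?thesis using False by (simp cong: sum.cong)
    qed
  qed
  also have "\<dots> = (\<Sum>x\<in>Fix (p ^ r) \<inter> Dset a. of_nat k * psi r x)"
  proof -
    have "Fix (p ^ r) \<inter> Dset a = ?F \<inter> {x. x \<in> Dset a}" by (auto simp: Dset_def)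
    then show ?thesis by (simp add: sum.inter_restrict)
  qed
  finally show ?thesis by (simp add: sum_distrib_left)
qed

text \<open>Terms with exact \<open>c \<noteq> 0\<close> are multiplied by \<open>C\<close>, and
  inexact ones vanish. For \<open>c = 0\<close> both Gauss sums are -1, which leaves the defect
  \<open>C - 1\<close> for each of the \<open>M\<close> shifts; finally
  \<open>M / k = 1 / h\<close>.\<close>

lemma sum_Dset_relative:
  defines "C \<equiv> of_nat ((p ^ d) ^ ((M - 1) div 2))"
  shows "(\<Sum>x\<in>Dset a. psi f x) = C * (\<Sum>x\<in>Fix (p ^ d) \<inter> Dset a. psi d x) + (C - 1) / of_nat h"
proof -
  have "of_nat k * (\<Sum>x\<in>Dset a. psi f x) = (\<Sum>c<k. gauss f (chi c) * shift_sum c a)"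
    using sum_Dset[of f a] by (simp add: Fix_f)
  also have "\<dots> = (\<Sum>c<k. C * (gauss d (chi c) * shift_sum c a) + (if c = 0 then (C - 1) * of_nat M else 0))"
  proof (intro sum.cong refl)
    fix c assume c: "c \<in> {..<k}"
    show "gauss f (chi c) * shift_sum c a = C * (gauss d (chi c) * shift_sum c a) + (if c = 0 then (C - 1) * of_nat M else 0)"
    proof (cases "c = 0")
      case True
      have "shift_sum 0 a = of_nat M" by (simp add: shift_sum_def card_shifts)
      then show ?thesis using True gauss_trivial[of f] gauss_trivial[OF d_dvd] by (simp add: algebra_simps)
    next
      case c0: False
      show ?thesis
      proof (cases "exact c")
        case True
        have "\<not> k dvd c" using c c0 by (auto dest: dvd_imp_le)
        then show ?thesis using relative_gauss[OF True, of M] c0 by (simp add: C_def fdM)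
      qed (simp add: shift_sum_zero c0)
    qed
  qed
  also have "\<dots> = C * (\<Sum>c<k. gauss d (chi c) * shift_sum c a) + (C - 1) * of_nat M"
    using k_pos by (simp add: sum.distrib sum_distrib_left)
  also have "\<dots> = C * (of_nat k * (\<Sum>x\<in>Fix (p ^ d) \<inter> Dset a. psi d x)) + (C - 1) * of_nat M"
    by (simp only: sum_Dset)
  also have "(C - 1) * of_nat M = of_nat k * ((C - 1) / of_nat h)"
    using h_pos by (simp add: arg_cong[OF k_eq, of of_nat])
  finally have "of_nat k * (\<Sum>x\<in>Dset a. psi f x) =
      of_nat k * (C * (\<Sum>x\<in>Fix (p ^ d) \<inter> Dset a. psi d x) + (C - 1) / of_nat h)"
    by (simp only: distrib_left mult.left_commute)
  then show ?thesis using k_pos by simp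
qed

text \<open>Nonzero subfield elements are \<open>\<gamma> ^ (N0 * b)\<close> with \<open>M\<close>
  dividing \<open>N0\<close>, so only the one shift with \<open>M dvd a + shift_of t0\<close> can
  meet them. Dividing by \<open>M\<close> leaves a congruence for \<open>b\<close> modulo
  \<open>h\<close>, solvable because \<open>N0 div M\<close> is prime to \<open>h\<close> by
  \<open>exact_k\<close>.\<close>

lemma Dset_coset:
  "\<exists>x0\<in>Fix (p ^ d) - {0}. Fix (p ^ d) \<inter> Dset a = (\<lambda>y. x0 * y ^ h) ` (Fix (p ^ d) - {0})"
proof -
  define N0 where "N0 = stride d"
  have "M dvd N0" using stride_level_dvd[of 1 M] by (simp add: N0_def)
  then obtain N1 where N1: "N0 = M * N1" by auto
  have N0q: "N0 * (p ^ d - 1) = qm" unfolding N0_def by (rule stride_mult[OF d_dvd])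
  have cop: "coprime N1 h" unfolding h_def
  proof (rule prod_coprime_right)
    fix i assume i: "i \<in> {1..l}"
    have "\<not> P i dvd N1"
    proof
      assume 1: "P i dvd N1"
      have "P i ^ (ex i - 1) dvd M" unfolding M_def by (rule dvd_prodI) (use i in auto)
      then have "P i ^ (ex i - 1) * P i dvd N0" unfolding N1 using 1 by (rule mult_dvd_mono)
      moreover have "P i ^ (ex i - 1) * P i = P i ^ ex i" using ex_pos[OF i] by (simp flip: power_Suc2)
      ultimately have 2: "P i ^ ex i dvd N0" by simp
      have "P i dvd p ^ d - 1" by (rule dvd_trans[OF P_dvd_h[OF i] h_dvd])
      then show False by (rule no_extra[OF i 2]) (simp only: N0q dvd_refl)
    qed
    then show "coprime N1 (P i)" using prime_imp_coprime[OF P_prime[OF i]] by (simp add: coprime_commute)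
  qed
  obtain t0 where t0: "t0 \<in> shifts" "M dvd a + shift_of t0" using shifts_unique[of a] by blast
  then obtain w where w: "a + shift_of t0 = M * w" by auto
  obtain b0 where b0: "[N1 * b0 = w] (mod h)"
  proof -
    obtain x where "[N1 * x = 1] (mod h)" using cong_solve_coprime_nat[OF cop] by auto
    then have "[N1 * x * w = 1 * w] (mod h)" by (intro cong_mult cong_refl)
    then show ?thesis using that[of "x * w"] by (simp add: mult.assoc)
  qed
  have cong_M: "[M * x = M * y] (mod k) \<longleftrightarrow> [x = y] (mod h)" for x y
    unfolding k_eq using M_pos by (simp add: cong_def mult.commute[of h])
  have mem: "\<gamma> ^ (N0 * b) \<in> Dset a \<longleftrightarrow> [b = b0] (mod h)" for b
  proof -
    have "\<gamma> ^ (N0 * b) \<in> Dset a \<longleftrightarrow> (\<exists>t\<in>shifts. [N0 * b = a + shift_of t] (mod k))"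
    proof -
      have "[dlog (\<gamma> ^ (N0 * b)) = x] (mod k) \<longleftrightarrow> [N0 * b = x] (mod k)" for x
        using dlog_gamma[of "N0 * b"] by (simp add: cong_def)
      then show ?thesis using gamma_nz by (simp add: Dset_def)
    qed
    also have "\<dots> \<longleftrightarrow> [N0 * b = a + shift_of t0] (mod k)"
    proof
      assume "\<exists>t\<in>shifts. [N0 * b = a + shift_of t] (mod k)"
      then obtain t where t: "t \<in> shifts" "[N0 * b = a + shift_of t] (mod k)" by blast
      have "M dvd k" unfolding k_eq by simp
      then have "[N0 * b = a + shift_of t] (mod M)" by (rule cong_dvd_modulus_nat[OF t(2)])
      moreover have "M dvd N0 * b" unfolding N1 by simp
      ultimately have "M dvd a + shift_of t" using cong_dvd_iff by blast
      then have "t = t0" using shifts_unique[of a] t(1) t0 by blast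
      then show "[N0 * b = a + shift_of t0] (mod k)" using t by simp
    qed (use t0 in blast)
    also have "\<dots> \<longleftrightarrow> [N1 * b = w] (mod h)" unfolding w N1 mult.assoc cong_M ..
    also have "\<dots> \<longleftrightarrow> [N1 * b = N1 * b0] (mod h)" using cong_trans[OF _ b0, of "N1 * b"] cong_trans[OF _ cong_sym[OF b0], of "N1 * b"] by blast
    also have "\<dots> \<longleftrightarrow> [b = b0] (mod h)" using cop by (simp add: cong_mult_lcancel_nat)
    finally show ?thesis .
  qed
  define x0 where "x0 = \<gamma> ^ (N0 * b0)"
  have Fix_iff: "x \<in> Fix (p ^ d) - {0} \<longleftrightarrow> (\<exists>b. x = \<gamma> ^ (N0 * b))" for x
    unfolding N0_def by (rule Fix_nz_iff[OF d_dvd])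
  have "Fix (p ^ d) \<inter> Dset a = (\<lambda>y. x0 * y ^ h) ` (Fix (p ^ d) - {0})"
  proof (intro equalityI subsetI)
    fix x assume x: "x \<in> Fix (p ^ d) \<inter> Dset a"
    then have "x \<in> Fix (p ^ d) - {0}" by (auto simp: Dset_def)
    then obtain b where b: "x = \<gamma> ^ (N0 * b)" using Fix_iff by blast
    then have "[b = b0] (mod h)" using x mem by blast
    \<comment> \<open>A congruence of natural numbers adds multiples on both sides; the quotient
      \<open>y1 / y2\<close> takes the place of a negative exponent.\<close>
    then obtain s1 s2 where s: "b0 + s1 * h = b + s2 * h" by (auto simp: cong_iff_lin_nat)
    define y1 y2 where "y1 = \<gamma> ^ (N0 * s1)" and "y2 = \<gamma> ^ (N0 * s2)"
    have y: "y1 \<in> Fix (p ^ d) - {0}" "y2 \<in> Fix (p ^ d) - {0}" using Fix_iff y1_def y2_def by blast+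
    have "x0 * y1 ^ h = \<gamma> ^ (N0 * (b0 + s1 * h))"
      by (simp add: x0_def y1_def power_add distrib_left mult.assoc flip: power_mult)
    also have "\<dots> = x * y2 ^ h" unfolding s
      by (simp add: b y2_def power_add distrib_left mult.assoc flip: power_mult)
    finally have "x = x0 * (y1 / y2) ^ h" using y by (simp add: field_simps power_divide)
    moreover have "y1 / y2 \<in> Fix (p ^ d) - {0}"
      using y subfield_set.divide_K[OF subfield_Fix] by auto
    ultimately show "x \<in> (\<lambda>y. x0 * y ^ h) ` (Fix (p ^ d) - {0})" by blast
  next
    fix x assume "x \<in> (\<lambda>y. x0 * y ^ h) ` (Fix (p ^ d) - {0})"
    then obtain y where y: "y \<in> Fix (p ^ d) - {0}" "x = x0 * y ^ h" by blast
    obtain s where s: "y = \<gamma> ^ (N0 * s)" using Fix_iff y(1) by blast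
    have "x0 * y ^ h = \<gamma> ^ (N0 * (b0 + s * h))"
      by (simp add: x0_def s power_add distrib_left mult.assoc flip: power_mult)
    then have x: "x = \<gamma> ^ (N0 * (b0 + s * h))" using y(2) by simp
    have "[b0 + s * h = b0] (mod h)" by (simp add: cong_def)
    then have "x \<in> Dset a" unfolding x mem .
    moreover have "x \<in> Fix (p ^ d) - {0}" using Fix_iff x by blast
    ultimately show "x \<in> Fix (p ^ d) \<inter> Dset a" by blast
  qed
  moreover have "x0 \<in> Fix (p ^ d) - {0}" using Fix_iff x0_def by blast
  ultimately show ?thesis by blast
qed

end

section \<open>Strongly regular Cayley graphs\<close>

definition addchar :: "('a::finite_field \<Rightarrow> complex) \<Rightarrow> bool" where
  "addchar e \<longleftrightarrow> e 0 = 1 \<and> (\<forall>x y. e (x + y) = e x * e y) \<and> (\<exists>x. e x \<noteq> 1)"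

lemma addchar_simps:
  assumes "addchar e" shows "e 0 = 1" "e (x + y) = e x * e y"
  using assms by (auto simp: addchar_def)

lemma addchar_orth:
  assumes "addchar (e :: 'a::finite_field \<Rightarrow> complex)"
  shows "(\<Sum>u\<in>UNIV. e (u * z)) = (if z = 0 then of_nat CARD('a) else 0)"
proof (cases "z = 0")
  case False
  obtain y where y: "e y \<noteq> 1" using assms by (auto simp: addchar_def)
  have "(\<Sum>u\<in>UNIV. e (u * z)) = (\<Sum>u\<in>UNIV. e ((u + y / z) * z))"
    by (rule sum.reindex_bij_witness[of _ "\<lambda>u. u + y / z" "\<lambda>u. u - y / z"]) auto
  also have "\<dots> = (\<Sum>u\<in>UNIV. e (u * z)) * e y"
    unfolding sum_distrib_right
    by (rule sum.cong[OF refl]) (use False in \<open>simp add: distrib_right addchar_simps[OF assms]\<close>)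
  finally show ?thesis using y False by simp
qed (simp add: addchar_simps[OF assms])

text \<open>The convolution square of the indicator of \<open>S\<close>; for symmetric
  \<open>S\<close> it counts common neighbours.\<close>

definition conv :: "'a::finite_field set \<Rightarrow> 'a \<Rightarrow> nat" where
  "conv S z = card {x \<in> S. z - x \<in> S}"

lemma charsum_square:
  assumes e: "addchar (e :: 'a::finite_field \<Rightarrow> complex)"
  shows "(\<Sum>x\<in>S. e (v * x))\<^sup>2 = (\<Sum>z\<in>UNIV. of_nat (conv S z) * e (v * z))"
proof -
  have "(\<Sum>x\<in>S. e (v * x))\<^sup>2 = (\<Sum>x\<in>S. \<Sum>y\<in>S. e (v * (x + y)))"
    by (simp add: power2_eq_square sum_product distrib_left addchar_simps[OF e])
  also have "\<dots> = (\<Sum>x\<in>S. \<Sum>z\<in>UNIV. if z - x \<in> S then e (v * z) else 0)"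
  proof (rule sum.cong[OF refl])
    fix x
    have "(\<Sum>z\<in>UNIV. if z - x \<in> S then e (v * z) else 0) = (\<Sum>z\<in>{z. z - x \<in> S}. e (v * z))"
      by (simp add: sum.If_cases)
    also have "\<dots> = (\<Sum>y\<in>S. e (v * (x + y)))"
      by (rule sum.reindex_bij_witness[of _ "\<lambda>y. x + y" "\<lambda>z. z - x"]) auto
    finally show "(\<Sum>y\<in>S. e (v * (x + y))) = (\<Sum>z\<in>UNIV. if z - x \<in> S then e (v * z) else 0)" by simp
  qed
  also have "\<dots> = (\<Sum>z\<in>UNIV. \<Sum>x\<in>S. if z - x \<in> S then e (v * z) else 0)" by (rule sum.swap)
  also have "\<dots> = (\<Sum>z\<in>UNIV. of_nat (conv S z) * e (v * z))"
    by (rule sum.cong[OF refl]) (simp add: conv_def sum.If_cases Int_def)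
  finally show ?thesis .
qed

lemma cayley_simps [simp]:
  "pverts (cayley_graph S) = UNIV" "(x, y) \<in> parcs (cayley_graph S) \<longleftrightarrow> x - y \<in> S"
  by (auto simp: cayley_graph_def)

lemma card_common_neighbours:
  assumes "\<And>x. x \<in> S \<Longrightarrow> - x \<in> (S :: 'a::finite_field set)"
  shows "card (common_neighbours (cayley_graph S) x y) = conv S (x - y)"
proof -
  have sym: "- x \<in> S \<longleftrightarrow> x \<in> S" for x using assms[of x] assms[of "- x"] by auto
  have "bij_betw (\<lambda>w. x - w) (common_neighbours (cayley_graph S) x y) {u \<in> S. x - y - u \<in> S}"
  proof (rule bij_betw_byWitness[where f' = "\<lambda>u. x - u"])
    have "x - y - (x - w) \<in> S \<longleftrightarrow> y - w \<in> S" for w using sym[of "y - w"] by simp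
    then show "(\<lambda>w. x - w) ` common_neighbours (cayley_graph S) x y \<subseteq> {u \<in> S. x - y - u \<in> S}"
      by (auto simp: common_neighbours_def)
    have "y - (x - u) \<in> S \<longleftrightarrow> x - y - u \<in> S" for u using sym[of "x - y - u"] by (simp add: algebra_simps)
    then show "(\<lambda>u. x - u) ` {u \<in> S. x - y - u \<in> S} \<subseteq> common_neighbours (cayley_graph S) x y"
      by (auto simp: common_neighbours_def)
  qed auto
  then show ?thesis by (simp add: conv_def bij_betw_same_card)
qed

text \<open>\<open>conv S\<close> is \<open>l\<close> on \<open>S\<close> and \<open>\<mu>\<close>
  on the other nonzero elements, and all character values sum to 0. Squaring the sum
  \<open>s\<close> gives \<open>s ^ 2 = conv S 0 + l * s + \<mu> * (- 1 - s)\<close>, a quadratic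
  equation independent of \<open>v\<close>.\<close>

lemma srg_charsum:
  fixes S :: "'a::finite_field set"
  assumes e: "addchar e" and srg: "strongly_regular (cayley_graph S)"
  shows "\<exists>A B. \<forall>v. v \<noteq> 0 \<longrightarrow> (\<Sum>x\<in>S. e (v * x)) \<in> {A, B}"
proof -
  obtain n k l \<mu> where s: "strongly_regular_with (cayley_graph S) n k l \<mu>"
    using srg by (auto simp: strongly_regular_def)
  have pg: "pair_graph (cayley_graph S)" using s by (simp add: strongly_regular_with_def)
  interpret pair_graph "cayley_graph S" by (rule pg)
  have neg: "- x \<in> S" if "x \<in> S" for x
  proof -
    have "(x, 0) \<in> parcs (cayley_graph S)" using that by simp
    then have "(0, x) \<in> parcs (cayley_graph S)" by (rule arcs_symmetric)
    then show ?thesis by simp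
  qed
  have S0: "0 \<notin> S"
  proof
    assume "0 \<in> S"
    then have "(0, 0) \<in> parcs (cayley_graph S)" by simp
    then show False using pair_no_loops by fastforce
  qed
  have conv_S: "conv S z = l" if "z \<in> S" for z
  proof -
    have "card (common_neighbours (cayley_graph S) z 0) = l"
      using s that unfolding strongly_regular_with_def by simp
    then show ?thesis using card_common_neighbours[of S z 0, OF neg] by simp
  qed
  have conv_N: "conv S z = \<mu>" if "z \<notin> S" "z \<noteq> 0" for z
  proof -
    have "card (common_neighbours (cayley_graph S) z 0) = \<mu>"
      using s that unfolding strongly_regular_with_def by simp
    then show ?thesis using card_common_neighbours[of S z 0, OF neg] by simp
  qed
  define b :: complex where "b = of_nat l - of_nat \<mu>"
  define c :: complex where "c = of_nat (conv S 0) - of_nat \<mu>"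
  define D where "D = csqrt (b\<^sup>2 + 4 * c)"
  have D: "D * D = b\<^sup>2 + 4 * c" by (simp add: D_def flip: power2_eq_square)
  have "(\<Sum>x\<in>S. e (v * x)) \<in> {(b + D) / 2, (b - D) / 2}" if v: "v \<noteq> 0" for v
  proof -
    define s where "s = (\<Sum>x\<in>S. e (v * x))"
    have U: "UNIV = insert 0 (S \<union> (UNIV - insert 0 S))" by auto
    have split: "(\<Sum>z\<in>UNIV. g z) = g 0 + ((\<Sum>z\<in>S. g z) + (\<Sum>z\<in>UNIV - insert 0 S. g z))" for g :: "'a \<Rightarrow> complex"
    proof -
      have "(\<Sum>z\<in>UNIV. g z) = g 0 + (\<Sum>z\<in>S \<union> (UNIV - insert 0 S). g z)"
        by (subst U, rule sum.insert) (use S0 in auto)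
      also have "(\<Sum>z\<in>S \<union> (UNIV - insert 0 S). g z) = (\<Sum>z\<in>S. g z) + (\<Sum>z\<in>UNIV - insert 0 S. g z)"
        by (rule sum.union_disjoint) auto
      finally show ?thesis .
    qed
    define t where "t = (\<Sum>z\<in>UNIV - insert 0 S. e (v * z))"
    have "(\<Sum>z\<in>UNIV. e (v * z)) = 0" using addchar_orth[OF e, of v] v by (simp add: mult.commute)
    then have t: "1 + (s + t) = 0" unfolding split s_def t_def by (simp add: addchar_simps[OF e])
    have "s\<^sup>2 = of_nat (conv S 0) * e (v * 0) + ((\<Sum>z\<in>S. of_nat (conv S z) * e (v * z)) +
        (\<Sum>z\<in>UNIV - insert 0 S. of_nat (conv S z) * e (v * z)))"
      unfolding s_def charsum_square[OF e] by (rule split)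
    also have "(\<Sum>z\<in>S. of_nat (conv S z) * e (v * z)) = of_nat l * s"
      unfolding s_def sum_distrib_left by (rule sum.cong) (auto simp: conv_S)
    also have "(\<Sum>z\<in>UNIV - insert 0 S. of_nat (conv S z) * e (v * z)) = of_nat \<mu> * t"
      unfolding t_def sum_distrib_left by (rule sum.cong) (auto simp: conv_N)
    also have "t = - 1 - s" using t by (simp add: algebra_simps eq_neg_iff_add_eq_0)
    finally have q: "s\<^sup>2 = b * s + c"
      by (simp add: addchar_simps[OF e] b_def c_def algebra_simps)
    have "(s - (b + D) / 2) * (s - (b - D) / 2) = s\<^sup>2 - b * s + (b\<^sup>2 - D * D) / 4"
      by (simp add: field_simps power2_eq_square)
    also have "\<dots> = 0" unfolding q D by (simp add: field_simps)
    finally show ?thesis unfolding s_def[symmetric] by auto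
  qed
  then show ?thesis by blast
qed

text \<open>The two values satisfy one quadratic equation at all \<open>v \<noteq> 0\<close>. By
  Fourier inversion \<open>conv S z\<close> for \<open>z \<noteq> 0\<close> then depends only on
  whether \<open>z \<in> S\<close>.\<close>

lemma charsum_srg:
  fixes S :: "'a::finite_field set"
  assumes e: "addchar e" and S0: "0 \<notin> S" and neg: "\<And>x. x \<in> S \<Longrightarrow> - x \<in> S"
    and two: "\<And>v. v \<noteq> 0 \<Longrightarrow> (\<Sum>x\<in>S. e (v * x)) \<in> {A, B}"
  shows "strongly_regular (cayley_graph S)"
proof -
  define s where "s = (\<lambda>v. \<Sum>x\<in>S. e (v * x))"
  let ?q = "of_nat CARD('a) :: complex"
  have inv: "(\<Sum>v\<in>UNIV. (\<Sum>w\<in>X. g w * e (v * w)) * e (v * (- z))) = ?q * (if z \<in> X then g z else 0)"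
    for g :: "'a \<Rightarrow> complex" and X z
  proof -
    have "(\<Sum>v\<in>UNIV. (\<Sum>w\<in>X. g w * e (v * w)) * e (v * (- z))) =
       (\<Sum>v\<in>UNIV. \<Sum>w\<in>X. g w * e (v * (w - z)))"
      unfolding sum_distrib_right
      by (intro sum.cong refl) (simp add: mult.assoc right_diff_distrib flip: addchar_simps(2)[OF e])
    also have "\<dots> = (\<Sum>w\<in>X. g w * (\<Sum>v\<in>UNIV. e (v * (w - z))))"
      unfolding sum_distrib_left by (rule sum.swap)
    also have "\<dots> = (\<Sum>w\<in>X. if w = z then ?q * g z else 0)"
      unfolding addchar_orth[OF e] by (rule sum.cong[OF refl]) auto
    finally show ?thesis by simp
  qed
  \<comment> \<open>Corrects the quadratic relation at \<open>v = 0\<close>, where the sum is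
    \<open>card S\<close>; under inversion it contributes a constant.\<close>
  define h where "h = (s 0)\<^sup>2 - ((A + B) * s 0 - A * B)"
  have sq: "(s v)\<^sup>2 = (A + B) * s v - A * B + (if v = 0 then h else 0)" for v
    using two[of v] by (cases "v = 0") (auto simp: h_def s_def algebra_simps power2_eq_square)
  have conv: "?q * of_nat (conv S z) = h + (A + B) * (?q * (if z \<in> S then 1 else 0))" if z: "z \<noteq> 0" for z
  proof -
    have "?q * of_nat (conv S z) = (\<Sum>v\<in>UNIV. (s v)\<^sup>2 * e (v * (- z)))"
      unfolding s_def charsum_square[OF e] inv by simp
    also have "\<dots> = (\<Sum>v\<in>UNIV. (A + B) * ((\<Sum>x\<in>S. 1 * e (v * x)) * e (v * (- z))) - A * B * e (v * (- z))
        + (if v = 0 then h else 0))"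
      unfolding sq
      by (rule sum.cong[OF refl]) (simp add: s_def addchar_simps[OF e] algebra_simps)
    also have "\<dots> = (A + B) * (\<Sum>v\<in>UNIV. (\<Sum>x\<in>S. 1 * e (v * x)) * e (v * (- z)))
        - A * B * (\<Sum>v\<in>UNIV. e (v * (- z))) + h"
      by (simp only: sum.distrib sum_subtractf sum_distrib_left[symmetric]) simp
    also have "\<dots> = h + (A + B) * (?q * (if z \<in> S then 1 else 0))"
      unfolding inv addchar_orth[OF e] using z by simp
    finally show ?thesis .
  qed
  have q0: "?q \<noteq> 0" by simp
  have same: "conv S z = conv S z'" if "z \<noteq> 0" "z' \<noteq> 0" "z \<in> S \<longleftrightarrow> z' \<in> S" for z z'
  proof -
    have "?q * of_nat (conv S z) = ?q * of_nat (conv S z')" using conv that by simp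
    then show ?thesis using q0 by simp
  qed
  have "\<exists>l. \<forall>z\<in>S. conv S z = l"
    using same S0 by (cases "S = {}") (auto, metis)
  then obtain l where l: "\<And>z. z \<in> S \<Longrightarrow> conv S z = l" by blast
  have "\<exists>\<mu>. \<forall>z. z \<notin> S \<and> z \<noteq> 0 \<longrightarrow> conv S z = \<mu>"
    using same by (cases "\<exists>z. z \<notin> S \<and> z \<noteq> 0") (metis, blast)
  then obtain \<mu> where mu: "\<And>z. z \<notin> S \<Longrightarrow> z \<noteq> 0 \<Longrightarrow> conv S z = \<mu>" by blast
  have pg: "pair_graph (cayley_graph S)"
  proof
    show "finite (pverts (cayley_graph S))" by simp
    show "finite (parcs (cayley_graph S))" by (rule finite_subset[of _ UNIV]) auto
    show "symmetric (with_proj (cayley_graph S))"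
      unfolding symmetric_def sym_def
    proof (intro allI impI)
      fix x y assume "(x, y) \<in> arcs_ends (with_proj (cayley_graph S))"
      then have "x - y \<in> S" by (auto simp: arcs_ends_def arc_to_ends_def)
      then have "y - x \<in> S" using neg[of "x - y"] by simp
      then show "(y, x) \<in> arcs_ends (with_proj (cayley_graph S))"
        by (force simp: arcs_ends_def arc_to_ends_def)
    qed
  next
    fix a assume "a \<in> parcs (cayley_graph S)"
    then show "fst a \<noteq> snd a" using S0 by (cases a) auto
  qed auto
  have deg: "card {y. x - y \<in> S} = card S" for x
  proof -
    have "bij_betw (\<lambda>y. x - y) {y. x - y \<in> S} S"
      by (rule bij_betw_byWitness[where f' = "\<lambda>y. x - y"]) auto
    then show ?thesis by (rule bij_betw_same_card)
  qed
  have "strongly_regular_with (cayley_graph S) CARD('a) (card S) l \<mu>"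
    unfolding strongly_regular_with_def
    using pg deg card_common_neighbours[OF neg] l mu by simp
  then show ?thesis unfolding strongly_regular_def by blast
qed

section \<open>The index of a cyclic subgroup and the order of its generator\<close>

text \<open>\<open>t\<close> is the order of \<open>p\<close> modulo \<open>n\<close>; Lagrange's
  theorem relates it to the number of cosets.\<close>

lemma unit_index_order:
  assumes n: "n > 1" and cop: "coprime p n"
  shows "\<exists>t. unit_index n p * t = totient n \<and> (\<forall>s. n dvd p ^ s - 1 \<longleftrightarrow> t dvd s)"
proof -
  interpret R: residues "int n" "residue_ring (int n)" using n by unfold_locales auto
  define U where "U = units_of (residue_ring (int n))"
  interpret U: comm_group U unfolding U_def by (rule R.units_comm_group)
  define a where "a = int p mod int n"
  have carr: "carrier U = Units (residue_ring (int n))" by (simp add: U_def units_of_carrier)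
  have a: "a \<in> carrier U" unfolding carr a_def
    using cop n by (intro R.mod_in_res_units) (auto simp: coprime_commute)
  have fin: "finite (carrier U)" unfolding carr by (rule R.finite_Units)
  have "card (rcosets\<^bsub>U\<^esub> (generate U {a})) * card (generate U {a}) = Coset.order U"
    by (rule U.lagrange_finite[OF fin U.generate_is_subgroup]) (use a in auto)
  moreover have "Coset.order U = totient n" unfolding Coset.order_def carr using R.totient_eq by simp
  moreover have "unit_index n p = card (rcosets\<^bsub>U\<^esub> (generate U {a}))"
    by (simp add: unit_index_def U_def a_def Let_def)
  moreover have "card (generate U {a}) = U.ord a" using U.generate_pow_card[OF a] by simp
  ultimately have 1: "unit_index n p * U.ord a = totient n" by simp
  have 2: "n dvd p ^ s - 1 \<longleftrightarrow> U.ord a dvd s" for s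
  proof -
    have p: "p ^ s \<ge> 1" using cop n by (cases "p = 0") auto
    have "a [^]\<^bsub>U\<^esub> s = a [^]\<^bsub>residue_ring (int n)\<^esub> s"
      using a carr unfolding U_def by (intro R.units_of_pow) simp
    also have "\<dots> = int p ^ s mod int n" unfolding a_def by (rule R.pow_cong)
    finally have apow: "a [^]\<^bsub>U\<^esub> s = int p ^ s mod int n" .
    have one: "\<one>\<^bsub>U\<^esub> = 1" unfolding U_def by (simp add: units_of_one R.res_one_eq)
    have "U.ord a dvd s \<longleftrightarrow> a [^]\<^bsub>U\<^esub> s = \<one>\<^bsub>U\<^esub>" using U.pow_eq_id[OF a] by simp
    also have "\<dots> \<longleftrightarrow> int p ^ s mod int n = 1 mod int n" unfolding apow one using n by simp
    also have "\<dots> \<longleftrightarrow> int n dvd int (p ^ s - 1)" using p by (simp add: mod_eq_dvd_iff of_nat_diff)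
    also have "\<dots> \<longleftrightarrow> n dvd p ^ s - 1" by (simp only: int_dvd_int_iff)
    finally show ?thesis by simp
  qed
  show ?thesis using 1 2 by blast
qed

section \<open>Embedding a finite field into another one\<close>

text \<open>Integer polynomials can be evaluated in both fields, which carries elements between two
  unrelated types.\<close>

definition int_eval :: "'a::comm_ring_1 \<Rightarrow> int poly \<Rightarrow> 'a" where
  "int_eval x F = poly (of_int_poly F) x"

lemma int_eval_simps:
  "int_eval x (F + G) = int_eval x F + int_eval x G" "int_eval x (F * G) = int_eval x F * int_eval x G"
  "int_eval x (F - G) = int_eval x F - int_eval x G" "int_eval x 1 = 1" "int_eval x 0 = 0"
  "int_eval x (monom c n) = of_int c * x ^ n" "int_eval x (smult c F) = of_int c * int_eval x F"
  by (simp_all add: int_eval_def of_int_poly_hom.hom_add of_int_poly_hom.hom_mult of_int_poly_hom.hom_minus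
    map_poly_monom poly_monom of_int_hom.map_poly_hom_smult)

text \<open>
  The minimal polynomial of \<open>\<gamma>1\<close>, lifted to the integers, has a root in the second field, since it
  divides \<open>t\<^bsup>Q\<^esup> - t\<close> modulo \<open>p\<close>.
\<close>

lemma finite_field_embedding:
  fixes \<gamma>1 :: "'a::finite_field" and p Q :: nat
  assumes prim: "primitive_element \<gamma>1" and chA: "CHAR('a) = p" and chB: "CHAR('b::finite_field) = p"
    and cardA: "CARD('a) = Q" and cardB: "card (Fix Q :: 'b set) = Q"
  shows "\<exists>\<phi> :: 'a \<Rightarrow> 'b. (\<forall>x y. \<phi> (x + y) = \<phi> x + \<phi> y) \<and> (\<forall>x y. \<phi> (x * y) = \<phi> x * \<phi> y) \<and>
    \<phi> 1 = 1 \<and> inj \<phi> \<and> range \<phi> = Fix Q"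
proof -
  have p: "prime p" unfolding chA[symmetric] by (rule prime_CHAR_semidom) (simp add: finite_imp_CHAR_pos)
  have Q1: "Q > 1"
  proof -
    have "card {0, 1 :: 'a} \<le> CARD('a)" by (intro card_mono) auto
    then show ?thesis using cardA by simp
  qed
  have pA: "of_int (int p * c) = (0 :: 'a)" for c using chA by (metis mult_zero_left of_int_mult of_int_of_nat_eq of_nat_CHAR)
  have pB: "of_int (int p * c) = (0 :: 'b)" for c using chB by (metis mult_zero_left of_int_mult of_int_of_nat_eq of_nat_CHAR)
  define I where "I = {F :: int poly. int_eval \<gamma>1 F = 0}"
  define X where "X = monom (1 :: int) Q - monom 1 1"
  have XI: "X \<in> I" using finite_field_power_card_eq_same[of \<gamma>1] cardA by (simp add: I_def X_def int_eval_simps)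
  have cX: "coeff X i = (if i = Q then 1 else if i = 1 then -1 else 0)" for i
    using Q1 by (auto simp: X_def)
  have dX: "degree X = Q"
    by (intro antisym degree_le le_degree) (use Q1 in \<open>auto simp: cX\<close>)
  have lX: "lead_coeff X = 1" unfolding dX cX by simp
  \<comment> \<open>Monic of least degree among the integer polynomials vanishing at
    \<open>\<gamma>1\<close>: a lift of the minimal polynomial.\<close>
  obtain g where g: "g \<in> I" "lead_coeff g = 1"
    and gmin: "\<And>F. F \<in> I \<Longrightarrow> lead_coeff F = 1 \<Longrightarrow> degree g \<le> degree F"
    using ex_has_least_nat[of "\<lambda>F. F \<in> I \<and> lead_coeff F = 1" X degree] XI lX by auto
  have gdeg: "degree g > 0"
  proof (rule ccontr)
    assume "\<not> ?thesis"
    then have "g = 1" using g(2) by (metis degree_0_id lead_coeff_1 neq0_conv of_int_hom.hom_one one_pCons)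
    then show False using g(1) by (simp add: I_def int_eval_simps)
  qed
  \<comment> \<open>The kernel of evaluation is generated by \<open>g\<close> and \<open>p\<close>;
    this makes the map \<open>\<phi>\<close> below well defined.\<close>
  have div: "\<exists>u w. F = g * u + smult (int p) w" if "F \<in> I" for F
    using that
  proof (induction "degree F" arbitrary: F rule: less_induct)
    case less
    define n where "n = degree F"
    define c where "c = lead_coeff F"
    have red: ?case if F': "F' \<in> I" "coeff F' n = 0" "degree F' \<le> n" and e: "F = F' + (g * u0 + smult (int p) w0)" for F' u0 w0
    proof -
      have "\<exists>u w. F' = g * u + smult (int p) w"
      proof (cases "F' = 0")
        case True
        then show ?thesis by (intro exI[of _ 0]) simp
      next
        case False
        then have "degree F' < n" using F' by (metis le_neq_implies_less leading_coeff_0_iff)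
        then show ?thesis using less.hyps F'(1) by (simp add: n_def)
      qed
      then obtain u w where "F' = g * u + smult (int p) w" by blast
      then have "F = g * (u + u0) + smult (int p) (w + w0)" unfolding e by (simp add: algebra_simps smult_add_right)
      then show ?thesis by blast
    qed
    show ?case
    proof (cases "degree g \<le> n")
      case True
      define T where "T = monom c (n - degree g)"
      have dT: "degree (g * T) \<le> n"
        using degree_mult_le[of g T] degree_monom_le[of c "n - degree g"] True by (simp add: T_def)
      have "coeff (g * T) n = c"
        using True g(2) by (simp add: T_def mult.commute[of g] coeff_monom_mult)
      then have "coeff (F - g * T) n = 0" by (simp add: c_def n_def)
      moreover have "F - g * T \<in> I" using less.prems g(1) by (simp add: I_def int_eval_simps)
      moreover have "degree (F - g * T) \<le> n" using dT by (simp add: degree_diff_le n_def)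
      ultimately show ?thesis by (intro red[of "F - g * T" T 0]) simp_all
    next
      case dg: False
      \<comment> \<open>Otherwise \<open>c\<close> is invertible modulo \<open>p\<close>, and
        rescaling gives a monic element of the kernel of smaller degree than
        \<open>g\<close>.\<close>
      have "int p dvd c"
      proof (rule ccontr)
        assume "\<not> int p dvd c"
        then have "coprime (int p) c" using p prime_imp_coprime[of "int p" c] by simp
        then obtain c' where c': "[c * c' = 1] (mod int p)" using cong_solve_coprime_int by (metis coprime_commute)
        define H where "H = smult c' F + monom (1 - c * c') n"
        have "int p dvd 1 - c * c'" using c' by (metis cong_iff_dvd_diff cong_sym)
        then obtain c3 where "1 - c * c' = int p * c3" by blast
        then have z: "of_int (1 - c * c') = (0 :: 'a)" by (simp only: pA)
        have "int_eval \<gamma>1 H = 0" unfolding H_def int_eval_simps z using less.prems by (simp add: I_def)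
        moreover have cH: "coeff H n = 1" by (simp add: H_def c_def n_def mult.commute)
        moreover have "degree H = n"
          by (intro antisym le_degree) (use cH in \<open>auto simp: H_def n_def intro!: degree_add_le degree_smult_le degree_monom_le\<close>)
        ultimately show False using gmin[of H] dg by (simp add: I_def)
      qed
      then obtain c2 where c2: "c = int p * c2" by blast
      define F' where "F' = F - monom c n"
      have zc: "of_int c = (0 :: 'a)" unfolding c2 by (rule pA)
      have "F' \<in> I" using less.prems by (simp add: I_def F'_def int_eval_simps zc)
      moreover have "coeff F' n = 0" by (simp add: F'_def c_def n_def)
      moreover have "degree F' \<le> n" unfolding F'_def by (intro degree_diff_le degree_monom_le) (simp add: n_def)
      moreover have "F = F' + (g * 0 + smult (int p) (monom c2 n))"
        unfolding F'_def smult_monom c2[symmetric] by simp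
      ultimately show ?thesis by (rule red)
    qed
  qed
  \<comment> \<open>If \<open>g\<close> had no root among the \<open>Q\<close> roots of
    \<open>X\<close>, all of them would be roots of the cofactor \<open>u\<close>, whose degree is
    less than \<open>Q\<close>.\<close>
  have "\<exists>\<delta> \<in> (Fix Q :: 'b set). int_eval \<delta> g = 0"
  proof (rule ccontr)
    assume no: "\<not> ?thesis"
    obtain u w where uw: "X = g * u + smult (int p) w" using div[OF XI] by blast
    have "of_int_poly X = (of_int_poly g * of_int_poly u :: 'b poly)"
    proof -
      have "of_int_poly (smult (int p) w) = (0 :: 'b poly)"
        by (rule poly_eqI) (simp only: coeff_map_poly coeff_smult of_int_0 pB coeff_0)
      then show ?thesis unfolding uw of_int_poly_hom.hom_add of_int_poly_hom.hom_mult by simp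
    qed
    moreover have dXb: "degree (of_int_poly X :: 'b poly) = Q"
    proof (intro antisym le_degree)
      show "degree (of_int_poly X :: 'b poly) \<le> Q" using dX degree_map_poly_le[of of_int X] by metis
      show "coeff (of_int_poly X :: 'b poly) Q \<noteq> 0" by (simp add: coeff_map_poly cX)
    qed
    moreover have dgb: "degree (of_int_poly g :: 'b poly) \<ge> degree g"
      by (rule le_degree) (use g(2) in \<open>simp add: coeff_map_poly\<close>)
    ultimately have u: "of_int_poly u \<noteq> (0 :: 'b poly)" "degree (of_int_poly u :: 'b poly) < Q"
    proof -
      have e: "of_int_poly X = (of_int_poly g * of_int_poly u :: 'b poly)" by fact
      have X0: "of_int_poly X \<noteq> (0 :: 'b poly)" using dXb Q1 by auto
      then show u0: "of_int_poly u \<noteq> (0 :: 'b poly)" using e by auto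
      have g0: "of_int_poly g \<noteq> (0 :: 'b poly)" using e X0 by auto
      have "Q = degree (of_int_poly g :: 'b poly) + degree (of_int_poly u :: 'b poly)"
        using dXb unfolding e by (simp add: degree_mult_eq g0 u0)
      then show "degree (of_int_poly u :: 'b poly) < Q" using dgb gdeg by linarith
    qed
    have "Fix Q \<subseteq> {y :: 'b. poly (of_int_poly u) y = 0}"
    proof
      fix y :: 'b assume y: "y \<in> Fix Q"
      have "int_eval y X = 0" using y by (simp add: X_def int_eval_simps Fix_def)
      then have "int_eval y g * int_eval y u = 0" unfolding uw int_eval_simps using pB[of 1] by simp
      then have "int_eval y u = 0" using no y by auto
      then show "y \<in> {y. poly (of_int_poly u) y = 0}" by (simp add: int_eval_def)
    qed
    then have "card (Fix Q :: 'b set) \<le> card {y :: 'b. poly (of_int_poly u) y = 0}" by (intro card_mono) auto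
    also have "\<dots> \<le> degree (of_int_poly u :: 'b poly)" using u(1) by (rule card_poly_roots_bound)
    finally show False using u(2) cardB by simp
  qed
  then obtain \<delta> :: 'b where del: "\<delta> \<in> Fix Q" "int_eval \<delta> g = 0" by blast
  have ker: "int_eval \<delta> F = 0" if F: "F \<in> I" for F
  proof -
    obtain u w where "F = g * u + smult (int p) w" using div[OF F] by blast
    then show ?thesis using del(2) pB[of 1] by (simp add: int_eval_simps)
  qed
  have surj: "\<exists>F. int_eval \<gamma>1 F = x" for x
  proof (cases "x = 0")
    case False
    then obtain j :: int where j: "x = \<gamma>1 powi j" using prim unfolding primitive_element_def by blast
    have g0: "\<gamma>1 ^ Q = \<gamma>1" using finite_field_power_card_eq_same[of \<gamma>1] cardA by simp
    show ?thesis
    proof (cases "j \<ge> 0")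
      case True
      then have "x = int_eval \<gamma>1 (monom 1 (nat j))" by (simp add: j int_eval_simps power_int_def)
      then show ?thesis by blast
    next
      case neg: False
      have "\<gamma>1 \<noteq> 0"
      proof
        assume "\<gamma>1 = 0" then have "x = 0" using j neg by (simp add: power_int_def)
        then show False using False by simp
      qed
      moreover obtain n where n: "Q = Suc (Suc n)" using Q1 less_imp_Suc_add[of 1 Q] by auto
      ultimately have "\<gamma>1 ^ (Q - 2) * \<gamma>1 = 1" using g0 by (simp add: mult.commute)
      then have "inverse \<gamma>1 = \<gamma>1 ^ (Q - 2)" by (metis inverse_unique mult.commute)
      then have "x = int_eval \<gamma>1 (monom 1 ((Q - 2) * nat (- j)))"
        using neg by (simp add: j int_eval_simps power_int_def power_mult)
      then show ?thesis by blast
    qed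
  qed (auto intro: exI[of _ 0] simp: int_eval_simps)
  define \<phi> where "\<phi> = (\<lambda>x. int_eval \<delta> (SOME F. int_eval \<gamma>1 F = x))"
  have phi: "\<phi> (int_eval \<gamma>1 F) = int_eval \<delta> F" for F
  proof -
    define G where "G = (SOME G. int_eval \<gamma>1 G = int_eval \<gamma>1 F)"
    have "int_eval \<gamma>1 G = int_eval \<gamma>1 F" unfolding G_def by (rule someI[of _ F]) simp
    then have "G - F \<in> I" by (simp add: I_def int_eval_simps)
    then have "int_eval \<delta> (G - F) = 0" by (rule ker)
    then show ?thesis by (simp add: \<phi>_def G_def int_eval_simps)
  qed
  have add: "\<phi> (x + y) = \<phi> x + \<phi> y" and mult: "\<phi> (x * y) = \<phi> x * \<phi> y" for x y
  proof -
    obtain F G where FG: "x = int_eval \<gamma>1 F" "y = int_eval \<gamma>1 G" using surj by metis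
    show "\<phi> (x + y) = \<phi> x + \<phi> y" by (simp only: FG phi flip: int_eval_simps(1))
    show "\<phi> (x * y) = \<phi> x * \<phi> y" by (simp only: FG phi flip: int_eval_simps(2))
  qed
  have one: "\<phi> 1 = 1" using phi[of 1] by (simp add: int_eval_simps)
  have nz: "\<phi> x \<noteq> 0" if "x \<noteq> 0" for x
    using mult[of x "inverse x"] one that by auto
  have inj: "inj \<phi>"
  proof
    fix x y assume e: "\<phi> x = \<phi> y"
    have "\<phi> x = \<phi> (x - y) + \<phi> y" using add[of "x - y" y] by simp
    then show "x = y" using nz[of "x - y"] e by auto
  qed
  have pow: "\<phi> (x ^ n) = \<phi> x ^ n" for x n by (induction n) (simp_all add: one mult)
  have "range \<phi> = Fix Q"
  proof (rule card_subset_eq)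
    show "range \<phi> \<subseteq> Fix Q"
    proof
      fix y assume "y \<in> range \<phi>"
      then obtain x where x: "y = \<phi> x" by blast
      have "y ^ Q = \<phi> (x ^ Q)" by (simp add: x pow)
      also have "x ^ Q = x" using finite_field_power_card_eq_same[of x] cardA by simp
      finally show "y \<in> Fix Q" by (simp add: x Fix_def)
    qed
    show "card (range \<phi>) = card (Fix Q :: 'b set)" using inj cardA cardB by (simp add: card_image)
  qed simp
  then show ?thesis using add mult one inj by blast
qed

section \<open>Transfer of the two-value property from the subfield to the large field\<close>

context tower
begin

lemma addchar_psi: "addchar (psi f)"
  unfolding addchar_def
proof (intro conjI allI)
  show "psi f 0 = 1" by simp
  show "psi f (x + y) = psi f x * psi f y" for x y using Fix_f by (intro psi_add) auto
  show "\<exists>x. psi f x \<noteq> 1" using psi_nontrivial[of f] by auto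
qed

lemma Dset_nz: "0 \<notin> Dset a"
  by (simp add: Dset_def)

lemma Dset_shift: "(\<lambda>x. \<gamma> ^ a * x) ` Dset 0 = Dset a"
proof -
  have mem: "\<gamma> ^ i \<in> Dset b \<longleftrightarrow> (\<exists>t\<in>shifts. [i = b + shift_of t] (mod k))" for i b
  proof -
    have "[dlog (\<gamma> ^ i) = x] (mod k) \<longleftrightarrow> [i = x] (mod k)" for x
      using dlog_gamma[of i] by (simp add: cong_def)
    then show ?thesis using gamma_nz by (simp add: Dset_def)
  qed
  have shift: "\<gamma> ^ (a + i) \<in> Dset a \<longleftrightarrow> \<gamma> ^ i \<in> Dset 0" for i
    unfolding mem by (simp add: add.assoc cong_add_lcancel_nat)
  show ?thesis
  proof (intro equalityI subsetI)
    fix y assume "y \<in> (\<lambda>x. \<gamma> ^ a * x) ` Dset 0"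
    then obtain x where x: "x \<in> Dset 0" "y = \<gamma> ^ a * x" by blast
    then have "x \<noteq> 0" using Dset_nz by metis
    then obtain i where "x = \<gamma> ^ i" using gamma_exists by blast
    then show "y \<in> Dset a" using x shift by (simp add: power_add)
  next
    fix y assume y: "y \<in> Dset a"
    have "y / \<gamma> ^ a \<noteq> 0" using y Dset_nz gamma_nz by auto
    then obtain i where i: "y / \<gamma> ^ a = \<gamma> ^ i" using gamma_exists by blast
    then have "y = \<gamma> ^ (a + i)" using gamma_nz by (simp add: power_add field_simps)
    then have "\<gamma> ^ i \<in> Dset 0" using y shift by simp
    moreover have "y = \<gamma> ^ a * \<gamma> ^ i" using i gamma_nz by (simp add: field_simps)
    ultimately show "y \<in> (\<lambda>x. \<gamma> ^ a * x) ` Dset 0" by blast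
  qed
qed

text \<open>-1 lies in the prime field and is therefore a \<open>k\<close>-th power.\<close>

lemma Dset_minus:
  assumes "x \<in> Dset 0" shows "- x \<in> Dset 0"
proof -
  have "chi 1 (-1) = 1"
    using subfield_set.uminus_K[OF subfield_Fix[of 1], of 1] subfield_set.one_K[OF subfield_Fix[of 1]]
    by (intro chi_prime_field) simp
  then have m1: "k dvd dlog (-1)" by (simp add: chi_def zk_eq_1)
  have x0: "x \<noteq> 0" using assms Dset_nz by metis
  have "- x = \<gamma> ^ (dlog (-1) + dlog x)" using dlog[of "-1"] dlog[OF x0] by (simp add: power_add)
  then have "[dlog (- x) = dlog (-1) + dlog x] (mod k)" using dlog_gamma by metis
  also have "[dlog (-1) + dlog x = 0 + dlog x] (mod k)"
    using m1 by (intro cong_add cong_refl) (simp add: cong_0_iff)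
  finally have c: "[dlog (- x) = dlog x] (mod k)" by simp
  obtain t where "t \<in> shifts" "[dlog x = 0 + shift_of t] (mod k)" using assms by (auto simp: Dset_def)
  then show ?thesis using x0 c by (auto simp: Dset_def intro: cong_trans)
qed

lemma Dset_cyclotomic: "Dset 0 = (\<Union>t\<in>shifts. cyclotomic_class \<gamma> k (shift_of t))"
proof -
  have rng: "range (\<lambda>j::int. (\<gamma> ^ k) powi j) = (\<lambda>y. y ^ k) ` (UNIV - {0})"
  proof -
    have "(\<gamma> ^ k) powi j = (\<gamma> powi j) ^ k" for j by (simp add: power_int_power' power_int_power mult.commute)
    then have "range (\<lambda>j::int. (\<gamma> ^ k) powi j) = (\<lambda>y. y ^ k) ` range (\<lambda>j::int. \<gamma> powi j)" by auto
    then show ?thesis using prim by (simp add: primitive_element_def)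
  qed
  have "x \<in> Dset 0 \<longleftrightarrow> (\<exists>t\<in>shifts. x \<in> cyclotomic_class \<gamma> k (shift_of t))" for x
  proof
    assume x: "x \<in> Dset 0"
    then obtain t where t: "t \<in> shifts" "[dlog x = shift_of t] (mod k)" by (auto simp: Dset_def)
    have x0: "x \<noteq> 0" using x Dset_nz by metis
    obtain s2 s1 where "shift_of t + s2 * k = dlog x + s1 * k"
      using t(2) unfolding cong_iff_lin_nat by blast
    then have s: "dlog x + s1 * k = shift_of t + s2 * k" by simp
    have "x * (\<gamma> ^ s1) ^ k = \<gamma> ^ (dlog x + s1 * k)" using dlog[OF x0] by (simp add: power_add power_mult)
    also have "\<dots> = \<gamma> ^ shift_of t * (\<gamma> ^ s2) ^ k" unfolding s by (simp add: power_add power_mult)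
    finally have "x = \<gamma> ^ shift_of t * (\<gamma> ^ s2 / \<gamma> ^ s1) ^ k" using gamma_nz by (simp add: field_simps)
    moreover have "\<gamma> ^ s2 / \<gamma> ^ s1 \<in> UNIV - {0}" using gamma_nz by simp
    ultimately have "x \<in> cyclotomic_class \<gamma> k (shift_of t)" unfolding cyclotomic_class_def rng by blast
    then show "\<exists>t\<in>shifts. x \<in> cyclotomic_class \<gamma> k (shift_of t)" using t(1) by blast
  next
    assume "\<exists>t\<in>shifts. x \<in> cyclotomic_class \<gamma> k (shift_of t)"
    then obtain t y where t: "t \<in> shifts" "y \<noteq> 0" "x = \<gamma> ^ shift_of t * y ^ k"
      unfolding cyclotomic_class_def rng by blast
    obtain i where "y = \<gamma> ^ i" using gamma_exists[OF t(2)] by blast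
    then have x: "x = \<gamma> ^ (shift_of t + i * k)" using t(3) by (simp add: power_add power_mult)
    then have "[dlog x = shift_of t + i * k] (mod k)" using dlog_gamma by simp
    then have "[dlog x = shift_of t] (mod k)" by (simp add: cong_def)
    then show "x \<in> Dset 0" using t(1) x gamma_nz by (auto simp: Dset_def)
  qed
  then show ?thesis by blast
qed

lemma two_values_lift:
  assumes two: "\<And>v. v \<in> Fix (p ^ d) - {0} \<Longrightarrow>
    (\<Sum>x\<in>(\<lambda>y. v * y ^ h) ` (Fix (p ^ d) - {0}). psi d x) \<in> {A, B}"
  shows "strongly_regular (cayley_graph (Dset 0))"
proof -
  define C :: complex where "C = of_nat ((p ^ d) ^ ((M - 1) div 2))"
  show ?thesis
  proof (rule charsum_srg[OF addchar_psi Dset_nz Dset_minus])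
    fix u :: 'b assume u: "u \<noteq> 0"
    then obtain a where a: "u = \<gamma> ^ a" using gamma_exists by blast
    have "(\<Sum>x\<in>Dset 0. psi f (u * x)) = (\<Sum>x\<in>(\<lambda>x. u * x) ` Dset 0. psi f x)"
      by (subst sum.reindex) (use u in \<open>auto simp: inj_on_def\<close>)
    also have "\<dots> = (\<Sum>x\<in>Dset a. psi f x)" unfolding a Dset_shift ..
    also have "\<dots> = C * (\<Sum>x\<in>Fix (p ^ d) \<inter> Dset a. psi d x) + (C - 1) / of_nat h"
      unfolding C_def by (rule sum_Dset_relative)
    finally have e: "(\<Sum>x\<in>Dset 0. psi f (u * x)) = \<dots>" .
    obtain x0 where "x0 \<in> Fix (p ^ d) - {0}"
      "Fix (p ^ d) \<inter> Dset a = (\<lambda>y. x0 * y ^ h) ` (Fix (p ^ d) - {0})" using Dset_coset by blast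
    then have "(\<Sum>x\<in>Fix (p ^ d) \<inter> Dset a. psi d x) \<in> {A, B}" using two by simp
    then show "(\<Sum>x\<in>Dset 0. psi f (u * x)) \<in> {C * A + (C - 1) / of_nat h, C * B + (C - 1) / of_nat h}"
      unfolding e by auto
  qed
qed

text \<open>Class 0 consists of the nonzero \<open>h\<close>-th powers whatever
  \<open>\<gamma>1\<close> is, so an arbitrary embedding \<open>\<phi>\<close> carries it to the
  \<open>h\<close>-th powers of the subfield.\<close>

lemma srg_lift:
  fixes \<gamma>1 :: "'a::finite_field"
  assumes prim1: "primitive_element \<gamma>1" and card_a: "CARD('a) = p ^ d"
    and srg: "strongly_regular (cayley_graph (cyclotomic_class \<gamma>1 h 0))"
  shows "strongly_regular (cayley_graph (Dset 0))"
proof -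
  interpret A: prim_field \<gamma>1 p d by unfold_locales (use prim1 p_prime card_a in auto)
  obtain \<phi> :: "'a \<Rightarrow> 'b" where phi: "\<And>x y. \<phi> (x + y) = \<phi> x + \<phi> y" "\<And>x y. \<phi> (x * y) = \<phi> x * \<phi> y"
    "\<phi> 1 = 1" "inj \<phi>" "range \<phi> = Fix (p ^ d)"
    using finite_field_embedding[OF prim1 A.char_p char_p card_a card_Fix[OF d_dvd]] by blast
  have "\<phi> 0 + 0 = \<phi> 0 + \<phi> 0" using phi(1)[of 0 0] by (metis add.right_neutral)
  then have zero: "\<phi> 0 = 0" unfolding add_left_cancel by (rule sym)
  have nz: "\<phi> x = 0 \<longleftrightarrow> x = 0" for x using inj_eq[OF phi(4), of x 0] zero by simp
  have pow: "\<phi> (x ^ n) = \<phi> x ^ n" for x n by (induction n) (simp_all add: phi)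
  have im: "\<phi> ` (UNIV - {0}) = Fix (p ^ d) - {0}" using phi(5) nz by (auto simp: image_iff)
  have e: "addchar (\<lambda>x. psi d (\<phi> x))"
    unfolding addchar_def
  proof (intro conjI allI)
    show "psi d (\<phi> 0) = 1" by (simp add: zero)
    show "psi d (\<phi> (x + y)) = psi d (\<phi> x) * psi d (\<phi> y)" for x y
      unfolding phi(1) using phi(5) by (intro psi_add) auto
    obtain y where "y \<in> Fix (p ^ d)" "psi d y \<noteq> 1" using psi_nontrivial[OF d_dvd] by auto
    then show "\<exists>x. psi d (\<phi> x) \<noteq> 1" using phi(5) by (metis imageE)
  qed
  obtain V1 V2 where V: "\<And>v. v \<noteq> 0 \<Longrightarrow> (\<Sum>x\<in>cyclotomic_class \<gamma>1 h 0. psi d (\<phi> (v * x))) \<in> {V1, V2}"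
    using srg_charsum[OF e srg] by blast
  have cyc: "cyclotomic_class \<gamma>1 h 0 = (\<lambda>y. y ^ h) ` (UNIV - {0})"
  proof -
    have "(\<gamma>1 ^ h) powi j = (\<gamma>1 powi j) ^ h" for j by (simp add: power_int_power' power_int_power mult.commute)
    then have "range (\<lambda>j::int. (\<gamma>1 ^ h) powi j) = (\<lambda>y. y ^ h) ` range (\<lambda>j::int. \<gamma>1 powi j)" by auto
    then show ?thesis using prim1 by (simp add: primitive_element_def cyclotomic_class_def)
  qed
  show ?thesis
  proof (rule two_values_lift)
    fix v :: 'b assume "v \<in> Fix (p ^ d) - {0}"
    then obtain v' where v': "v = \<phi> v'" "v' \<noteq> 0" using im by (metis DiffD2 imageE insertI1)
    have "(\<lambda>y. v * y ^ h) ` (Fix (p ^ d) - {0}) = (\<lambda>x. \<phi> (v' * x)) ` cyclotomic_class \<gamma>1 h 0"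
      unfolding cyc im[symmetric] image_image by (simp add: v' phi pow)
    moreover have "inj_on (\<lambda>x. \<phi> (v' * x)) (cyclotomic_class \<gamma>1 h 0)"
      using v'(2) by (auto simp: inj_on_def dest: injD[OF phi(4)])
    ultimately have "(\<Sum>x\<in>(\<lambda>y. v * y ^ h) ` (Fix (p ^ d) - {0}). psi d x) =
        (\<Sum>x\<in>cyclotomic_class \<gamma>1 h 0. psi d (\<phi> (v' * x)))" by (simp add: sum.reindex)
    then show "(\<Sum>x\<in>(\<lambda>y. v * y ^ h) ` (Fix (p ^ d) - {0}). psi d x) \<in> {V1, V2}"
      using V[OF v'(2)] by simp
  qed
qed

end

section \<open>From the hypotheses on indices to the tower\<close>

text \<open>\<open>totient n / n\<close> depends only on the primes dividing
  \<open>n\<close>.\<close>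

lemma totient_mult_radical:
  fixes n T :: nat
  assumes "n > 0" "T > 0" "\<And>r. prime r \<Longrightarrow> r dvd T \<Longrightarrow> r dvd n"
  shows "totient (n * T) = totient n * T"
proof -
  have "prime_factors (n * T) = prime_factors n"
    using assms by (auto simp: prime_factors_dvd prime_dvd_mult_iff)
  then have "real (totient (n * T)) = real (totient n * T)"
    by (simp add: totient_formula2)
  then show ?thesis by (simp only: of_nat_eq_iff)
qed

theorem theorem3p3:
  fixes P ex n hh :: "nat \<Rightarrow> nat"
    and l m p h k e d f q1 q :: nat
    and \<gamma>1 :: "'a::finite_field" and \<gamma> :: "'b::finite_field"
    and D :: "'b set"
  assumes P_prime: "\<forall>i\<in>{1..l}. prime (P i) \<and> odd (P i)"
    and P_distinct: "inj_on P {1..l}"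
    and h_def: "h = (\<Prod>i\<in>{1..l}. P i)"
    and m_range: "1 \<le> m" "m \<le> l"
    and p_prime: "prime p"
    and p_not_dvd: "\<not> p dvd h"
    and gcd_h: "gcd h (p - 1) = 1"
    and index_stable: "\<forall>I u x. I \<subseteq> {1..l} \<and> I \<noteq> {} \<and> unit_index (\<Prod>i\<in>I. P i) p = u \<and>
            (\<forall>i\<in>I. x i \<ge> (1::nat)) \<longrightarrow>
          unit_index (\<Prod>i\<in>I. P i ^ x i) p = u"
    and e_def: "e = unit_index h p"
    and ex_pos: "\<forall>i\<in>{1..m}. ex i \<ge> 1"
    and ex_one: "\<forall>i\<in>{m+1..l}. ex i = 1"
    and k_def: "k = (\<Prod>i\<in>{1..m}. P i ^ ex i) * (\<Prod>i\<in>{m+1..l}. P i)"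
    and index_k: "unit_index k p = e"
    and d_def: "d = totient h div e"
    and f_def: "f = totient k div e"
    and q1_def: "q1 = p ^ d"
    and q_def: "q = p ^ f"
    and hh_def: "\<forall>j\<in>{1..m}. hh j = (\<Prod>i\<in>{1..l} - {j}. P i)"
    and minus_one: "\<forall>j\<in>{1..m}. \<exists>s::nat. [int p ^ s = - 1] (mod int (hh j))"
    and n_def: "\<forall>j\<in>{1..m}. n j = (\<Prod>i\<in>{1..l} - {j}. P i ^ ex i)"
    and card_a: "CARD('a) = q1"
    and card_b: "CARD('b) = q"
    and prim1: "primitive_element \<gamma>1"
    and prim: "primitive_element \<gamma>"
    and D_def: "D = (\<Union>t \<in> (\<Pi>\<^sub>E j\<in>{1..m}. {0..P j ^ (ex j - 1) - 1}).
          cyclotomic_class \<gamma> k (\<Sum>j\<in>{1..m}. t j * n j))"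
    and srg: "strongly_regular (cayley_graph (cyclotomic_class \<gamma>1 h 0))"
  shows "strongly_regular (cayley_graph D)"
proof -
  define M where "M = (\<Prod>i\<in>{1..l}. P i ^ (ex i - 1))"
  have Pp: "prime (P i)" "odd (P i)" if "i \<in> {1..l}" for i using P_prime that by blast+
  have exp: "ex i \<ge> 1" if "i \<in> {1..l}" for i
    using that ex_pos ex_one by (cases "i \<le> m") auto
  have P2: "P i > 1" if "i \<in> {1..l}" for i using Pp(1)[OF that] by (rule prime_gt_1_nat)
  have kk: "k = (\<Prod>i\<in>{1..l}. P i ^ ex i)"
  proof -
    have "{1..l} = {1..m} \<union> {m+1..l}" using m_range by auto
    then have "(\<Prod>i\<in>{1..l}. P i ^ ex i) = (\<Prod>i\<in>{1..m}. P i ^ ex i) * (\<Prod>i\<in>{m+1..l}. P i ^ ex i)"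
      by (simp only:) (rule prod.union_disjoint; auto)
    also have "(\<Prod>i\<in>{m+1..l}. P i ^ ex i) = (\<Prod>i\<in>{m+1..l}. P i)"
      by (rule prod.cong) (use ex_one in auto)
    finally show ?thesis using k_def by simp
  qed
  have kM: "k = h * M"
  proof -
    have "P i ^ ex i = P i * P i ^ (ex i - 1)" if "i \<in> {1..l}" for i
      using exp[OF that] by (simp flip: power_Suc)
    then show ?thesis unfolding kk h_def M_def by (simp flip: prod.distrib)
  qed
  have Pi_dvd_h: "P i dvd h" if "i \<in> {1..l}" for i unfolding h_def by (rule dvd_prodI) (use that in auto)
  have h0: "h > 0" unfolding h_def using P2 by (intro prod_pos) (metis gr_implies_not0 gr0I)
  have M0: "M > 0" unfolding M_def using P2 by (intro prod_pos) (metis gr_implies_not0 gr0I power_eq_0_iff)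
  have k0: "k > 0" using kM h0 M0 by simp
  have one: "1 \<in> {1..l}" using m_range by auto
  have h1: "h > 1" using P2[OF one] dvd_imp_le[OF Pi_dvd_h[OF one] h0] by linarith
  have k1: "k > 1" using h1 kM M0 by (metis dvd_imp_le dvd_triv_left k0 less_le_trans)
  have primes_k: "r dvd h" if r: "prime r" "r dvd (\<Prod>i\<in>{1..l}. P i ^ x i)" for r and x :: "nat \<Rightarrow> nat"
  proof -
    obtain i where i: "i \<in> {1..l}" "r dvd P i ^ x i"
      using r prime_dvd_prod_iff[of "{1..l}" r "\<lambda>i. P i ^ x i"] by auto
    then have "r dvd P i" using r(1) prime_dvd_power by blast
    then show ?thesis using Pi_dvd_h[OF i(1)] dvd_trans by blast
  qed
  have cop: "coprime p n'" if "\<And>r. prime r \<Longrightarrow> r dvd n' \<Longrightarrow> r dvd h" for n'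
  proof -
    have "\<not> p dvd n'" using that p_prime p_not_dvd by blast
    then show ?thesis by (rule prime_imp_coprime[OF p_prime])
  qed
  have primes_M: "r dvd h" if "prime r" "r dvd M" for r
    by (rule primes_k[OF that(1), of "\<lambda>i. ex i - 1"]) (use that(2) in \<open>simp add: M_def\<close>)
  have tot_k: "totient k = totient h * M" unfolding kM by (rule totient_mult_radical[OF h0 M0 primes_M])
  obtain th where th: "e * th = totient h" "\<And>s. h dvd p ^ s - 1 \<longleftrightarrow> th dvd s"
    using unit_index_order[OF h1 cop] unfolding e_def by blast
  obtain tk where tk: "e * tk = totient k" "\<And>s. k dvd p ^ s - 1 \<longleftrightarrow> tk dvd s"
    using unit_index_order[OF k1 cop] primes_k[of _ ex] unfolding index_k kk[symmetric] by blast
  have e0: "e > 0" using th(1) h0 by (metis mult_0 neq0_conv totient_gt_0_iff)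
  have dth: "d = th" unfolding d_def th(1)[symmetric] using e0 by simp
  have ftk: "f = tk" unfolding f_def tk(1)[symmetric] using e0 by simp
  \<comment> \<open>Equal indices turn \<open>totient k = totient h * M\<close> into the same
    relation between the orders of \<open>p\<close>.\<close>
  have fdM: "f = d * M"
  proof -
    have "e * tk = e * (th * M)" using tk(1) th(1) tot_k by (simp add: mult.assoc)
    then show ?thesis using e0 dth ftk by simp
  qed
  have f0: "f > 0" using ftk tk(1) k0 by (metis mult_0_right neq0_conv totient_gt_0_iff)
  \<comment> \<open>Raising one exponent by 1 keeps the index \<open>e\<close>, so the order of
    \<open>p\<close> modulo \<open>K = k * P j\<close> is \<open>f * P j\<close>, which cannot
    divide \<open>f\<close>.\<close>
  have no_more: "\<not> P j ^ Suc (ex j) dvd p ^ f - 1" if j: "j \<in> {1..l}" for j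
  proof
    assume dv: "P j ^ Suc (ex j) dvd p ^ f - 1"
    define x where "x = ex(j := Suc (ex j))"
    define K where "K = (\<Prod>i\<in>{1..l}. P i ^ x i)"
    have rem: "(\<Prod>i\<in>{1..l}. P i ^ y i) = P j ^ y j * (\<Prod>i\<in>{1..l} - {j}. P i ^ y i)" for y :: "nat \<Rightarrow> nat"
      by (rule prod.remove) (use j in auto)
    have oth: "(\<Prod>i\<in>{1..l} - {j}. P i ^ x i) = (\<Prod>i\<in>{1..l} - {j}. P i ^ ex i)"
      by (rule prod.cong) (auto simp: x_def)
    have KP: "K = k * P j" unfolding K_def kk rem oth by (simp add: x_def)
    have uK: "unit_index K p = e"
      using index_stable[rule_format, of "{1..l}" e x] one exp
      unfolding K_def e_def h_def by (auto simp: x_def)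
    have K1: "K > 1" using KP k1 P2[OF j] by (metis less_1_mult)
    obtain tK where tK: "e * tK = totient K" "\<And>s. K dvd p ^ s - 1 \<longleftrightarrow> tK dvd s"
      using unit_index_order[OF K1 cop] primes_k[of _ x] unfolding uK K_def[symmetric] by blast
    have "totient K = totient k * P j" unfolding KP
    proof (rule totient_mult_radical[OF k0])
      show "P j > 0" using P2[OF j] by simp
      fix r assume "prime r" "r dvd P j"
      then have "r dvd h" using Pi_dvd_h[OF j] dvd_trans by blast
      then show "r dvd k" unfolding kM by simp
    qed
    then have "e * tK = e * (tk * P j)" using tK(1) tk(1) by (simp add: mult.assoc)
    then have tKf: "tK = f * P j" using e0 ftk by simp
    have "K dvd p ^ f - 1" unfolding K_def
    proof (rule coprime_prod_dvd)
      fix i i' assume ii': "i \<in> {1..l}" "i' \<in> {1..l}" "i \<noteq> i'"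
      then have "P i \<noteq> P i'" using P_distinct by (auto dest: inj_onD)
      then have "coprime (P i) (P i')" using primes_coprime[OF Pp(1)[OF ii'(1)] Pp(1)[OF ii'(2)]] by simp
      then show "coprime (P i ^ x i) (P i' ^ x i')" by simp
    next
      fix i assume i: "i \<in> {1..l}"
      show "P i ^ x i dvd p ^ f - 1"
      proof (cases "i = j")
        case False
        have "P i ^ ex i dvd k" unfolding kk by (rule dvd_prodI) (use i in auto)
        also have "k dvd p ^ f - 1" using tk(2) ftk by simp
        finally show ?thesis using False by (simp add: x_def)
      qed (use dv in \<open>simp add: x_def\<close>)
    qed simp
    then have "f * P j dvd f" using tK(2) tKf by simp
    then have "f * P j \<le> f" using f0 by (rule dvd_imp_le)
    then show False using P2[OF j] f0 by simp
  qed
  have n_eq: "n j = k div P j ^ ex j" "n j = hh j * (\<Prod>i\<in>{1..l} - {j}. P i ^ (ex i - 1))" if j: "j \<in> {1..m}" for j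
  proof -
    have jl: "j \<in> {1..l}" using j m_range by auto
    have "k = P j ^ ex j * n j" unfolding kk n_def[rule_format, OF j]
      by (rule prod.remove) (use jl in auto)
    then show "n j = k div P j ^ ex j" using P2[OF jl] by simp
    have "P i ^ ex i = P i * P i ^ (ex i - 1)" if "i \<in> {1..l} - {j}" for i
      using exp[of i] that by (simp flip: power_Suc)
    then show "n j = hh j * (\<Prod>i\<in>{1..l} - {j}. P i ^ (ex i - 1))"
      unfolding n_def[rule_format, OF j] hh_def[rule_format, OF j] by (simp flip: prod.distrib)
  qed
  have "tower \<gamma> p f P ex l m d h k M"
  proof unfold_locales
    show "primitive_element \<gamma>" by (rule prim)
    show "prime p" by (rule p_prime)
    show "CARD('b) = p ^ f" using card_b q_def by simp
    show "prime (P i)" "odd (P i)" "ex i \<ge> 1" "\<not> P i ^ Suc (ex i) dvd p ^ f - 1" if "i \<in> {1..l}" for i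
      using Pp exp no_more that by blast+
    show "inj_on P {1..l}" by (rule P_distinct)
    show "h = (\<Prod>i\<in>{1..l}. P i)" by (rule h_def)
    show "k = (\<Prod>i\<in>{1..l}. P i ^ ex i)" by (rule kk)
    show "M = (\<Prod>i\<in>{1..l}. P i ^ (ex i - 1))" by (rule M_def)
    show "f = d * M" by (rule fdM)
    show "h dvd p ^ d - 1" using th(2) dth by simp
    show "m \<le> l" by (rule m_range)
    show "ex i = 1" if "i \<in> {m+1..l}" for i using ex_one that by blast
    show "\<not> P i dvd p - 1" if "i \<in> {1..l}" for i
    proof
      assume "P i dvd p - 1"
      then have "P i dvd gcd h (p - 1)" using Pi_dvd_h[OF that] by (rule gcd_greatest[rotated])
      then show False unfolding gcd_h using P2[OF that] by simp
    qed
    show "P i \<noteq> p" if "i \<in> {1..l}" for i using Pi_dvd_h[OF that] p_not_dvd by auto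
    show "\<exists>s. k div P j ^ ex j dvd p ^ s + 1" if j: "j \<in> {1..m}" for j
    proof -
      define T where "T = (\<Prod>i\<in>{1..l} - {j}. P i ^ (ex i - 1))"
      obtain s where s: "[int p ^ s = - 1] (mod int (hh j))" using minus_one j by blast
      have prT: "\<exists>i\<in>{1..l} - {j}. r = P i" if r: "prime r" "r dvd T" for r
      proof -
        have "\<exists>i\<in>{1..l} - {j}. r dvd P i ^ (ex i - 1)"
          using r(2) unfolding T_def prime_dvd_prod_iff[OF finite_Diff[OF finite_atLeastAtMost] r(1)] .
        then obtain i where i: "i \<in> {1..l} - {j}" "r dvd P i ^ (ex i - 1)" by blast
        then have "r dvd P i" using r(1) prime_dvd_power by blast
        then have "r = P i" using r(1) Pp(1)[of i] i(1) primes_dvd_imp_eq by blast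
        then show ?thesis using i(1) by blast
      qed
      \<comment> \<open>The \<open>T\<close>-th power lifts -1 from the modulus \<open>hh j\<close>
        to \<open>n j = hh j * T\<close>, and keeps the sign because \<open>T\<close> is
        odd.\<close>
      have "[(int p ^ s) ^ T = (- 1) ^ T] (mod int (hh j * T))"
      proof (rule power_cong_lift[OF s])
        show "T > 0" unfolding T_def using P2 by (intro prod_pos) (metis DiffD1 gr_implies_not0 gr0I power_eq_0_iff)
        fix r assume "prime r" "r dvd T"
        then obtain i where i: "i \<in> {1..l} - {j}" "r = P i" using prT by blast
        show "r dvd hh j" unfolding hh_def[rule_format, OF j] i(2) by (rule dvd_prodI) (use i(1) in auto)
      qed
      moreover have "odd T"
      proof
        assume "even T"
        then have "\<exists>i\<in>{1..l} - {j}. 2 = P i" by (intro prT) simp_all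
        then obtain i where "i \<in> {1..l} - {j}" "2 = P i" by blast
        then show False using Pp(2)[of i] by auto
      qed
      ultimately have "[int p ^ (s * T) = - 1] (mod int (n j))"
        unfolding n_eq(2)[OF j] T_def[symmetric] by (simp add: power_mult)
      then have "int (n j) dvd int (p ^ (s * T) + 1)" by (simp add: cong_iff_dvd_diff add.commute)
      then have "n j dvd p ^ (s * T) + 1" by (simp only: int_dvd_int_iff)
      then show ?thesis unfolding n_eq(1)[OF j] by blast
    qed
  qed
  then interpret tower \<gamma> p f P ex l m d h k M .
  have "D = Dset 0"
  proof -
    have upto: "{0..N - 1} = {..<N}" if "N > 0" for N :: nat using that by auto
    have "{0..P j ^ (ex j - 1) - 1} = {..<P j ^ (ex j - 1)}" if "j \<in> {1..m}" for j
      by (rule upto) (use P2[of j] that m_range in simp)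
    then have "(\<Pi>\<^sub>E j\<in>{1..m}. {0..P j ^ (ex j - 1) - 1}) = shifts"
      unfolding shifts_def by (rule PiE_cong)
    moreover have "(\<Sum>j\<in>{1..m}. t j * n j) = shift_of t" for t
      unfolding shift_of_def cofac_def by (rule sum.cong) (simp_all add: n_eq(1))
    ultimately show ?thesis unfolding D_def Dset_cyclotomic by simp
  qed
  moreover have "strongly_regular (cayley_graph (Dset 0))"
    by (rule srg_lift[OF prim1 _ srg]) (simp add: card_a q1_def)
  ultimately show ?thesis by simp
qed

end
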